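(* Let $k$ be an algebraically closed field (of any characteristic), $G$ a finite group, and $V$ a finite-dimensional faithful representation of $G$ over $k$. Write $D_{\mathrm{span}}=D_{\mathrm{span}}(G,V)$. Then there exists a $kG$-module direct summand $V_{\mathrm{reg}}$ of $k[V]_{\leq D_{\mathrm{span}}}$ such that: (1) $V_{\mathrm{reg}}$ is isomorphic to the regular representation of $G$ over $k$; (2) $V_{\mathrm{reg}}$ is graded as a $k$-subspace of $k[V]_{\leq D_{\mathrm{span}}}$, i.e. it is the direct sum of its intersections with the homogeneous components $k[V]_d$, $0\le d\le D_{\mathrm{span}}$; (3) any $k$-basis of $V_{\mathrm{reg}}$ is also a $k(V)^G$-basis of $k(V)$.
   Context: $k[V]$ is the ring of polynomial functions on $V$ (the symmetric algebra of $V^*$), graded by degree, with $G$-action $(gf)(v)=f(g^{-1}v)$; $k(V)$ is its fraction field and $k(V)^G$ the field of $G$-invariant rational functions. $k[V]_{d}$ is the space of homogeneous polynomials of degree $d$ and $k[V]_{\le d}$ the space of polynomials of degree at most $d$. The spanning degree $D_{\mathrm{span}}(G,V)$ is the minimum $d\in\mathbb{N}=\{0,1,2,\dots\}$ such that $k[V]_{\le d}$ spans $k(V)$ as a vector space over $k(V)^G$. *)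

theory Defs
  imports
    "HOL-Computational_Algebra.Polynomial"
    "HOL-Library.Function_Algebras"
    "HOL-Algebra.Embedded_Algebras"
    "HOL-Algebra.Group_Action"
begin

section \<open>The space of all functions on a set, as a vector space\<close>

definition fscale :: "'k::field \<Rightarrow> ('x \<Rightarrow> 'k) \<Rightarrow> 'x \<Rightarrow> 'k" where
  "fscale c f = (\<lambda>x. c * f x)"

global_interpretation fun_space: vector_space "fscale :: 'k::field \<Rightarrow> ('x \<Rightarrow> 'k) \<Rightarrow> 'x \<Rightarrow> 'k"
  by unfold_locales (auto simp: fscale_def fun_eq_iff algebra_simps)

section \<open>Polynomial functions\<close>

text \<open>
  Sums and products of functions are pointwise. A vector space \<open>V\<close> over \<open>k\<close> is a type
  with a scalar multiplication \<open>scale\<close>. Since \<open>k\<close> will be algebraically closed, hence infinite,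
  the symmetric algebra of \<open>V\<^sup>*\<close> is the ring of polynomial functions, and its degree \<open>d\<close>
  component is spanned by the products of \<open>d\<close> linear functionals (for \<open>d = 0\<close>, by the constant 1).
\<close>

definition hom_poly_funs :: "('k::field \<Rightarrow> 'v::ab_group_add \<Rightarrow> 'v) \<Rightarrow> nat \<Rightarrow> ('v \<Rightarrow> 'k) set" where
  "hom_poly_funs scale d =
     fun_space.span {\<Prod>i<d. l i | l. \<forall>i<d. Vector_Spaces.linear scale (*) (l i)}"

definition poly_funs_le :: "('k::field \<Rightarrow> 'v::ab_group_add \<Rightarrow> 'v) \<Rightarrow> nat \<Rightarrow> ('v \<Rightarrow> 'k) set" where
  "poly_funs_le scale d = fun_space.span (\<Union>e\<le>d. hom_poly_funs scale e)"

definition poly_funs :: "('k::field \<Rightarrow> 'v::ab_group_add \<Rightarrow> 'v) \<Rightarrow> ('v \<Rightarrow> 'k) set" where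
  "poly_funs scale = fun_space.span (\<Union>e. hom_poly_funs scale e)"

definition poly_fun_ring :: "('k::field \<Rightarrow> 'v::ab_group_add \<Rightarrow> 'v) \<Rightarrow> ('v \<Rightarrow> 'k) ring" where
  "poly_fun_ring scale =
     \<lparr>carrier = poly_funs scale, mult = (*), one = 1, zero = 0, add = (+)\<rparr>"

definition fun_act :: "('g, 'm) monoid_scheme \<Rightarrow> ('g \<Rightarrow> 'v \<Rightarrow> 'v) \<Rightarrow> 'g \<Rightarrow> ('v \<Rightarrow> 'k) \<Rightarrow> 'v \<Rightarrow> 'k" where
  "fun_act G \<rho> g f = (\<lambda>v. f (\<rho> (inv\<^bsub>G\<^esub> g) v))"

section \<open>The fraction field of a domain\<close>

text \<open>A fraction \<open>a/b\<close> is the class of all pairs \<open>(c, d)\<close> with \<open>d \<noteq> 0\<close> and \<open>a d = c b\<close>.\<close>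

definition frac_rel :: "('a, 'm) ring_scheme \<Rightarrow> (('a \<times> 'a) \<times> ('a \<times> 'a)) set" where
  "frac_rel R = {((a, b), (c, d)) | a b c d.
     a \<in> carrier R \<and> c \<in> carrier R \<and> b \<in> carrier R - {\<zero>\<^bsub>R\<^esub>} \<and> d \<in> carrier R - {\<zero>\<^bsub>R\<^esub>} \<and>
     a \<otimes>\<^bsub>R\<^esub> d = c \<otimes>\<^bsub>R\<^esub> b}"

definition frac_class :: "('a, 'm) ring_scheme \<Rightarrow> 'a \<Rightarrow> 'a \<Rightarrow> ('a \<times> 'a) set" where
  "frac_class R a b = frac_rel R `` {(a, b)}"

text \<open>
  The unions below do not depend on representatives: all sets in each union coincide.
\<close>

definition frac_field :: "('a, 'm) ring_scheme \<Rightarrow> ('a \<times> 'a) set ring" where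
  "frac_field R =
     \<lparr>carrier = (carrier R \<times> (carrier R - {\<zero>\<^bsub>R\<^esub>})) // frac_rel R,
      mult = (\<lambda>X Y. \<Union>(a, b)\<in>X. \<Union>(c, d)\<in>Y. frac_class R (a \<otimes>\<^bsub>R\<^esub> c) (b \<otimes>\<^bsub>R\<^esub> d)),
      one = frac_class R \<one>\<^bsub>R\<^esub> \<one>\<^bsub>R\<^esub>,
      zero = frac_class R \<zero>\<^bsub>R\<^esub> \<one>\<^bsub>R\<^esub>,
      add = (\<lambda>X Y. \<Union>(a, b)\<in>X. \<Union>(c, d)\<in>Y.
               frac_class R ((a \<otimes>\<^bsub>R\<^esub> d) \<oplus>\<^bsub>R\<^esub> (c \<otimes>\<^bsub>R\<^esub> b)) (b \<otimes>\<^bsub>R\<^esub> d))\<rparr>"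

text \<open>The embedding of \<open>R\<close> into its fraction field.\<close>

definition frac_emb :: "('a, 'm) ring_scheme \<Rightarrow> 'a \<Rightarrow> ('a \<times> 'a) set" where
  "frac_emb R a = frac_class R a \<one>\<^bsub>R\<^esub>"

text \<open>The map of the fraction field induced by an automorphism \<open>\<sigma>\<close> of \<open>R\<close>.\<close>

definition frac_map :: "('a, 'm) ring_scheme \<Rightarrow> ('a \<Rightarrow> 'a) \<Rightarrow> ('a \<times> 'a) set \<Rightarrow> ('a \<times> 'a) set" where
  "frac_map R \<sigma> X = (\<Union>(a, b)\<in>X. frac_class R (\<sigma> a) (\<sigma> b))"

section \<open>Rational functions and invariants\<close>

definition rat_fun_field ::
  "('k::field \<Rightarrow> 'v::ab_group_add \<Rightarrow> 'v) \<Rightarrow> (('v \<Rightarrow> 'k) \<times> ('v \<Rightarrow> 'k)) set ring" where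
  "rat_fun_field scale = frac_field (poly_fun_ring scale)"

definition invariant_field ::
  "('g, 'm) monoid_scheme \<Rightarrow> ('k::field \<Rightarrow> 'v::ab_group_add \<Rightarrow> 'v) \<Rightarrow> ('g \<Rightarrow> 'v \<Rightarrow> 'v) \<Rightarrow>
     (('v \<Rightarrow> 'k) \<times> ('v \<Rightarrow> 'k)) set set" where
  "invariant_field G scale \<rho> =
     {x \<in> carrier (rat_fun_field scale).
        \<forall>g\<in>carrier G. frac_map (poly_fun_ring scale) (fun_act G \<rho> g) x = x}"

section \<open>Spanning sets and bases over a subfield\<close>

text \<open>The library notions for subfields concern finite lists; these are the versions for sets.\<close>

definition spans_over :: "('a, 'm) ring_scheme \<Rightarrow> 'a set \<Rightarrow> 'a set \<Rightarrow> bool" where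
  "spans_over L F S \<longleftrightarrow>
     S \<subseteq> carrier L \<and> (\<forall>x\<in>carrier L. \<exists>us. set us \<subseteq> S \<and> x \<in> ring.Span L F us)"

definition independent_over :: "('a, 'm) ring_scheme \<Rightarrow> 'a set \<Rightarrow> 'a set \<Rightarrow> bool" where
  "independent_over L F S \<longleftrightarrow>
     (\<forall>us. distinct us \<and> set us \<subseteq> S \<longrightarrow> ring.independent L F us)"

definition basis_over :: "('a, 'm) ring_scheme \<Rightarrow> 'a set \<Rightarrow> 'a set \<Rightarrow> bool" where
  "basis_over L F S \<longleftrightarrow> spans_over L F S \<and> independent_over L F S"

definition fun_basis :: "('x \<Rightarrow> 'k::field) set \<Rightarrow> ('x \<Rightarrow> 'k) set \<Rightarrow> bool" where
  "fun_basis U B \<longleftrightarrow> fun_space.independent B \<and> fun_space.span B = U"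

section \<open>The spanning degree\<close>

definition spanning_degree ::
  "('g, 'm) monoid_scheme \<Rightarrow> ('k::field \<Rightarrow> 'v::ab_group_add \<Rightarrow> 'v) \<Rightarrow> ('g \<Rightarrow> 'v \<Rightarrow> 'v) \<Rightarrow> nat" where
  "spanning_degree G scale \<rho> =
     (LEAST d. spans_over (rat_fun_field scale) (invariant_field G scale \<rho>)
                 (frac_emb (poly_fun_ring scale) ` poly_funs_le scale d))"

section \<open>Modules over the group algebra inside function spaces\<close>

definition kG_submodule ::
  "('g, 'm) monoid_scheme \<Rightarrow> ('g \<Rightarrow> ('x \<Rightarrow> 'k::field) \<Rightarrow> 'x \<Rightarrow> 'k) \<Rightarrow> ('x \<Rightarrow> 'k) set \<Rightarrow> bool" where
  "kG_submodule G act U \<longleftrightarrow>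
     fun_space.subspace U \<and> (\<forall>g\<in>carrier G. \<forall>u\<in>U. act g u \<in> U)"

definition kG_direct_summand ::
  "('g, 'm) monoid_scheme \<Rightarrow> ('g \<Rightarrow> ('x \<Rightarrow> 'k::field) \<Rightarrow> 'x \<Rightarrow> 'k) \<Rightarrow>
     ('x \<Rightarrow> 'k) set \<Rightarrow> ('x \<Rightarrow> 'k) set \<Rightarrow> bool" where
  "kG_direct_summand G act U M \<longleftrightarrow>
     kG_submodule G act U \<and>
     (\<exists>W. kG_submodule G act W \<and> U \<inter> W = {0} \<and> M = {u + w | u w. u \<in> U \<and> w \<in> W})"

definition kG_isomorphic ::
  "('g, 'm) monoid_scheme \<Rightarrow>
     ('g \<Rightarrow> ('x \<Rightarrow> 'k::field) \<Rightarrow> 'x \<Rightarrow> 'k) \<Rightarrow> ('x \<Rightarrow> 'k) set \<Rightarrow>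
     ('g \<Rightarrow> ('y \<Rightarrow> 'k) \<Rightarrow> 'y \<Rightarrow> 'k) \<Rightarrow> ('y \<Rightarrow> 'k) set \<Rightarrow> bool" where
  "kG_isomorphic G act U act' U' \<longleftrightarrow>
     (\<exists>\<phi>. bij_betw \<phi> U U' \<and>
        (\<forall>u\<in>U. \<forall>w\<in>U. \<phi> (u + w) = \<phi> u + \<phi> w) \<and>
        (\<forall>c. \<forall>u\<in>U. \<phi> (fscale c u) = fscale c (\<phi> u)) \<and>
        (\<forall>g\<in>carrier G. \<forall>u\<in>U. \<phi> (act g u) = act' g (\<phi> u)))"

text \<open>
  The regular representation is the group algebra \<open>kG\<close> with left multiplication. An element
  \<open>\<Sum>h. a h \<sqdot> h\<close> is its coefficient function \<open>a\<close>, extended by 0 outside the carrier, so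
  that the coefficient of \<open>x\<close> in \<open>g \<sqdot> (\<Sum>h. a h \<sqdot> h)\<close> is \<open>a (g\<^sup>-\<^sup>1 x)\<close>.
\<close>

definition regular_space :: "('g, 'm) monoid_scheme \<Rightarrow> ('g \<Rightarrow> 'k::field) set" where
  "regular_space G = {a. \<forall>x. x \<notin> carrier G \<longrightarrow> a x = 0}"

definition regular_act :: "('g, 'm) monoid_scheme \<Rightarrow> 'g \<Rightarrow> ('g \<Rightarrow> 'k::field) \<Rightarrow> 'g \<Rightarrow> 'k" where
  "regular_act G g a = (\<lambda>x. if x \<in> carrier G then a (inv\<^bsub>G\<^esub> g \<otimes>\<^bsub>G\<^esub> x) else 0)"

text \<open>\<open>U\<close> is the internal direct sum of its subspaces \<open>C i\<close>, for \<open>i\<close> in the finite set \<open>I\<close>.\<close>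

definition internal_direct_sum ::
  "('x \<Rightarrow> 'k::field) set \<Rightarrow> 'i set \<Rightarrow> ('i \<Rightarrow> ('x \<Rightarrow> 'k) set) \<Rightarrow> bool" where
  "internal_direct_sum U I C \<longleftrightarrow>
     (\<forall>i\<in>I. fun_space.subspace (C i) \<and> C i \<subseteq> U) \<and>
     (\<forall>u\<in>U. \<exists>!h. h \<in> (\<Pi>\<^sub>E i\<in>I. C i) \<and> u = (\<Sum>i\<in>I. h i))"

end

theory Submission
  imports Defs "Jordan_Normal_Form.Determinant"
begin

text \<open>
  Evaluation along the orbit of a point \<open>v\<close>, \<open>m \<mapsto> (x \<mapsto> m (x v))\<close>, is a \<open>kG\<close>-linear map from
  polynomial functions to \<open>kG\<close>. If polynomials of degree at most \<open>D\<close> span \<open>k(V)\<close> over \<open>k(V)\<^sup>G\<close>,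
  then this map is onto for a generic \<open>v\<close>: write polynomials that interpolate on a free orbit as
  \<open>k(V)\<^sup>G\<close>-combinations of polynomials of degree at most \<open>D\<close>, and avoid the zeros of the invariant
  denominators and of the determinant \<open>det (g b)\<close> of the interpolating family. So everything happens
  over \<open>k\<close>. The surjection splits, because \<open>kG\<close> is free, and the homogeneous components \<open>s\<^sub>d\<close> of a
  section \<open>s\<close> satisfy \<open>\<Sum>\<^sub>d f s\<^sub>d = id\<close>. Applying the Fitting decomposition \<open>P = A \<oplus> B\<close> of \<open>P = kG\<close> to one
  \<open>T = f s\<^sub>d\<close>, \<open>T\<close> is bijective on \<open>A\<close> and \<open>1 - T\<close> is bijective on \<open>B\<close>, so \<open>A\<close> lifts into degree
  \<open>d\<close> and \<open>B\<close> is treated by induction using the other degrees. The kernel of evaluation is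
  a complement of the resulting graded lift of \<open>kG\<close>. A \<open>k\<close>-basis of this lift has
  nonzero determinant \<open>det (g b)\<close>, and Cramer's rule together with the uniqueness of solutions makes it a basis of
  \<open>k(V)\<close> over \<open>k(V)\<^sup>G\<close>.
\<close>

section \<open>Representations on function spaces and Fitting decomposition\<close>

text \<open>The resulting section mixes degrees. Its homogeneous components are equivariant, but the
  endomorphisms \<open>f s_d\<close> of kG that they induce merely add up to the identity: they are
  not projections and need not commute. Fitting's lemma extracts a decomposition from a single one
  of them. On its nilpotent part \<open>1 - T\<close> is invertible, so there the other degrees
  still suffice, after renormalising by the inverse of \<open>1 - T\<close>. Descent from k(V)^G to
  k rests on invariants being constant on orbits: after evaluation along one orbit they are scalars.
  The order of \<open>G\<close> occurs both as the dimension of kG and as the number of points of a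
  free orbit, and this is what makes the matrix of values \<open>b (g v)\<close> square.\<close>

definition linear_on :: "('x \<Rightarrow> 'k::field) set \<Rightarrow> (('x \<Rightarrow> 'k) \<Rightarrow> 'y \<Rightarrow> 'k) \<Rightarrow> bool" where
  "linear_on U \<phi> \<longleftrightarrow>
     (\<forall>u\<in>U. \<forall>w\<in>U. \<phi> (u + w) = \<phi> u + \<phi> w) \<and> (\<forall>c. \<forall>u\<in>U. \<phi> (fscale c u) = fscale c (\<phi> u))"

global_interpretation fun_pair: vector_space_pair
  "fscale :: 'k::field \<Rightarrow> ('x \<Rightarrow> 'k) \<Rightarrow> 'x \<Rightarrow> 'k"
  "fscale :: 'k::field \<Rightarrow> ('y \<Rightarrow> 'k) \<Rightarrow> 'y \<Rightarrow> 'k" ..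

lemma linear_on_subset: "linear_on U \<phi> \<Longrightarrow> U' \<subseteq> U \<Longrightarrow> linear_on U' \<phi>"
  unfolding linear_on_def by blast

text \<open>Modules are subsets of function types, so equivariant maps are only controlled there;
  this passes to a total linear map, to which bases and dimension apply. Values on a basis of
  \<open>U\<close> determine the extension, because the locus of agreement is a subspace.\<close>

lemma linear_on_extend:
  assumes U: "fun_space.subspace U" and \<phi>: "linear_on U \<phi>"
  obtains \<psi> where "Vector_Spaces.linear fscale fscale \<psi>" "\<And>u. u \<in> U \<Longrightarrow> \<psi> u = \<phi> u"
proof -
  obtain B where B: "B \<subseteq> U" "fun_space.independent B" "U \<subseteq> fun_space.span B"
    using fun_space.basis_exists[of U] by metis
  let ?\<psi> = "fun_pair.construct B \<phi>"
  have lin: "Vector_Spaces.linear fscale fscale ?\<psi>"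
    by (rule fun_pair.linear_construct[OF B(2)])
  interpret l: Vector_Spaces.linear fscale fscale ?\<psi> by (rule lin)
  have "\<phi> (fscale 0 0) = fscale 0 (\<phi> 0)"
    using \<phi> fun_space.subspace_0[OF U] unfolding linear_on_def by blast
  hence \<phi>0: "\<phi> 0 = 0" by (simp only: fun_space.scale_zero_left)
  have "fun_space.subspace {u \<in> U. ?\<psi> u = \<phi> u}"
    using \<phi> U unfolding fun_space.subspace_def linear_on_def
    by (auto simp: l.add l.scale l.zero \<phi>0 simp del: zero_fun_apply)
  moreover have "B \<subseteq> {u \<in> U. ?\<psi> u = \<phi> u}"
    using B(1) fun_pair.construct_basis[OF B(2)] by blast
  ultimately have "fun_space.span B \<subseteq> {u \<in> U. ?\<psi> u = \<phi> u}" by (rule fun_space.span_minimal[rotated])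
  thus ?thesis using that[of ?\<psi>] lin B(3) by blast
qed

lemma linear_on_zero:
  assumes "fun_space.subspace U" "linear_on U \<phi>"
  shows "\<phi> 0 = 0"
proof -
  obtain \<psi> where \<psi>: "Vector_Spaces.linear fscale fscale \<psi>" "\<And>u. u \<in> U \<Longrightarrow> \<psi> u = \<phi> u"
    using linear_on_extend[OF assms] by blast
  interpret l: Vector_Spaces.linear fscale fscale \<psi> by (rule \<psi>(1))
  show ?thesis using \<psi>(2)[OF fun_space.subspace_0[OF assms(1)]] l.zero by (simp only:)
qed

lemma linear_on_diff:
  assumes "fun_space.subspace U" "linear_on U \<phi>" "u \<in> U" "w \<in> U"
  shows "\<phi> (u - w) = \<phi> u - \<phi> w"
proof -
  obtain \<psi> where \<psi>: "Vector_Spaces.linear fscale fscale \<psi>" "\<And>u. u \<in> U \<Longrightarrow> \<psi> u = \<phi> u"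
    using linear_on_extend[OF assms(1,2)] by blast
  interpret l: Vector_Spaces.linear fscale fscale \<psi> by (rule \<psi>(1))
  show ?thesis
    using \<psi>(2)[OF fun_space.subspace_diff[OF assms(1,3,4)]] \<psi>(2)[OF assms(3)] \<psi>(2)[OF assms(4)] l.diff
    by (simp only:)
qed

lemma linear_on_sum:
  assumes "fun_space.subspace U" "linear_on U \<phi>" "\<And>i. i \<in> I \<Longrightarrow> u i \<in> U"
  shows "\<phi> (\<Sum>i\<in>I. u i) = (\<Sum>i\<in>I. \<phi> (u i))"
proof -
  obtain \<psi> where \<psi>: "Vector_Spaces.linear fscale fscale \<psi>" "\<And>u. u \<in> U \<Longrightarrow> \<psi> u = \<phi> u"
    using linear_on_extend[OF assms(1,2)] by blast
  interpret l: Vector_Spaces.linear fscale fscale \<psi> by (rule \<psi>(1))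
  have "\<phi> (\<Sum>i\<in>I. u i) = (\<Sum>i\<in>I. \<psi> (u i))"
    using \<psi>(2)[OF fun_space.subspace_sum[OF assms(1,3)], of I] l.sum[of u I] by (simp only:)
  thus ?thesis using \<psi>(2)[OF assms(3)] by (simp cong: sum.cong)
qed

lemma linear_on_image_subspace:
  assumes "fun_space.subspace U" "linear_on U \<phi>"
  shows "fun_space.subspace (\<phi> ` U)"
proof -
  obtain \<psi> where \<psi>: "Vector_Spaces.linear fscale fscale \<psi>" "\<And>u. u \<in> U \<Longrightarrow> \<psi> u = \<phi> u"
    using linear_on_extend[OF assms] by blast
  have "\<phi> ` U = \<psi> ` U" using \<psi>(2) by force
  thus ?thesis using fun_pair.linear_subspace_image[OF \<psi>(1) assms(1)] by simp
qed

lemma linear_on_inj_onI: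
  assumes "fun_space.subspace U" "linear_on U \<phi>" "\<And>u. u \<in> U \<Longrightarrow> \<phi> u = 0 \<Longrightarrow> u = 0"
  shows "inj_on \<phi> U"
proof (rule inj_onI)
  fix x y assume xy: "x \<in> U" "y \<in> U" "\<phi> x = \<phi> y"
  hence "\<phi> (x - y) = 0" using linear_on_diff[OF assms(1,2)] by simp
  thus "x = y" using assms(3)[of "x - y"] fun_space.subspace_diff[OF assms(1)] xy by simp
qed

lemma fd_subspace_basis:
  assumes "fun_space.subspace U" "finite S" "U \<subseteq> fun_space.span S"
  obtains B where "finite B" "fun_space.independent B" "fun_space.span B = U"
proof -
  obtain B where B: "B \<subseteq> U" "fun_space.independent B" "U \<subseteq> fun_space.span B"
    using fun_space.basis_exists[of U] by metis
  have "finite B" using fun_space.independent_span_bound[OF assms(2) B(2)] B(1) assms(3) by auto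
  moreover have "fun_space.span B = U" using B fun_space.span_minimal[OF B(1) assms(1)] by auto
  ultimately show ?thesis using that B by blast
qed

text \<open>Dimension count: an injective endomorphism sends a basis \<open>B\<close> to an
  independent set of the same size, and a vector outside the image would enlarge that set beyond
  \<open>card B\<close>.\<close>

lemma linear_on_inj_imp_surj:
  assumes U: "fun_space.subspace U" "finite S" "U \<subseteq> fun_space.span S"
    and \<phi>: "linear_on U \<phi>" "\<phi> ` U \<subseteq> U" "inj_on \<phi> U"
  shows "bij_betw \<phi> U U"
proof -
  obtain \<psi> where \<psi>: "Vector_Spaces.linear fscale fscale \<psi>" "\<And>u. u \<in> U \<Longrightarrow> \<psi> u = \<phi> u"
    using linear_on_extend[OF U(1) \<phi>(1)] by blast
  obtain B where B: "finite B" "fun_space.independent B" "fun_space.span B = U"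
    using fd_subspace_basis[OF U] by metis
  have eq: "\<phi> ` U = \<psi> ` U" using \<psi>(2) by force
  have injU: "inj_on \<psi> (fun_space.span B)" unfolding B(3) using \<phi>(3) inj_on_cong[of U \<psi> \<phi>] \<psi>(2) by blast
  have ind: "fun_space.independent (\<psi> ` B)"
    using fun_pair.linear_independent_injective_image[OF \<psi>(1) B(2) injU] .
  have "inj_on \<psi> B" using injU fun_space.span_superset inj_on_subset by blast
  hence card: "card (\<psi> ` B) = card B" by (rule card_image)
  have sp: "fun_space.span (\<psi> ` B) = \<psi> ` U"
    using fun_pair.linear_span_image[OF \<psi>(1), of B] B(3) by simp
  have "U \<subseteq> \<phi> ` U"
  proof
    fix x assume x: "x \<in> U"
    show "x \<in> \<phi> ` U"
    proof (rule ccontr)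
      assume n: "x \<notin> \<phi> ` U"
      hence n': "x \<notin> fun_space.span (\<psi> ` B)" using sp eq by simp
      have "fun_space.independent (insert x (\<psi> ` B))"
        using fun_space.independent_insertI[OF n' ind] .
      moreover have "insert x (\<psi> ` B) \<subseteq> fun_space.span B"
        using x B(3) \<phi>(2) eq fun_space.span_superset[of B] by auto
      ultimately have "card (insert x (\<psi> ` B)) \<le> card B"
        using fun_space.independent_span_bound[OF B(1)] by blast
      moreover have "x \<notin> \<psi> ` B" using n' fun_space.span_superset by blast
      ultimately show False using card B(1) by simp
    qed
  qed
  thus ?thesis using \<phi> by (auto simp: bij_betw_def)
qed

section \<open>Equivariant maps, projections and the Fitting decomposition\<close>

definition kG_hom ::
  "('g, 'm) monoid_scheme \<Rightarrow>
     ('g \<Rightarrow> ('x \<Rightarrow> 'k::field) \<Rightarrow> 'x \<Rightarrow> 'k) \<Rightarrow> ('x \<Rightarrow> 'k) set \<Rightarrow>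
     ('g \<Rightarrow> ('y \<Rightarrow> 'k) \<Rightarrow> 'y \<Rightarrow> 'k) \<Rightarrow> ('y \<Rightarrow> 'k) set \<Rightarrow> (('x \<Rightarrow> 'k) \<Rightarrow> 'y \<Rightarrow> 'k) \<Rightarrow> bool" where
  "kG_hom G act U act' W \<phi> \<longleftrightarrow>
     \<phi> ` U \<subseteq> W \<and> linear_on U \<phi> \<and> (\<forall>g\<in>carrier G. \<forall>u\<in>U. \<phi> (act g u) = act' g (\<phi> u))"

lemma kG_hom_subset:
  "kG_hom G act U act' W \<phi> \<Longrightarrow> U' \<subseteq> U \<Longrightarrow> \<phi> ` U' \<subseteq> W' \<Longrightarrow> kG_hom G act U' act' W' \<phi>"
  unfolding kG_hom_def by (meson linear_on_subset subsetD)

lemma kG_hom_comp: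
  assumes "kG_hom G act U act' W \<phi>" "kG_hom G act' W act'' X \<psi>"
  shows "kG_hom G act U act'' X (\<lambda>u. \<psi> (\<phi> u))"
proof -
  have "\<phi> u \<in> W" if "u \<in> U" for u using assms(1) that unfolding kG_hom_def by blast
  thus ?thesis using assms unfolding kG_hom_def linear_on_def by auto
qed

lemma kG_hom_image:
  assumes "kG_submodule G act U" "kG_hom G act U act' W \<phi>"
  shows "kG_submodule G act' (\<phi> ` U)"
proof -
  have "act' g (\<phi> u) \<in> \<phi> ` U" if "g \<in> carrier G" "u \<in> U" for g u
  proof -
    have "act' g (\<phi> u) = \<phi> (act g u)" using assms(2) that unfolding kG_hom_def by (simp only:)
    thus ?thesis using assms(1) that unfolding kG_submodule_def by blast
  qed
  thus ?thesis using assms linear_on_image_subspace[of U \<phi>] unfolding kG_hom_def kG_submodule_def by blast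
qed

lemma kG_hom_id_minus:
  assumes "kG_submodule G act U" "\<And>g. g \<in> carrier G \<Longrightarrow> linear_on UNIV (act g)" "kG_hom G act U act U T"
  shows "kG_hom G act U act U (\<lambda>u. u - T u)"
proof -
  have U: "fun_space.subspace U" using assms(1) by (simp add: kG_submodule_def)
  have "act g (u - T u) = act g u - act g (T u)" if "g \<in> carrier G" for g u
    using linear_on_diff[OF fun_space.subspace_UNIV assms(2)[OF that]] by simp
  thus ?thesis using assms(3) fun_space.subspace_diff[OF U] unfolding kG_hom_def linear_on_def
    by (auto simp: fun_space.scale_right_diff_distrib)
qed

lemma kG_hom_inv_into:
  assumes U: "kG_submodule G act U" and \<phi>: "kG_hom G act U act' W \<phi>" and bij: "bij_betw \<phi> U W"
  shows "kG_hom G act' W act U (inv_into U \<phi>)"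
proof -
  have inj: "inj_on \<phi> U" and im: "\<phi> ` U = W" using bij by (auto simp: bij_betw_def)
  let ?\<psi> = "inv_into U \<phi>"
  have sub: "fun_space.subspace U" using U by (simp add: kG_submodule_def)
  have 1: "?\<psi> (\<phi> u) = u" if "u \<in> U" for u using inj that by simp
  show ?thesis unfolding kG_hom_def linear_on_def im[symmetric]
  proof (intro conjI ballI allI)
    show "?\<psi> ` \<phi> ` U \<subseteq> U" using 1 by auto
  next
    fix x y assume "x \<in> \<phi> ` U" "y \<in> \<phi> ` U"
    then obtain u w where u: "u \<in> U" "w \<in> U" "x = \<phi> u" "y = \<phi> w" by blast
    have "?\<psi> (x + y) = ?\<psi> (\<phi> (u + w))" using \<phi> u unfolding kG_hom_def linear_on_def by simp
    thus "?\<psi> (x + y) = ?\<psi> x + ?\<psi> y" using 1 u fun_space.subspace_add[OF sub] by simp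
  next
    fix c x assume "x \<in> \<phi> ` U"
    then obtain u where u: "u \<in> U" "x = \<phi> u" by blast
    have "?\<psi> (fscale c x) = ?\<psi> (\<phi> (fscale c u))" using \<phi> u unfolding kG_hom_def linear_on_def by simp
    thus "?\<psi> (fscale c x) = fscale c (?\<psi> x)" using 1 u fun_space.subspace_scale[OF sub] by simp
  next
    fix g x assume g: "g \<in> carrier G" and "x \<in> \<phi> ` U"
    then obtain u where u: "u \<in> U" "x = \<phi> u" by blast
    have "?\<psi> (act' g x) = ?\<psi> (\<phi> (act g u))" using \<phi> u g unfolding kG_hom_def by simp
    thus "?\<psi> (act' g x) = act g (?\<psi> x)" using 1 u U g unfolding kG_submodule_def by simp
  qed
qed

text \<open>The component in \<open>B\<close> is unique because \<open>A\<close> and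
  \<open>B\<close> meet only in 0; equivariance follows since the action is additive and preserves
  both summands.\<close>

lemma kG_direct_sum_projection:
  assumes A: "kG_submodule G act A" and B: "kG_submodule G act B" and AB: "A \<inter> B = {0}"
    and P: "P = {a + b | a b. a \<in> A \<and> b \<in> B}"
    and act: "\<And>g. g \<in> carrier G \<Longrightarrow> linear_on UNIV (act g)"
  obtains \<pi> where "kG_hom G act P act B \<pi>" "\<And>a. a \<in> A \<Longrightarrow> \<pi> a = 0" "\<And>b. b \<in> B \<Longrightarrow> \<pi> b = b"
    "\<And>p. p \<in> P \<Longrightarrow> p - \<pi> p \<in> A"
proof -
  have sA: "fun_space.subspace A" and sB: "fun_space.subspace B"
    using A B by (simp_all add: kG_submodule_def)
  have uniq: "b = b'" if "a \<in> A" "b \<in> B" "a' \<in> A" "b' \<in> B" "a + b = a' + b'" for a b a' b'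
  proof -
    have "b - b' = a' - a" using that(5) by (simp add: algebra_simps)
    hence "b - b' \<in> A \<inter> B"
      using fun_space.subspace_diff[OF sA that(3,1)] fun_space.subspace_diff[OF sB that(2,4)] by simp
    thus ?thesis using AB by simp
  qed
  define \<pi> where "\<pi> p = (THE b. b \<in> B \<and> (\<exists>a\<in>A. p = a + b))" for p
  have \<pi>: "\<pi> (a + b) = b" if "a \<in> A" "b \<in> B" for a b
    unfolding \<pi>_def by (rule the_equality) (use that uniq in blast)+
  have z: "0 \<in> A" "0 \<in> B" using sA sB fun_space.subspace_0 by blast+
  show ?thesis
  proof (rule that[of \<pi>])
    show "\<pi> a = 0" if "a \<in> A" for a using \<pi>[OF that z(2)] by simp
    show "\<pi> b = b" if "b \<in> B" for b using \<pi>[OF z(1) that] by simp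
    show "p - \<pi> p \<in> A" if "p \<in> P" for p using that \<pi> unfolding P by auto
    show "kG_hom G act P act B \<pi>"
      unfolding kG_hom_def linear_on_def
    proof (intro conjI ballI allI)
      show "\<pi> ` P \<subseteq> B" using \<pi> unfolding P by auto
    next
      fix x y assume "x \<in> P" "y \<in> P"
      then obtain a b a' b' where *: "a \<in> A" "b \<in> B" "a' \<in> A" "b' \<in> B" "x = a + b" "y = a' + b'"
        unfolding P by blast
      have "x + y = (a + a') + (b + b')" using * by (simp add: algebra_simps)
      thus "\<pi> (x + y) = \<pi> x + \<pi> y"
        using * \<pi> fun_space.subspace_add[OF sA] fun_space.subspace_add[OF sB] by metis
    next
      fix c x assume "x \<in> P"
      then obtain a b where *: "a \<in> A" "b \<in> B" "x = a + b" unfolding P by blast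
      have "fscale c x = fscale c a + fscale c b" using * by (simp add: fun_space.scale_right_distrib)
      thus "\<pi> (fscale c x) = fscale c (\<pi> x)"
        using * \<pi> fun_space.subspace_scale[OF sA] fun_space.subspace_scale[OF sB] by metis
    next
      fix g x assume g: "g \<in> carrier G" and "x \<in> P"
      then obtain a b where *: "a \<in> A" "b \<in> B" "x = a + b" unfolding P by blast
      have "act g x = act g a + act g b" using * act[OF g] unfolding linear_on_def by simp
      thus "\<pi> (act g x) = act g (\<pi> x)"
        using * \<pi> A B g unfolding kG_submodule_def by metis
    qed
  qed
qed

text \<open>\<open>A\<close> is an image of a power of \<open>T\<close> of least dimension, so
  \<open>T\<close> cannot shrink it further. \<open>B\<close> is the kernel of the same power, on
  which \<open>T\<close> is nilpotent and hence \<open>1 - T\<close> injective. Finite dimension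
  upgrades injectivity to bijectivity in both cases.\<close>

lemma kG_Fitting:
  assumes P: "kG_submodule G act P" and fd: "finite S" "P \<subseteq> fun_space.span S"
    and act: "\<And>g. g \<in> carrier G \<Longrightarrow> linear_on UNIV (act g)" and T: "kG_hom G act P act P T"
  obtains A B where "kG_submodule G act A" "kG_submodule G act B" "A \<inter> B = {0}"
    "P = {a + b | a b. a \<in> A \<and> b \<in> B}" "bij_betw T A A" "T ` B \<subseteq> B" "bij_betw (\<lambda>b. b - T b) B B"
proof -
  have sP: "fun_space.subspace P" using P by (simp add: kG_submodule_def)
  have Tn: "kG_hom G act P act P (T ^^ n)" for n
  proof (induction n)
    case 0 show ?case by (auto simp: kG_hom_def linear_on_def)
  next
    case (Suc n) show ?case using kG_hom_comp[OF Suc T] by (simp add: comp_def)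
  qed
  have Pn: "kG_submodule G act ((T ^^ n) ` P)" for n by (rule kG_hom_image[OF P Tn])
  have Psub: "(T ^^ n) ` P \<subseteq> P" for n using Tn[of n] by (simp add: kG_hom_def)
  have ex: "\<exists>n B. finite B \<and> fun_space.independent B \<and> fun_space.span B = (T ^^ n) ` P"
    using fd_subspace_basis[OF sP fd] by (metis funpow_0 image_cong image_ident)
  \<comment> \<open>The least dimension among the iterated images replaces a stabilisation argument
    for the descending chain: an \<open>n\<close> attaining it is already stable.\<close>
  define c where "c = (LEAST c. \<exists>n B. finite B \<and> fun_space.independent B \<and> fun_space.span B = (T ^^ n) ` P \<and> card B = c)"
  have "\<exists>n B. finite B \<and> fun_space.independent B \<and> fun_space.span B = (T ^^ n) ` P \<and> card B = c"
    unfolding c_def by (rule LeastI_ex) (use ex in blast)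
  then obtain n B where B: "finite B" "fun_space.independent B" "fun_space.span B = (T ^^ n) ` P" "card B = c"
    by blast
  have min: "c \<le> card B'" if "finite B'" "fun_space.independent B'" "fun_space.span B' = (T ^^ m) ` P" for B' m
    unfolding c_def by (rule Least_le) (use that in blast)
  define A where "A = (T ^^ n) ` P"
  have mA: "kG_submodule G act A" and AP: "A \<subseteq> P" unfolding A_def by (rule Pn, rule Psub)
  have sA: "fun_space.subspace A" using mA by (simp add: kG_submodule_def)
  have TA: "T ` A = (T ^^ Suc n) ` P" unfolding A_def by (auto simp: image_image)
  have TAA: "T ` A \<subseteq> A" unfolding TA A_def using T by (auto simp: kG_hom_def funpow_swap1)
  have linA: "linear_on A T" using T AP linear_on_subset unfolding kG_hom_def by blast
  obtain \<psi> where \<psi>: "Vector_Spaces.linear fscale fscale \<psi>" "\<And>u. u \<in> A \<Longrightarrow> \<psi> u = T u"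
    using linear_on_extend[OF sA linA] by blast
  have BA: "B \<subseteq> A" using B(3) fun_space.span_superset unfolding A_def by blast
  have spB: "fun_space.span (\<psi> ` B) = T ` A"
    using fun_pair.linear_span_image[OF \<psi>(1), of B] B(3) \<psi>(2) unfolding A_def by simp
  obtain C where C: "C \<subseteq> \<psi> ` B" "fun_space.independent C" "\<psi> ` B \<subseteq> fun_space.span C"
    using fun_space.basis_exists[of "\<psi> ` B"] by metis
  have spC: "fun_space.span C = T ` A"
    using spB C fun_space.span_mono[OF C(1)] fun_space.span_minimal[OF C(3) fun_space.subspace_span] by auto
  have finC: "finite C" using C(1) B(1) finite_surj by blast
  \<comment> \<open>The image under the power \<open>Suc n\<close> cannot have a smaller basis by
    minimality, so \<open>\<psi>\<close> loses no dimension on \<open>A\<close> and is injective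
    there.\<close>
  have cC: "card B \<le> card C" using min[OF finC C(2), of "Suc n"] spC TA B(4) by simp
  have "card C \<le> card (\<psi> ` B)" using C(1) B(1) by (simp add: card_mono)
  hence cB: "card (\<psi> ` B) = card B" using cC card_image_le[OF B(1), of \<psi>] by simp
  hence CB: "C = \<psi> ` B" using C(1) cC B(1) by (metis card_seteq finite_imageI)
  have "inj_on \<psi> B" using cB B(1) by (simp add: eq_card_imp_inj_on)
  hence "inj_on \<psi> A"
    using fun_pair.linear_inj_on_span_independent_image[OF \<psi>(1) C(2)[unfolded CB]]
    unfolding B(3) A_def[symmetric] by blast
  moreover have "inj_on \<psi> A = inj_on T A" by (rule inj_on_cong) (rule \<psi>(2))
  ultimately have injA: "inj_on T A" by blast
  have fdA: "A \<subseteq> fun_space.span B" using B(3) A_def by simp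
  have bijA: "bij_betw T A A" by (rule linear_on_inj_imp_surj[OF sA B(1) fdA linA TAA injA])
  have bijTn: "bij_betw (T ^^ m) A A" for m
    by (rule bij_betw_funpow[OF bijA])
  define K where "K = {p \<in> P. (T ^^ n) p = 0}"
  have linTn: "linear_on P (T ^^ n)" using Tn[of n] by (simp add: kG_hom_def)
  have Tn0: "(T ^^ n) 0 = 0" by (rule linear_on_zero[OF sP linTn])
  have act0: "act g 0 = 0" if "g \<in> carrier G" for g
    using linear_on_zero[OF fun_space.subspace_UNIV act[OF that]] .
  have sK: "fun_space.subspace K"
    unfolding fun_space.subspace_def
    using sP linTn Tn0 unfolding K_def fun_space.subspace_def linear_on_def by auto
  have mK: "kG_submodule G act K"
    using sK P Tn[of n] act0 unfolding kG_submodule_def K_def kG_hom_def by auto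
  have AK: "A \<inter> K = {0}"
  proof -
    have "a = 0" if "a \<in> A" "a \<in> K" for a
      using that bijTn[of n] Tn0 fun_space.subspace_0[OF sA] unfolding K_def bij_betw_def inj_on_def by auto
    thus ?thesis using fun_space.subspace_0[OF sA] fun_space.subspace_0[OF sK] by auto
  qed
  have PAK: "P = {a + b | a b. a \<in> A \<and> b \<in> K}"
  proof (intro equalityI subsetI)
    fix p assume p: "p \<in> P"
    \<comment> \<open>The n-th power is bijective on \<open>A\<close>, so some \<open>a\<close> in
      \<open>A\<close> has the same image as \<open>p\<close>; the difference then lies in the
      kernel.\<close>
    have "(T ^^ n) p \<in> A" using p A_def by blast
    then obtain a where a: "a \<in> A" "(T ^^ n) p = (T ^^ n) a"
      using bijTn[of n] unfolding bij_betw_def by blast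
    have "p - a \<in> K" using a p AP linear_on_diff[OF sP linTn, of p a] fun_space.subspace_diff[OF sP, of p a]
      unfolding K_def by auto
    moreover have "p = a + (p - a)" by simp
    ultimately show "p \<in> {a + b | a b. a \<in> A \<and> b \<in> K}" using a(1) by blast
  next
    fix p assume "p \<in> {a + b | a b. a \<in> A \<and> b \<in> K}"
    thus "p \<in> P" using AP fun_space.subspace_add[OF sP] unfolding K_def by blast
  qed
  have TK: "T ` K \<subseteq> K"
  proof
    fix y assume "y \<in> T ` K"
    then obtain b where b: "b \<in> P" "(T ^^ n) b = 0" "y = T b" unfolding K_def by blast
    have "(T ^^ n) (T b) = T ((T ^^ n) b)" by (simp add: funpow_swap1)
    hence "(T ^^ n) (T b) = 0" using b(2) linear_on_zero[OF sP, of T] T by (simp add: kG_hom_def)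
    thus "y \<in> K" using b T unfolding K_def kG_hom_def by auto
  qed
  have homK: "kG_hom G act K act K (\<lambda>b. b - T b)"
    by (rule kG_hom_id_minus[OF mK act]) (use kG_hom_subset[OF T _ TK] in \<open>auto simp: K_def\<close>)
  have fdK: "K \<subseteq> fun_space.span S" using fd unfolding K_def by blast
  have injK: "inj_on (\<lambda>b. b - T b) K"
  proof (rule linear_on_inj_onI[OF sK])
    show "linear_on K (\<lambda>b. b - T b)" using homK by (simp add: kG_hom_def)
    fix b assume b: "b \<in> K" "b - T b = 0"
    have Tb: "T b = b" using b(2) by (simp only: right_minus_eq)
    \<comment> \<open>A fixed point of \<open>T\<close> is fixed by every power, in particular by
      the n-th, which kills it.\<close>
    have "(T ^^ m) b = b" for m by (induction m) (simp_all add: Tb)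
    thus "b = 0" using b(1) unfolding K_def by auto
  qed
  have "bij_betw (\<lambda>b. b - T b) K K"
    by (rule linear_on_inj_imp_surj[OF sK fd(1) fdK _ _ injK]) (use homK in \<open>auto simp: kG_hom_def\<close>)
  thus ?thesis using that[OF mA mK AK PAK bijA TK] by blast
qed

text \<open>The conclusion says that the \<open>f i\<close> assemble to a bijection from the
  external direct sum of the \<open>V i\<close> onto \<open>P\<close>. Each step peels off one index
  \<open>j\<close>: the Fitting part on which \<open>f j\<close> after \<open>s j\<close> is
  invertible is lifted through \<open>s j\<close>, the rest is left to the other indices.
  \<open>P\<close> and \<open>f\<close> must vary in the induction, because the remaining part
  carries rescaled maps.\<close>

lemma graded_lift:
  fixes P :: "('y \<Rightarrow> 'k::field) set" and M :: "'i \<Rightarrow> ('x \<Rightarrow> 'k) set"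
  assumes "finite I"
    and "kG_submodule G act P" "finite S" "P \<subseteq> fun_space.span S"
    and act: "\<And>g. g \<in> carrier G \<Longrightarrow> linear_on UNIV (act g)"
    and "\<And>i. i \<in> I \<Longrightarrow> kG_submodule G act' (M i)"
    and "\<And>i. i \<in> I \<Longrightarrow> kG_hom G act P act' (M i) (s i)"
    and "\<And>i. i \<in> I \<Longrightarrow> kG_hom G act' (M i) act P (f i)"
    and "\<And>p. p \<in> P \<Longrightarrow> (\<Sum>i\<in>I. f i (s i p)) = p"
  shows "\<exists>V. (\<forall>i\<in>I. kG_submodule G act' (V i) \<and> V i \<subseteq> M i) \<and>
    (\<forall>p\<in>P. \<exists>!h. h \<in> (\<Pi>\<^sub>E i\<in>I. V i) \<and> (\<Sum>i\<in>I. f i (h i)) = p)"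
  using assms(1-4,6-)
proof (induction I arbitrary: P f s rule: finite_induct)
  \<comment> \<open>The empty sum forces \<open>p = 0\<close>, and only the empty extensional
    function qualifies.\<close>
  case empty
  thus ?case by auto
next
  case (insert j I)
  note P = insert.prems(1) and fd = insert.prems(2,3) and M = insert.prems(4)
    and s = insert.prems(5) and f = insert.prems(6) and id = insert.prems(7)
  have sP: "fun_space.subspace P" using P by (simp add: kG_submodule_def)
  define T where "T p = f j (s j p)" for p
  have T: "kG_hom G act P act P T"
    unfolding T_def using kG_hom_comp[OF s f] by blast
  obtain A B where A: "kG_submodule G act A" and B: "kG_submodule G act B" and AB: "A \<inter> B = {0}"
    and PAB: "P = {a + b | a b. a \<in> A \<and> b \<in> B}" and TA: "bij_betw T A A" and TB: "T ` B \<subseteq> B"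
    and bijB: "bij_betw (\<lambda>b. b - T b) B B"
    using kG_Fitting[OF P fd act T] by blast
  obtain \<pi> where \<pi>: "kG_hom G act P act B \<pi>" and \<pi>A: "\<And>a. a \<in> A \<Longrightarrow> \<pi> a = 0"
    and \<pi>B: "\<And>b. b \<in> B \<Longrightarrow> \<pi> b = b" and \<pi>P: "\<And>p. p \<in> P \<Longrightarrow> p - \<pi> p \<in> A"
    using kG_direct_sum_projection[OF A B AB PAB act] by blast
  have sA: "fun_space.subspace A" and sB: "fun_space.subspace B"
    using A B by (simp_all add: kG_submodule_def)
  have AP: "A \<subseteq> P" and BP: "B \<subseteq> P"
    using PAB fun_space.subspace_0[OF sA] fun_space.subspace_0[OF sB]
    by (force, force)
  \<comment> \<open>The inverse of \<open>1 - T\<close> on \<open>B\<close>. There the terms for the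
    remaining indices add up to \<open>1 - T\<close>, and composing with \<open>W\<close> restores
    the identity that the induction hypothesis requires.\<close>
  define W where "W = inv_into B (\<lambda>b. b - T b)"
  have idT: "kG_hom G act B act B (\<lambda>b. b - T b)"
    by (rule kG_hom_id_minus[OF B act kG_hom_subset[OF T BP TB]])
  have W: "kG_hom G act B act B W"
    unfolding W_def by (rule kG_hom_inv_into[OF B idT bijB])
  have injW: "inj_on W B"
    unfolding W_def by (rule bij_betw_imp_inj_on[OF bij_betw_inv_into[OF bijB]])
  \<comment> \<open>A single term \<open>f i m\<close> need not lie in \<open>B\<close>, hence the
    projection \<open>\<pi>\<close> before \<open>W\<close>.\<close>
  have W\<pi>: "kG_hom G act P act B (\<lambda>p. W (\<pi> p))" by (rule kG_hom_comp[OF \<pi> W])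
  have linW\<pi>: "linear_on P (\<lambda>p. W (\<pi> p))" and \<pi>im: "\<And>p. p \<in> P \<Longrightarrow> \<pi> p \<in> B"
    and lin\<pi>: "linear_on P \<pi>"
    using W\<pi> \<pi> unfolding kG_hom_def by blast+
  have fP: "f i m \<in> P" if "i \<in> insert j I" "m \<in> M i" for i m
    using f[OF that(1)] that(2) unfolding kG_hom_def by blast
  have sM: "s i p \<in> M i" if "i \<in> insert j I" "p \<in> P" for i p
    using s[OF that(1)] that(2) unfolding kG_hom_def by blast
  have "\<exists>V. (\<forall>i\<in>I. kG_submodule G act' (V i) \<and> V i \<subseteq> M i) \<and>
    (\<forall>p\<in>B. \<exists>!h. h \<in> (\<Pi>\<^sub>E i\<in>I. V i) \<and> (\<Sum>i\<in>I. W (\<pi> (f i (h i)))) = p)"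
  proof (rule insert.IH[where P = B and f = "\<lambda>i m. W (\<pi> (f i m))" and s = s])
    show "kG_hom G act B act' (M i) (s i)" if "i \<in> I" for i
      using that by (intro kG_hom_subset[OF s BP]) (use sM BP in blast)+
    show "kG_hom G act' (M i) act B (\<lambda>m. W (\<pi> (f i m)))" if "i \<in> I" for i
      using kG_hom_comp[OF f W\<pi>] that by blast
    fix b assume b: "b \<in> B"
    have *: "(\<Sum>i\<in>I. f i (s i b)) = b - T b"
    proof -
      have "T b + (\<Sum>i\<in>I. f i (s i b)) = b"
        using id[OF subsetD[OF BP b]] unfolding T_def sum.insert[OF insert.hyps] .
      thus ?thesis by (metis add_diff_cancel_left')
    qed
    have "(\<Sum>i\<in>I. W (\<pi> (f i (s i b)))) = W (\<pi> (\<Sum>i\<in>I. f i (s i b)))"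
      by (rule linear_on_sum[OF sP linW\<pi>, symmetric]) (use fP sM b BP in blast)
    also have "\<dots> = W (b - T b)" unfolding *
      using \<pi>B[of "b - T b"] bij_betwE[OF bijB] b by simp
    also have "\<dots> = b" unfolding W_def using bij_betw_inv_into_left[OF bijB b] .
    finally show "(\<Sum>i\<in>I. W (\<pi> (f i (s i b)))) = b" .
  next
    show "kG_submodule G act B" by (rule B)
    show "finite S" "B \<subseteq> fun_space.span S" using fd BP by blast+
    show "\<And>i. i \<in> I \<Longrightarrow> kG_submodule G act' (M i)" using M by blast
  qed
  then obtain V where VV: "(\<forall>i\<in>I. kG_submodule G act' (V i) \<and> V i \<subseteq> M i) \<and>
    (\<forall>p\<in>B. \<exists>!h. h \<in> (\<Pi>\<^sub>E i\<in>I. V i) \<and> (\<Sum>i\<in>I. W (\<pi> (f i (h i)))) = p)"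
    by (rule exE)
  have V: "\<And>i. i \<in> I \<Longrightarrow> kG_submodule G act' (V i)" "\<And>i. i \<in> I \<Longrightarrow> V i \<subseteq> M i"
    using conjunct1[OF VV] by blast+
  note uV = bspec[OF conjunct2[OF VV]]
  define V' where "V' = V(j := s j ` A)"
  have Vj: "V' j = s j ` A" and Vi: "\<And>i. i \<in> I \<Longrightarrow> V' i = V i"
    using insert.hyps(2) by (auto simp: V'_def)
  have sjA: "s j ` A \<subseteq> M j" using sM AP by blast
  have homsj: "kG_hom G act A act' (M j) (s j)"
    by (intro kG_hom_subset[OF s AP] sjA) simp
  have V'sub: "kG_submodule G act' (V' i) \<and> V' i \<subseteq> M i" if "i \<in> insert j I" for i
  proof (cases "i = j")
    case True
    thus ?thesis using kG_hom_image[OF A homsj] sjA Vj by simp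
  next
    case False
    thus ?thesis using that V Vi by simp
  qed
  have sumP: "(\<Sum>i\<in>I. f i (h i)) \<in> P"
    and sumW: "(\<Sum>i\<in>I. W (\<pi> (f i (h i)))) = W (\<pi> (\<Sum>i\<in>I. f i (h i)))"
    if "\<And>i. i \<in> I \<Longrightarrow> h i \<in> V i" for h
  proof -
    have *: "f i (h i) \<in> P" if "i \<in> I" for i using fP that V(2) \<open>\<And>i. i \<in> I \<Longrightarrow> h i \<in> V i\<close> by blast
    show "(\<Sum>i\<in>I. f i (h i)) \<in> P" by (rule fun_space.subspace_sum[OF sP *])
    show "(\<Sum>i\<in>I. W (\<pi> (f i (h i)))) = W (\<pi> (\<Sum>i\<in>I. f i (h i)))"
      by (rule linear_on_sum[OF sP linW\<pi> *, symmetric])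
  qed
  have "\<exists>!h. h \<in> (\<Pi>\<^sub>E i\<in>insert j I. V' i) \<and> (\<Sum>i\<in>insert j I. f i (h i)) = p" if p: "p \<in> P" for p
  proof -
    have Wp: "W (\<pi> p) \<in> B" using W\<pi> p unfolding kG_hom_def by blast
    \<comment> \<open>The indices in \<open>I\<close> match \<open>p\<close> modulo
      \<open>A\<close>: injectivity of \<open>W\<close> turns the equation into equality of
      projections to \<open>B\<close>. The leftover \<open>p - q\<close> lies in \<open>A\<close>
      and is absorbed by the index \<open>j\<close>, since \<open>T\<close> is onto
      \<open>A\<close>.\<close>
    obtain h0 where h0: "h0 \<in> (\<Pi>\<^sub>E i\<in>I. V i)" "(\<Sum>i\<in>I. W (\<pi> (f i (h0 i)))) = W (\<pi> p)"
      and uh0: "\<And>h. h \<in> (\<Pi>\<^sub>E i\<in>I. V i) \<Longrightarrow> (\<Sum>i\<in>I. W (\<pi> (f i (h i)))) = W (\<pi> p) \<Longrightarrow> h = h0"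
      using uV[OF Wp] by (elim ex1E) blast
    define q where "q = (\<Sum>i\<in>I. f i (h0 i))"
    have h0V: "\<And>i. i \<in> I \<Longrightarrow> h0 i \<in> V i" using h0(1) by (auto simp: PiE_iff)
    have qP: "q \<in> P" unfolding q_def by (rule sumP[OF h0V])
    have "W (\<pi> q) = W (\<pi> p)" using sumW[OF h0V] h0(2) q_def by simp
    hence "\<pi> q = \<pi> p" using injW \<pi>im[OF qP] \<pi>im[OF p] by (simp add: inj_on_eq_iff)
    hence "\<pi> (p - q) = 0" using linear_on_diff[OF sP lin\<pi> p qP] by simp
    hence "p - q \<in> A" using \<pi>P[OF fun_space.subspace_diff[OF sP p qP]] by simp
    then obtain a where a: "a \<in> A" "T a = p - q" using TA unfolding bij_betw_def by (metis imageE)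
    show ?thesis
    proof (rule ex1I[of _ "h0(j := s j a)"])
      have "(\<Sum>i\<in>I. f i ((h0(j := s j a)) i)) = q"
        unfolding q_def using insert.hyps(2) by (intro sum.cong) auto
      moreover have "h0(j := s j a) \<in> (\<Pi>\<^sub>E i\<in>insert j I. V' i)"
        using a h0(1) by (intro PiE_fun_upd) (auto simp: Vj Vi PiE_iff)
      ultimately show "h0(j := s j a) \<in> (\<Pi>\<^sub>E i\<in>insert j I. V' i) \<and>
          (\<Sum>i\<in>insert j I. f i ((h0(j := s j a)) i)) = p"
        using insert.hyps a(2) by (simp add: T_def[symmetric])
    next
      fix h assume h: "h \<in> (\<Pi>\<^sub>E i\<in>insert j I. V' i) \<and> (\<Sum>i\<in>insert j I. f i (h i)) = p"
      obtain a' where a': "a' \<in> A" "h j = s j a'" using h Vj by (auto simp: PiE_iff)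
      have hV: "\<And>i. i \<in> I \<Longrightarrow> h i \<in> V i" using h Vi by (auto simp: PiE_iff)
      have pe: "p = T a' + (\<Sum>i\<in>I. f i (h i))"
        using h unfolding sum.insert[OF insert.hyps] a'(2) T_def by blast
      have Ta': "T a' \<in> A" using TA a'(1) unfolding bij_betw_def by blast
      \<comment> \<open>Uniqueness reverses the construction: projecting to \<open>B\<close> removes
        the \<open>j\<close>-term, so the part of \<open>h\<close> over \<open>I\<close> has to be
        \<open>h0\<close>.\<close>
      have "\<pi> p = \<pi> (T a') + \<pi> (\<Sum>i\<in>I. f i (h i))"
        unfolding pe using lin\<pi> subsetD[OF AP Ta'] sumP[OF hV] unfolding linear_on_def by blast
      hence "\<pi> p = \<pi> (\<Sum>i\<in>I. f i (h i))" unfolding \<pi>A[OF Ta'] by (simp only: add_0_left)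
      hence "(\<Sum>i\<in>I. W (\<pi> (f i (h i)))) = W (\<pi> p)" using sumW[OF hV] by simp
      moreover have "(\<Sum>i\<in>I. W (\<pi> (f i ((h(j := undefined)) i)))) = (\<Sum>i\<in>I. W (\<pi> (f i (h i))))"
        using insert.hyps(2) by (intro sum.cong) auto
      \<comment> \<open>A member of the product over \<open>I\<close> must be
        \<open>undefined\<close> at \<open>j\<close>.\<close>
      moreover have "h(j := undefined) \<in> (\<Pi>\<^sub>E i\<in>I. V i)"
        using h Vi insert.hyps(2) by (auto simp: PiE_iff extensional_def)
      ultimately have eq: "h(j := undefined) = h0" by (intro uh0) (simp_all only:)
      have hh0: "h i = h0 i" if "i \<noteq> j" for i using that unfolding eq[symmetric] by simp
      have "(\<Sum>i\<in>I. f i (h i)) = q" unfolding q_def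
        using insert.hyps(2) by (intro sum.cong refl) (metis hh0)
      hence "T a' = T a" using pe a(2) by (metis add_diff_cancel_right')
      hence "a' = a" using TA a(1) a'(1) unfolding bij_betw_def by (meson inj_onD)
      thus "h = h0(j := s j a)" using hh0 a'(2) by auto
    qed
  qed
  thus ?case using V'sub by (intro exI[of _ V']) blast
qed

section \<open>The fraction field of a domain\<close>

text \<open>A union of coinciding sets equals any one of them; this is how operations on fractions
  are computed on representatives.\<close>

lemma UN_pairs_eq:
  assumes "(a, b) \<in> X" "(c, d) \<in> Y"
    and "\<And>a b c d. (a, b) \<in> X \<Longrightarrow> (c, d) \<in> Y \<Longrightarrow> f a b c d = S"
  shows "(\<Union>(a, b)\<in>X. \<Union>(c, d)\<in>Y. f a b c d) = S"
proof (rule SUP_eq_const)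
  show "X \<noteq> {}" using assms(1) by blast
  fix p assume p: "p \<in> X"
  have "(\<Union>q\<in>Y. case q of (c, d) \<Rightarrow> f (fst p) (snd p) c d) = S"
  proof (rule SUP_eq_const)
    show "Y \<noteq> {}" using assms(2) by blast
    fix q assume "q \<in> Y"
    thus "(case q of (c, d) \<Rightarrow> f (fst p) (snd p) c d) = S"
      using assms(3)[of "fst p" "snd p" "fst q" "snd q"] p by (cases q) simp
  qed
  thus "(case p of (a, b) \<Rightarrow> \<Union>(c, d)\<in>Y. f a b c d) = S" by (cases p) (simp only: prod.case fst_conv snd_conv)
qed

context domain
begin

lemma frac_rel_iff:
  "((a, b), (c, d)) \<in> frac_rel R \<longleftrightarrow>
     a \<in> carrier R \<and> c \<in> carrier R \<and> b \<in> carrier R - {\<zero>} \<and> d \<in> carrier R - {\<zero>} \<and> a \<otimes> d = c \<otimes> b"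
  by (auto simp: frac_rel_def)

text \<open>Transitivity is where zero divisors would interfere: the middle denominator has to be
  cancelled.\<close>

lemma frac_rel_equiv: "equiv (carrier R \<times> (carrier R - {\<zero>})) (frac_rel R)"
proof (rule equivI)
  show "frac_rel R \<subseteq> (carrier R \<times> (carrier R - {\<zero>})) \<times> carrier R \<times> (carrier R - {\<zero>})"
    by (auto simp: frac_rel_def)
  show "refl_on (carrier R \<times> (carrier R - {\<zero>})) (frac_rel R)"
    by (auto simp: refl_on_def frac_rel_def)
  show "sym (frac_rel R)" by (auto simp: sym_def frac_rel_def)
  show "trans (frac_rel R)"
  proof (rule transI)
    fix x y z assume xy: "(x, y) \<in> frac_rel R" and yz: "(y, z) \<in> frac_rel R"
    obtain a b c d e f where [simp]: "x = (a, b)" "y = (c, d)" "z = (e, f)" by (metis surj_pair)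
    from xy yz have c: "a \<in> carrier R" "b \<in> carrier R" "c \<in> carrier R" "d \<in> carrier R" "e \<in> carrier R"
      "f \<in> carrier R" "b \<noteq> \<zero>" "d \<noteq> \<zero>" "f \<noteq> \<zero>" and 1: "a \<otimes> d = c \<otimes> b" and 2: "c \<otimes> f = e \<otimes> d"
      by (auto simp: frac_rel_iff)
    have "d \<otimes> (a \<otimes> f) = (a \<otimes> d) \<otimes> f" using c by (simp add: m_ac)
    also have "\<dots> = (c \<otimes> f) \<otimes> b" unfolding 1 using c by (simp add: m_ac)
    also have "\<dots> = d \<otimes> (e \<otimes> b)" unfolding 2 using c by (simp add: m_ac)
    finally have "a \<otimes> f = e \<otimes> b" using c by (simp add: m_lcancel)
    thus "(x, z) \<in> frac_rel R" using c by (simp add: frac_rel_iff)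
  qed
qed

lemma frac_class_eq_iff:
  assumes "a \<in> carrier R" "b \<in> carrier R" "b \<noteq> \<zero>" "c \<in> carrier R" "d \<in> carrier R" "d \<noteq> \<zero>"
  shows "frac_class R a b = frac_class R c d \<longleftrightarrow> a \<otimes> d = c \<otimes> b"
  using eq_equiv_class_iff[OF frac_rel_equiv, of "(a, b)" "(c, d)"] assms
  unfolding frac_class_def by (auto simp: frac_rel_iff)

lemma mem_frac_class:
  "(a', b') \<in> frac_class R a b \<longleftrightarrow> 
     a \<in> carrier R \<and> a' \<in> carrier R \<and> b \<in> carrier R - {\<zero>} \<and> b' \<in> carrier R - {\<zero>} \<and> a \<otimes> b' = a' \<otimes> b"
  by (simp add: frac_class_def frac_rel_iff)

lemma self_in_frac_class:
  "a \<in> carrier R \<Longrightarrow> b \<in> carrier R \<Longrightarrow> b \<noteq> \<zero> \<Longrightarrow> (a, b) \<in> frac_class R a b"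
  by (simp add: mem_frac_class)

lemma frac_carrier: "carrier (frac_field R) = {frac_class R a b | a b. a \<in> carrier R \<and> b \<in> carrier R - {\<zero>}}"
  by (auto simp: frac_field_def quotient_def frac_class_def)

text \<open>Multiplicativity of \<open>\<sigma>\<close> carries the cross-multiplied identity
  between representatives along, and preservation of nonzero elements keeps the denominators
  legal.\<close>

lemma frac_map_class:
  assumes "a \<in> carrier R" "b \<in> carrier R" "b \<noteq> \<zero>"
    and \<sigma>: "\<And>x. x \<in> carrier R \<Longrightarrow> \<sigma> x \<in> carrier R"
      "\<And>x y. x \<in> carrier R \<Longrightarrow> y \<in> carrier R \<Longrightarrow> \<sigma> (x \<otimes> y) = \<sigma> x \<otimes> \<sigma> y"
      "\<And>x. x \<in> carrier R \<Longrightarrow> x \<noteq> \<zero> \<Longrightarrow> \<sigma> x \<noteq> \<zero>"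
  shows "frac_map R \<sigma> (frac_class R a b) = frac_class R (\<sigma> a) (\<sigma> b)"
proof -
  have "frac_class R (\<sigma> a') (\<sigma> b') = frac_class R (\<sigma> a) (\<sigma> b)" if "(a', b') \<in> frac_class R a b" for a' b'
  proof -
    have *: "a' \<in> carrier R" "b' \<in> carrier R" "b' \<noteq> \<zero>" "a \<otimes> b' = a' \<otimes> b"
      using that by (auto simp: mem_frac_class)
    have "\<sigma> a \<otimes> \<sigma> b' = \<sigma> a' \<otimes> \<sigma> b" using * assms(1,2) \<sigma>(2) by metis
    thus ?thesis using *(1-3) assms by (simp add: frac_class_eq_iff)
  qed
  thus ?thesis unfolding frac_map_def using self_in_frac_class[OF assms(1-3)] by blast
qed

lemma frac_mult:
  assumes "a \<in> carrier R" "b \<in> carrier R" "b \<noteq> \<zero>" "c \<in> carrier R" "d \<in> carrier R" "d \<noteq> \<zero>"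
  shows "frac_class R a b \<otimes>\<^bsub>frac_field R\<^esub> frac_class R c d = frac_class R (a \<otimes> c) (b \<otimes> d)"
proof -
  have "frac_class R (a' \<otimes> c') (b' \<otimes> d') = frac_class R (a \<otimes> c) (b \<otimes> d)"
    if "(a', b') \<in> frac_class R a b" "(c', d') \<in> frac_class R c d" for a' b' c' d'
  proof -
    have *: "a' \<in> carrier R" "b' \<in> carrier R" "b' \<noteq> \<zero>" "a \<otimes> b' = a' \<otimes> b"
      "c' \<in> carrier R" "d' \<in> carrier R" "d' \<noteq> \<zero>" "c \<otimes> d' = c' \<otimes> d"
      using that by (auto simp: mem_frac_class)
    have "(a' \<otimes> c') \<otimes> (b \<otimes> d) = (a' \<otimes> b) \<otimes> (c' \<otimes> d)" using *(1-3,5-7) assms by (simp add: m_ac)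
    also have "\<dots> = (a \<otimes> c) \<otimes> (b' \<otimes> d')" unfolding *(4,8)[symmetric] using *(1-3,5-7) assms by (simp add: m_ac)
    finally have eq: "(a' \<otimes> c') \<otimes> (b \<otimes> d) = (a \<otimes> c) \<otimes> (b' \<otimes> d')" .
    show ?thesis
      by (rule iffD2[OF frac_class_eq_iff eq]) (use *(1-3,5-7) assms in \<open>simp_all add: integral_iff\<close>)
  qed
  thus ?thesis unfolding frac_field_def
    by (simp add: UN_pairs_eq[OF self_in_frac_class[OF assms(1-3)] self_in_frac_class[OF assms(4-6)]])
qed

lemma frac_add:
  assumes "a \<in> carrier R" "b \<in> carrier R" "b \<noteq> \<zero>" "c \<in> carrier R" "d \<in> carrier R" "d \<noteq> \<zero>"
  shows "frac_class R a b \<oplus>\<^bsub>frac_field R\<^esub> frac_class R c d = frac_class R (a \<otimes> d \<oplus> c \<otimes> b) (b \<otimes> d)"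
proof -
  have "frac_class R (a' \<otimes> d' \<oplus> c' \<otimes> b') (b' \<otimes> d') = frac_class R (a \<otimes> d \<oplus> c \<otimes> b) (b \<otimes> d)"
    if "(a', b') \<in> frac_class R a b" "(c', d') \<in> frac_class R c d" for a' b' c' d'
  proof -
    have *: "a' \<in> carrier R" "b' \<in> carrier R" "b' \<noteq> \<zero>" "a \<otimes> b' = a' \<otimes> b"
      "c' \<in> carrier R" "d' \<in> carrier R" "d' \<noteq> \<zero>" "c \<otimes> d' = c' \<otimes> d"
      using that by (auto simp: mem_frac_class)
    have "(a' \<otimes> d' \<oplus> c' \<otimes> b') \<otimes> (b \<otimes> d) = (a' \<otimes> b) \<otimes> (d \<otimes> d') \<oplus> (c' \<otimes> d) \<otimes> (b \<otimes> b')"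
      using *(1-3,5-7) assms by (simp add: m_ac a_ac l_distr r_distr)
    also have "\<dots> = (a \<otimes> d \<oplus> c \<otimes> b) \<otimes> (b' \<otimes> d')"
      unfolding *(4,8)[symmetric] using *(1-3,5-7) assms by (simp add: m_ac a_ac l_distr r_distr)
    finally have eq: "(a' \<otimes> d' \<oplus> c' \<otimes> b') \<otimes> (b \<otimes> d) = (a \<otimes> d \<oplus> c \<otimes> b) \<otimes> (b' \<otimes> d')" .
    show ?thesis
      by (rule iffD2[OF frac_class_eq_iff eq]) (use *(1-3,5-7) assms in \<open>simp_all add: integral_iff\<close>)
  qed
  thus ?thesis unfolding frac_field_def
    by (simp add: UN_pairs_eq[OF self_in_frac_class[OF assms(1-3)] self_in_frac_class[OF assms(4-6)]])
qed

lemma frac_one: "\<one>\<^bsub>frac_field R\<^esub> = frac_class R \<one> \<one>"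
  and frac_zero: "\<zero>\<^bsub>frac_field R\<^esub> = frac_class R \<zero> \<one>"
  by (simp_all add: frac_field_def)

lemma frac_in_carrier:
  "a \<in> carrier R \<Longrightarrow> b \<in> carrier R \<Longrightarrow> b \<noteq> \<zero> \<Longrightarrow> frac_class R a b \<in> carrier (frac_field R)"
  by (auto simp: frac_carrier)

lemma frac_carrierE:
  assumes "x \<in> carrier (frac_field R)"
  obtains a b where "x = frac_class R a b" "a \<in> carrier R" "b \<in> carrier R" "b \<noteq> \<zero>"
  using assms by (auto simp: frac_carrier)

lemma frac_eq_zero_iff:
  "a \<in> carrier R \<Longrightarrow> b \<in> carrier R \<Longrightarrow> b \<noteq> \<zero> \<Longrightarrow> frac_class R a b = \<zero>\<^bsub>frac_field R\<^esub> \<longleftrightarrow> a = \<zero>"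
  by (simp add: frac_zero frac_class_eq_iff)

text \<open>Cross-multiplication reduces each axiom to an identity in \<open>R\<close>; a nonzero
  fraction has nonzero numerator and is inverted by swapping.\<close>

lemma frac_field_field: "field (frac_field R)"
proof -
  note rules = frac_mult frac_add frac_one frac_zero frac_in_carrier frac_class_eq_iff integral_iff
  have "cring (frac_field R)"
  proof (rule cringI)
    show "abelian_group (frac_field R)"
    proof (rule abelian_groupI)
      fix x y z assume "x \<in> carrier (frac_field R)" "y \<in> carrier (frac_field R)" "z \<in> carrier (frac_field R)"
      then show "x \<oplus>\<^bsub>frac_field R\<^esub> y \<oplus>\<^bsub>frac_field R\<^esub> z = x \<oplus>\<^bsub>frac_field R\<^esub> (y \<oplus>\<^bsub>frac_field R\<^esub> z)"
        by (elim frac_carrierE) (simp add: rules, simp add: m_ac a_ac l_distr r_distr)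
    next
      fix x assume "x \<in> carrier (frac_field R)"
      then obtain a b where "x = frac_class R a b" "a \<in> carrier R" "b \<in> carrier R" "b \<noteq> \<zero>"
        by (elim frac_carrierE)
      thus "\<exists>y\<in>carrier (frac_field R). y \<oplus>\<^bsub>frac_field R\<^esub> x = \<zero>\<^bsub>frac_field R\<^esub>"
        by (intro bexI[of _ "frac_class R (\<ominus> a) b"]) (simp_all add: rules l_minus l_neg)
    qed (auto elim!: frac_carrierE simp: rules m_ac a_ac)
    show "comm_monoid (frac_field R)"
      by (rule comm_monoidI) (auto elim!: frac_carrierE simp: rules m_ac)
    fix x y z assume "x \<in> carrier (frac_field R)" "y \<in> carrier (frac_field R)" "z \<in> carrier (frac_field R)"
    then show "(x \<oplus>\<^bsub>frac_field R\<^esub> y) \<otimes>\<^bsub>frac_field R\<^esub> z =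
        x \<otimes>\<^bsub>frac_field R\<^esub> z \<oplus>\<^bsub>frac_field R\<^esub> y \<otimes>\<^bsub>frac_field R\<^esub> z"
      by (elim frac_carrierE) (simp add: rules, simp add: m_ac a_ac l_distr r_distr)
  qed
  then interpret F: cring "frac_field R" .
  show ?thesis
  proof (rule F.cring_fieldI2)
    show "\<zero>\<^bsub>frac_field R\<^esub> \<noteq> \<one>\<^bsub>frac_field R\<^esub>" by (simp add: rules)
    fix x assume "x \<in> carrier (frac_field R)" "x \<noteq> \<zero>\<^bsub>frac_field R\<^esub>"
    then obtain a b where "x = frac_class R a b" "a \<in> carrier R" "b \<in> carrier R" "b \<noteq> \<zero>" "a \<noteq> \<zero>"
      by (elim frac_carrierE) (simp add: frac_eq_zero_iff)
    thus "\<exists>y\<in>carrier (frac_field R). x \<otimes>\<^bsub>frac_field R\<^esub> y = \<one>\<^bsub>frac_field R\<^esub>"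
      by (intro bexI[of _ "frac_class R b a"]) (simp_all add: rules m_ac)
  qed
qed

end

section \<open>Polynomial functions\<close>

text \<open>Over a finite field the product of all \<open>X - a\<close>, plus 1, would be
  nonconstant and take only the value 1.\<close>

lemma alg_closed_infinite: "infinite (UNIV :: 'k::alg_closed_field set)"
proof
  assume fin: "finite (UNIV :: 'k set)"
  define q where "q = (\<Prod>a\<in>(UNIV::'k set). [:- a, 1:])"
  have q: "poly q x = 0" for x
    unfolding q_def poly_prod using fin by (intro prod_zero bexI[of _ x]) auto
  have "degree q = card (UNIV :: 'k set)"
    unfolding q_def by (subst degree_prod_eq_sum_degree) auto
  hence "degree q > 0" using fin by (simp add: card_gt_0_iff)
  hence "degree (q + 1) > 0" using degree_add_eq_left[of 1 q] by simp
  then obtain x where "poly (q + 1) x = 0" using alg_closed_imp_poly_has_root by blast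
  thus False using q by simp
qed

lemma fscale_mult: "fscale c f * g = fscale c (f * g)" "f * fscale c g = fscale c (f * g)"
  by (auto simp: fscale_def fun_eq_iff algebra_simps)

lemma sum_fun_apply: "(\<Sum>i\<in>I. f i) x = (\<Sum>i\<in>I. f i x)"
  by (induction I rule: infinite_finite_induct) auto

lemma prod_fun_apply: "(\<Prod>i\<in>I. f i) x = (\<Prod>i\<in>I. f i x)"
  by (induction I rule: infinite_finite_induct) auto

lemma prod_lessThan_add:
  fixes h :: "nat \<Rightarrow> 'a::comm_monoid_mult"
  shows "(\<Prod>i<d + e. h i) = (\<Prod>i<d. h i) * (\<Prod>i<e. h (d + i))"
  by (induction e) (simp_all add: mult.assoc)

context
  fixes scale :: "'k::field \<Rightarrow> 'v::ab_group_add \<Rightarrow> 'v"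
begin

abbreviation lin_fun :: "('v \<Rightarrow> 'k) \<Rightarrow> bool" where
  "lin_fun \<equiv> Vector_Spaces.linear scale (*)"

lemma subspace_hom_poly_funs: "fun_space.subspace (hom_poly_funs scale d)"
  unfolding hom_poly_funs_def by (rule fun_space.subspace_span)

lemma subspace_poly_funs_le: "fun_space.subspace (poly_funs_le scale d)"
  unfolding poly_funs_le_def by (rule fun_space.subspace_span)

lemma subspace_poly_funs: "fun_space.subspace (poly_funs scale)"
  unfolding poly_funs_def by (rule fun_space.subspace_span)

lemma hom_poly_funs_subset_le: "e \<le> d \<Longrightarrow> hom_poly_funs scale e \<subseteq> poly_funs_le scale d"
  unfolding poly_funs_le_def by (intro subset_trans[OF _ fun_space.span_superset] UN_upper) simp

lemma poly_funs_le_subset: "poly_funs_le scale d \<subseteq> poly_funs scale"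
  unfolding poly_funs_le_def poly_funs_def by (intro fun_space.span_mono) blast

lemma hom_poly_funs_subset: "hom_poly_funs scale d \<subseteq> poly_funs scale"
  using hom_poly_funs_subset_le[of d d] poly_funs_le_subset by blast

lemma poly_funs_le_mono: "d \<le> e \<Longrightarrow> poly_funs_le scale d \<subseteq> poly_funs_le scale e"
  unfolding poly_funs_le_def by (intro fun_space.span_mono UN_mono) auto

lemma hom_poly_funs_induct:
  assumes "f \<in> hom_poly_funs scale d" and "fun_space.subspace {f. Q f}"
    and "\<And>l. \<forall>i<d. lin_fun (l i) \<Longrightarrow> Q (\<Prod>i<d. l i)"
  shows "Q f"
proof -
  have "hom_poly_funs scale d \<subseteq> {f. Q f}"
    unfolding hom_poly_funs_def by (rule fun_space.span_minimal[OF _ assms(2)]) (use assms(3) in auto)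
  thus ?thesis using assms(1) by blast
qed

lemma poly_funs_induct:
  assumes "f \<in> poly_funs scale" and "fun_space.subspace {f. Q f}"
    and "\<And>d f. f \<in> hom_poly_funs scale d \<Longrightarrow> Q f"
  shows "Q f"
proof -
  have "poly_funs scale \<subseteq> {f. Q f}"
    unfolding poly_funs_def by (rule fun_space.span_minimal[OF _ assms(2)]) (use assms(3) in auto)
  thus ?thesis using assms(1) by blast
qed

lemma hom_poly_funs_prod: "\<forall>i<d. lin_fun (l i) \<Longrightarrow> (\<Prod>i<d. l i) \<in> hom_poly_funs scale d"
  unfolding hom_poly_funs_def by (rule fun_space.span_base) blast

text \<open>The product is linear in each factor, so it suffices to multiply two products of
  functionals, and these concatenate.\<close>

lemma hom_poly_funs_mult:
  assumes f: "f \<in> hom_poly_funs scale d" and g: "g \<in> hom_poly_funs scale e"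
  shows "f * g \<in> hom_poly_funs scale (d + e)"
proof (rule hom_poly_funs_induct[OF f])
  note S = subspace_hom_poly_funs[of "d + e"]
  show "fun_space.subspace {f. f * g \<in> hom_poly_funs scale (d + e)}"
    using fun_space.subspace_add[OF S] fun_space.subspace_scale[OF S] fun_space.subspace_0[OF S]
    by (intro fun_space.subspaceI) (auto simp: distrib_right fscale_mult simp del: times_fun_apply)
  fix l :: "nat \<Rightarrow> 'v \<Rightarrow> 'k" assume l: "\<forall>i<d. lin_fun (l i)"
  show "(\<Prod>i<d. l i) * g \<in> hom_poly_funs scale (d + e)"
  proof (rule hom_poly_funs_induct[OF g])
    show "fun_space.subspace {g. (\<Prod>i<d. l i) * g \<in> hom_poly_funs scale (d + e)}"
      using fun_space.subspace_add[OF S] fun_space.subspace_scale[OF S] fun_space.subspace_0[OF S]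
      by (intro fun_space.subspaceI) (auto simp: distrib_left fscale_mult simp del: times_fun_apply)
    fix l' :: "nat \<Rightarrow> 'v \<Rightarrow> 'k" assume l': "\<forall>i<e. lin_fun (l' i)"
    define h where "h i = (if i < d then l i else l' (i - d))" for i
    have "(\<Prod>i<d. l i) * (\<Prod>i<e. l' i) = (\<Prod>i<d + e. h i)"
      unfolding prod_lessThan_add by (simp add: h_def)
    moreover have "\<forall>i<d + e. lin_fun (h i)" using l l' by (auto simp: h_def)
    ultimately show "(\<Prod>i<d. l i) * (\<Prod>i<e. l' i) \<in> hom_poly_funs scale (d + e)"
      using hom_poly_funs_prod by metis
  qed
qed

lemma poly_funs_mult:
  assumes f: "f \<in> poly_funs scale" and g: "g \<in> poly_funs scale"
  shows "f * g \<in> poly_funs scale"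
proof (rule poly_funs_induct[OF f])
  note S = subspace_poly_funs
  show "fun_space.subspace {f. f * g \<in> poly_funs scale}"
    using fun_space.subspace_add[OF S] fun_space.subspace_scale[OF S] fun_space.subspace_0[OF S]
    by (intro fun_space.subspaceI) (auto simp: distrib_right fscale_mult simp del: times_fun_apply)
  fix d f assume f: "f \<in> hom_poly_funs scale d"
  show "f * g \<in> poly_funs scale"
  proof (rule poly_funs_induct[OF g])
    show "fun_space.subspace {g. f * g \<in> poly_funs scale}"
      using fun_space.subspace_add[OF S] fun_space.subspace_scale[OF S] fun_space.subspace_0[OF S]
      by (intro fun_space.subspaceI) (auto simp: distrib_left fscale_mult simp del: times_fun_apply)
    fix e g assume "g \<in> hom_poly_funs scale e"
    thus "f * g \<in> poly_funs scale" using hom_poly_funs_mult[OF f] hom_poly_funs_subset by blast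
  qed
qed

lemma one_in_hom_poly_funs: "1 \<in> hom_poly_funs scale 0"
  using hom_poly_funs_prod[of 0] by simp

lemma one_in_poly_funs: "1 \<in> poly_funs scale"
  using one_in_hom_poly_funs hom_poly_funs_subset by blast

lemma lin_fun_in_poly_funs: "lin_fun l \<Longrightarrow> l \<in> poly_funs scale"
  using hom_poly_funs_prod[of 1 "\<lambda>_. l"] hom_poly_funs_subset by auto

lemma const_in_poly_funs: "(\<lambda>_. c) \<in> poly_funs scale"
  using fun_space.subspace_scale[OF subspace_poly_funs one_in_poly_funs, of c] by (simp add: fscale_def)

lemma poly_funs_prod:
  "(\<And>i. i \<in> I \<Longrightarrow> f i \<in> poly_funs scale) \<Longrightarrow> (\<Prod>i\<in>I. f i) \<in> poly_funs scale"
  by (induction I rule: infinite_finite_induct) (auto intro: poly_funs_mult one_in_poly_funs)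

text \<open>The degree filtration is increasing, so its union is already a subspace.\<close>

lemma poly_funs_eq_Union_le: "poly_funs scale = (\<Union>d. poly_funs_le scale d)"
proof
  have "fun_space.subspace (\<Union>d. poly_funs_le scale d)"
  proof (rule fun_space.subspaceI)
    show "0 \<in> (\<Union>d. poly_funs_le scale d)" using fun_space.subspace_0[OF subspace_poly_funs_le] by blast
    fix x y assume "x \<in> (\<Union>d. poly_funs_le scale d)" "y \<in> (\<Union>d. poly_funs_le scale d)"
    then obtain d e where "x \<in> poly_funs_le scale d" "y \<in> poly_funs_le scale e" by blast
    hence "x \<in> poly_funs_le scale (max d e)" "y \<in> poly_funs_le scale (max d e)"
      using poly_funs_le_mono[of d "max d e"] poly_funs_le_mono[of e "max d e"] by auto
    thus "x + y \<in> (\<Union>d. poly_funs_le scale d)"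
      using fun_space.subspace_add[OF subspace_poly_funs_le] by blast
  next
    fix c x assume "x \<in> (\<Union>d. poly_funs_le scale d)"
    thus "fscale c x \<in> (\<Union>d. poly_funs_le scale d)"
      using fun_space.subspace_scale[OF subspace_poly_funs_le] by blast
  qed
  thus "poly_funs scale \<subseteq> (\<Union>d. poly_funs_le scale d)"
    unfolding poly_funs_def using hom_poly_funs_subset_le by (intro fun_space.span_minimal) blast+
qed (use poly_funs_le_subset in blast)

lemma poly_funs_le_decompose:
  assumes "f \<in> poly_funs_le scale D"
  obtains h where "\<And>d. d \<le> D \<Longrightarrow> h d \<in> hom_poly_funs scale d" "f = (\<Sum>d\<le>D. h d)"
proof -
  define Q where "Q f \<longleftrightarrow> (\<exists>h. (\<forall>d\<le>D. h d \<in> hom_poly_funs scale d) \<and> f = (\<Sum>d\<le>D. h d))" for f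
  note S = subspace_hom_poly_funs
  have "fun_space.subspace {f. Q f}"
  proof (rule fun_space.subspaceI)
    show "0 \<in> {f. Q f}" unfolding Q_def using fun_space.subspace_0[OF S]
      by (auto intro!: exI[of _ "\<lambda>_. 0"] simp del: zero_fun_apply)
    fix x y assume "x \<in> {f. Q f}" "y \<in> {f. Q f}"
    then obtain h h' where "\<forall>d\<le>D. h d \<in> hom_poly_funs scale d" "\<forall>d\<le>D. h' d \<in> hom_poly_funs scale d"
      "x = (\<Sum>d\<le>D. h d)" "y = (\<Sum>d\<le>D. h' d)" unfolding Q_def by blast
    thus "x + y \<in> {f. Q f}" unfolding Q_def using fun_space.subspace_add[OF S]
      by (auto intro!: exI[of _ "\<lambda>d. h d + h' d"] simp: sum.distrib simp del: plus_fun_apply)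
  next
    fix c x assume "x \<in> {f. Q f}"
    then obtain h where "\<forall>d\<le>D. h d \<in> hom_poly_funs scale d" "x = (\<Sum>d\<le>D. h d)"
      unfolding Q_def by blast
    thus "fscale c x \<in> {f. Q f}" unfolding Q_def using fun_space.subspace_scale[OF S]
      by (auto intro!: exI[of _ "\<lambda>d. fscale c (h d)"] simp: fun_space.scale_sum_right)
  qed
  moreover have "(\<Union>e\<le>D. hom_poly_funs scale e) \<subseteq> {f. Q f}"
  proof clarify
    fix f e assume e: "e \<le> D" and f: "f \<in> hom_poly_funs scale e"
    have "f = (\<Sum>d\<le>D. if d = e then f else 0)" using e by (subst sum.delta) auto
    moreover have "\<forall>d\<le>D. (if d = e then f else 0) \<in> hom_poly_funs scale d"
      using f fun_space.subspace_0[OF S] by (simp del: zero_fun_apply)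
    ultimately show "Q f" unfolding Q_def by (intro exI[of _ "\<lambda>d. if d = e then f else 0"] conjI)
  qed
  ultimately have "Q f"
    using assms fun_space.span_minimal unfolding poly_funs_le_def by blast
  thus ?thesis using that unfolding Q_def by blast
qed

lemma hom_poly_funs_comp:
  assumes "f \<in> hom_poly_funs scale d" and T: "Vector_Spaces.linear scale scale T"
  shows "(\<lambda>v. f (T v)) \<in> hom_poly_funs scale d"
proof (rule hom_poly_funs_induct[OF assms(1)])
  note S = subspace_hom_poly_funs
  show "fun_space.subspace {f. (\<lambda>v. f (T v)) \<in> hom_poly_funs scale d}"
    using fun_space.subspace_add[OF S] fun_space.subspace_scale[OF S] fun_space.subspace_0[OF S]
    by (intro fun_space.subspaceI) (auto simp: fscale_def plus_fun_def zero_fun_def)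
  fix l :: "nat \<Rightarrow> 'v \<Rightarrow> 'k" assume l: "\<forall>i<d. lin_fun (l i)"
  have "(\<lambda>v. (\<Prod>i<d. l i) (T v)) = (\<Prod>i<d. (\<lambda>v. l i (T v)))" by (auto simp: prod_fun_apply fun_eq_iff)
  moreover have "\<forall>i<d. lin_fun (\<lambda>v. l i (T v))"
    using l Vector_Spaces.linear_compose[OF T] by (auto simp: comp_def)
  ultimately show "(\<lambda>v. (\<Prod>i<d. l i) (T v)) \<in> hom_poly_funs scale d" using hom_poly_funs_prod by metis
qed

lemma poly_funs_le_comp:
  assumes "f \<in> poly_funs_le scale d" and T: "Vector_Spaces.linear scale scale T"
  shows "(\<lambda>v. f (T v)) \<in> poly_funs_le scale d"
proof -
  obtain h where h: "\<And>e. e \<le> d \<Longrightarrow> h e \<in> hom_poly_funs scale e" "f = (\<Sum>e\<le>d. h e)"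
    using poly_funs_le_decompose[OF assms(1)] by blast
  have "(\<lambda>v. f (T v)) = (\<Sum>e\<le>d. (\<lambda>v. h e (T v)))" by (auto simp: h(2) sum_fun_apply fun_eq_iff)
  also have "\<dots> \<in> poly_funs_le scale d"
    using h(1) hom_poly_funs_comp[OF _ T] hom_poly_funs_subset_le
    by (intro fun_space.subspace_sum[OF subspace_poly_funs_le]) blast
  finally show ?thesis .
qed

lemma poly_funs_comp:
  assumes "f \<in> poly_funs scale" and T: "Vector_Spaces.linear scale scale T"
  shows "(\<lambda>v. f (T v)) \<in> poly_funs scale"
  using assms poly_funs_le_comp[OF _ T] unfolding poly_funs_eq_Union_le by blast

lemma hom_poly_funs_homogeneous:
  assumes "f \<in> hom_poly_funs scale d"
  shows "f (scale t v) = t ^ d * f v"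
proof (rule hom_poly_funs_induct[OF assms])
  show "fun_space.subspace {f. f (scale t v) = t ^ d * f v}"
    by (intro fun_space.subspaceI) (auto simp: fscale_def algebra_simps)
  fix l :: "nat \<Rightarrow> 'v \<Rightarrow> 'k" assume l: "\<forall>i<d. lin_fun (l i)"
  have "l i (scale t v) = t * l i v" if "i < d" for i
  proof -
    interpret l: Vector_Spaces.linear scale "(*)" "l i" using l that by blast
    show ?thesis by (rule l.scale)
  qed
  thus "(\<Prod>i<d. l i) (scale t v) = t ^ d * (\<Prod>i<d. l i) v"
    by (simp add: prod_fun_apply prod.distrib)
qed

text \<open>Along a line every functional becomes a polynomial of degree at most 1 in the parameter.
  This reduces vanishing questions to roots of univariate polynomials without choosing
  coordinates.\<close>

lemma poly_funs_on_line:
  assumes "f \<in> poly_funs scale"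
  shows "\<exists>p. \<forall>t. f (u + scale t w) = poly p t"
proof -
  define Q where "Q f \<longleftrightarrow> (\<exists>p. \<forall>t. f (u + scale t w) = poly p t)" for f :: "'v \<Rightarrow> 'k"
  have S: "fun_space.subspace {f. Q f}"
  proof (rule fun_space.subspaceI)
    show "0 \<in> {f. Q f}" unfolding Q_def by (auto intro: exI[of _ 0])
    fix x y assume "x \<in> {f. Q f}" "y \<in> {f. Q f}"
    then obtain p q where "\<forall>t. x (u + scale t w) = poly p t" "\<forall>t. y (u + scale t w) = poly q t"
      unfolding Q_def by blast
    thus "x + y \<in> {f. Q f}" unfolding Q_def by (auto intro!: exI[of _ "p + q"])
  next
    fix c x assume "x \<in> {f. Q f}"
    then obtain p where "\<forall>t. x (u + scale t w) = poly p t" unfolding Q_def by blast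
    thus "fscale c x \<in> {f. Q f}" unfolding Q_def by (auto intro!: exI[of _ "Polynomial.smult c p"] simp: fscale_def)
  qed
  have "Q f"
  proof (rule poly_funs_induct[OF assms S], rule hom_poly_funs_induct[OF _ S])
    fix d and l :: "nat \<Rightarrow> 'v \<Rightarrow> 'k" assume l: "\<forall>i<d. lin_fun (l i)"
    have "l i (u + scale t w) = poly [:l i u, l i w:] t" if "i < d" for i t
    proof -
      interpret l: Vector_Spaces.linear scale "(*)" "l i" using l that by blast
      show ?thesis by (simp add: l.add l.scale)
    qed
    thus "Q (\<Prod>i<d. l i)" unfolding Q_def
      by (intro exI[of _ "\<Prod>i<d. [:l i u, l i w:]"]) (simp add: prod_fun_apply poly_prod)
  qed
  thus ?thesis unfolding Q_def .
qed

text \<open>Join a point where \<open>f\<close> is nonzero to a point where \<open>g\<close> is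
  nonzero: both restrictions to this line are nonzero polynomials, and their product has only
  finitely many roots in an infinite field.\<close>

lemma poly_funs_integral:
  assumes inf: "infinite (UNIV :: 'k set)" and V: "vector_space scale"
    and f: "f \<in> poly_funs scale" "f \<noteq> 0" and g: "g \<in> poly_funs scale" "g \<noteq> 0"
  shows "f * g \<noteq> 0"
proof -
  interpret vector_space scale by (rule V)
  obtain u w where u: "f u \<noteq> 0" and w: "g w \<noteq> 0" using f(2) g(2) by (auto simp: fun_eq_iff)
  obtain p where p: "\<And>t. f (u + scale t (w - u)) = poly p t" using poly_funs_on_line[OF f(1)] by blast
  obtain q where q: "\<And>t. g (u + scale t (w - u)) = poly q t" using poly_funs_on_line[OF g(1)] by blast
  have "poly p 0 \<noteq> 0" "poly q 1 \<noteq> 0" using p[of 0] q[of 1] u w by simp_all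
  hence "p * q \<noteq> 0" by auto
  hence "finite {t. poly (p * q) t = 0}" by (rule poly_roots_finite)
  then obtain t where "poly (p * q) t \<noteq> 0" using inf by (metis (mono_tags, lifting) UNIV_eq_I mem_Collect_eq)
  hence "(f * g) (u + scale t (w - u)) \<noteq> 0" using p q by simp
  thus ?thesis by (metis zero_fun_apply)
qed

text \<open>On the multiples \<open>t v\<close> of a vector, degree \<open>d\<close> contributes the
  power \<open>t ^ d\<close>. The difference of the sums is thus a polynomial in \<open>t\<close>
  with coefficients \<open>h d v - h' d v\<close> that vanishes on an infinite field.\<close>

lemma hom_poly_funs_sum_inject:
  assumes inf: "infinite (UNIV :: 'k set)"
    and h: "\<And>d. d \<le> D \<Longrightarrow> h d \<in> hom_poly_funs scale d" "\<And>d. d \<le> D \<Longrightarrow> h' d \<in> hom_poly_funs scale d"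
    and eq: "(\<Sum>d\<le>D. h d) = (\<Sum>d\<le>D. h' d)" and d: "d \<le> D"
  shows "h d = h' d"
proof
  fix v
  define p where "p = (\<Sum>d\<le>D. Polynomial.monom (h d v - h' d v) d)"
  have "poly p t = 0" for t
  proof -
    have "poly p t = (\<Sum>d\<le>D. h d (scale t v)) - (\<Sum>d\<le>D. h' d (scale t v))"
      unfolding p_def poly_sum sum_subtractf[symmetric]
      using hom_poly_funs_homogeneous[OF h(1)] hom_poly_funs_homogeneous[OF h(2)]
      by (intro sum.cong refl) (simp add: poly_monom algebra_simps)
    also have "\<dots> = 0" using fun_cong[OF eq, of "scale t v"] by (simp add: sum_fun_apply)
    finally show ?thesis .
  qed
  hence "{t. poly p t = 0} = UNIV" by blast
  hence "p = 0" using inf poly_roots_finite[of p] by metis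
  moreover have "Polynomial.coeff p d = h d v - h' d v"
    unfolding p_def Polynomial.coeff_sum using d by (simp add: Polynomial.coeff_monom sum.delta)
  ultimately show "h d v = h' d v" by simp
qed

lemma poly_fun_ring_simps [simp]:
  "carrier (poly_fun_ring scale) = poly_funs scale" "\<one>\<^bsub>poly_fun_ring scale\<^esub> = 1"
  "\<zero>\<^bsub>poly_fun_ring scale\<^esub> = 0" "x \<otimes>\<^bsub>poly_fun_ring scale\<^esub> y = x * y" "x \<oplus>\<^bsub>poly_fun_ring scale\<^esub> y = x + y"
  by (simp_all add: poly_fun_ring_def)

lemma poly_fun_ring_domain:
  assumes inf: "infinite (UNIV :: 'k set)" and V: "vector_space scale"
  shows "domain (poly_fun_ring scale)"
proof -
  note S = subspace_poly_funs
  have "cring (poly_fun_ring scale)"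
  proof (rule cringI)
    show "abelian_group (poly_fun_ring scale)"
    proof (rule abelian_groupI)
      fix x assume "x \<in> carrier (poly_fun_ring scale)"
      thus "\<exists>y\<in>carrier (poly_fun_ring scale). y \<oplus>\<^bsub>poly_fun_ring scale\<^esub> x = \<zero>\<^bsub>poly_fun_ring scale\<^esub>"
        using fun_space.subspace_neg[OF S] by (intro bexI[of _ "- x"]) auto
    qed (use fun_space.subspace_add[OF S] fun_space.subspace_0[OF S] in
        \<open>auto simp: add_ac simp del: plus_fun_apply zero_fun_apply\<close>)
    show "comm_monoid (poly_fun_ring scale)"
      by (rule comm_monoidI)
         (auto simp: mult_ac one_in_poly_funs poly_funs_mult simp del: times_fun_apply one_fun_apply)
  qed (simp add: distrib_right)
  thus ?thesis
    using poly_funs_integral[OF inf V] one_in_poly_funs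
    by (intro domain.intro domain_axioms.intro) (auto simp del: times_fun_apply one_fun_apply zero_fun_apply)
qed

end

section \<open>Cramer systems over commutative rings\<close>

text \<open>Cramer's rule without division, in a form valid for the ring of all functions, which may
  have zero divisors.\<close>

lemma adj_mat_solves:
  fixes A :: "'a::comm_ring_1 mat"
  assumes A: "A \<in> carrier_mat n n" and i: "i < n"
  shows "(\<Sum>j<n. A $$ (i, j) * (\<Sum>l<n. adj_mat A $$ (j, l) * y l)) = det A * y i"
proof -
  note adj = adj_mat[OF A]
  have e: "(A * adj_mat A) $$ (i, l) = (\<Sum>j<n. A $$ (i, j) * adj_mat A $$ (j, l))" if "l < n" for l
    using A adj(1) i that by (simp add: scalar_prod_def atLeast0LessThan)
  have *: "(\<Sum>j<n. A $$ (i, j) * adj_mat A $$ (j, l)) = (if i = l then det A else 0)" if "l < n" for l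
    unfolding e[OF that, symmetric] adj(2) using that i by simp
  have "(\<Sum>j<n. A $$ (i, j) * (\<Sum>l<n. adj_mat A $$ (j, l) * y l)) =
        (\<Sum>l<n. (\<Sum>j<n. A $$ (i, j) * adj_mat A $$ (j, l)) * y l)"
    unfolding sum_distrib_left sum_distrib_right mult.assoc by (rule sum.swap)
  also have "\<dots> = (\<Sum>l<n. (if i = l then det A else 0) * y l)" using * by simp
  also have "\<dots> = det A * y i" using i by (subst sum.remove[of _ i]) auto
  finally show ?thesis .
qed

text \<open>Multiplying \<open>A x = 0\<close> from the left by the adjugate leaves
  \<open>det A\<close> times \<open>x\<close>. It yields uniqueness of solutions once the
  determinant can be cancelled.\<close>

lemma det_mult_kernel:
  fixes A :: "'a::comm_ring_1 mat"
  assumes A: "A \<in> carrier_mat n n" and k: "\<And>i. i < n \<Longrightarrow> (\<Sum>j<n. A $$ (i, j) * x j) = 0" and j: "j < n"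
  shows "det A * x j = 0"
proof -
  note adj = adj_mat[OF A]
  have e: "(adj_mat A * A) $$ (j, l) = (\<Sum>i<n. adj_mat A $$ (j, i) * A $$ (i, l))" if "l < n" for l
    using A adj(1) j that by (simp add: scalar_prod_def atLeast0LessThan)
  have *: "(\<Sum>i<n. adj_mat A $$ (j, i) * A $$ (i, l)) = (if j = l then det A else 0)" if "l < n" for l
    unfolding e[OF that, symmetric] adj(3) using that j by simp
  have "det A * x j = (\<Sum>l<n. (if j = l then det A else 0) * x l)"
    using j by (subst sum.remove[of _ j]) auto
  also have "\<dots> = (\<Sum>l<n. (\<Sum>i<n. adj_mat A $$ (j, i) * A $$ (i, l)) * x l)" using * by simp
  also have "\<dots> = (\<Sum>i<n. adj_mat A $$ (j, i) * (\<Sum>l<n. A $$ (i, l) * x l))"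
    unfolding sum_distrib_left sum_distrib_right mult.assoc by (rule sum.swap)
  also have "\<dots> = 0" using k by simp
  finally show ?thesis .
qed

text \<open>Evaluation at a point is a ring homomorphism, so whether a determinant of functions
  vanishes at \<open>v\<close> is decided by the matrix of values.\<close>

lemma det_eval_at:
  fixes A :: "('x \<Rightarrow> 'a::comm_ring_1) mat"
  shows "det A v = det (map_mat (\<lambda>f. f v) A)"
proof -
  interpret comm_ring_hom "\<lambda>f :: 'x \<Rightarrow> 'a. f v" by unfold_locales auto
  show ?thesis by (rule hom_det[symmetric])
qed

text \<open>The Leibniz formula uses only the listed operations. It serves to return from the ring
  of all functions, over which the matrices live, to the subring of polynomial functions.\<close>

lemma det_in_closed_set:
  fixes A :: "'a::comm_ring_1 mat"
  assumes A: "A \<in> carrier_mat n n" and S: "\<And>i j. i < n \<Longrightarrow> j < n \<Longrightarrow> A $$ (i, j) \<in> S"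
    and closed: "0 \<in> S" "1 \<in> S" "\<And>x y. x \<in> S \<Longrightarrow> y \<in> S \<Longrightarrow> x + y \<in> S"
      "\<And>x. x \<in> S \<Longrightarrow> - x \<in> S" "\<And>x y. x \<in> S \<Longrightarrow> y \<in> S \<Longrightarrow> x * y \<in> S"
  shows "det A \<in> S"
proof -
  have sum: "sum f I \<in> S" if "\<And>i. i \<in> I \<Longrightarrow> f i \<in> S" for f :: "'i \<Rightarrow> 'a" and I
    using that by (induction I rule: infinite_finite_induct) (auto intro: closed)
  have prod: "prod f I \<in> S" if "\<And>i. i \<in> I \<Longrightarrow> f i \<in> S" for f :: "'i \<Rightarrow> 'a" and I
    using that by (induction I rule: infinite_finite_induct) (auto intro: closed)
  have sgn: "signof p \<in> S" for p :: "nat \<Rightarrow> nat"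
    by (cases "evenperm p") (auto simp: sign_def intro: closed)
  show ?thesis unfolding det_def'[OF A]
    by (intro sum closed(5) sgn prod S) (auto dest: permutes_in_image)
qed

lemma adj_mat_in_closed_set:
  fixes A :: "'a::comm_ring_1 mat"
  assumes A: "A \<in> carrier_mat n n" and S: "\<And>i j. i < n \<Longrightarrow> j < n \<Longrightarrow> A $$ (i, j) \<in> S"
    and closed: "0 \<in> S" "1 \<in> S" "\<And>x y. x \<in> S \<Longrightarrow> y \<in> S \<Longrightarrow> x + y \<in> S"
      "\<And>x. x \<in> S \<Longrightarrow> - x \<in> S" "\<And>x y. x \<in> S \<Longrightarrow> y \<in> S \<Longrightarrow> x * y \<in> S"
    and ij: "i < n" "j < n"
  shows "adj_mat A $$ (i, j) \<in> S"
proof -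
  have "(- 1) ^ m \<in> S" for m by (induction m) (auto intro: closed)
  moreover have "det (mat_delete A j i) \<in> S"
  proof (rule det_in_closed_set[OF mat_delete_carrier[OF A]])
    fix a b assume "a < n - 1" "b < n - 1"
    thus "mat_delete A j i $$ (a, b) \<in> S"
      using A ij by (auto simp: mat_delete_def intro!: S)
  qed (use closed in auto)
  ultimately have "cofactor A j i \<in> S" unfolding cofactor_def by (intro closed(5))
  thus ?thesis using A ij by (simp add: adj_mat_def)
qed

section \<open>Rational functions and invariants of a linear group action\<close>

text \<open>Invariants and determinants are treated for any linear action over an infinite field;
  faithfulness enters later, for the existence of free orbits.\<close>

locale poly_rep = group G for G :: "('g, 'm) monoid_scheme" (structure) +
  fixes scale :: "'k::field \<Rightarrow> 'v::ab_group_add \<Rightarrow> 'v" and \<rho> :: "'g \<Rightarrow> 'v \<Rightarrow> 'v"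
  assumes finite_G: "finite (carrier G)"
    and vs: "vector_space scale"
    and infinite_field: "infinite (UNIV :: 'k set)"
    and rho_linear: "g \<in> carrier G \<Longrightarrow> Vector_Spaces.linear scale scale (\<rho> g)"
    and rho_one: "\<rho> \<one> v = v"
    and rho_mult: "g \<in> carrier G \<Longrightarrow> h \<in> carrier G \<Longrightarrow> \<rho> (g \<otimes> h) v = \<rho> g (\<rho> h v)"
begin

abbreviation "PF \<equiv> poly_funs scale"
abbreviation "PR \<equiv> poly_fun_ring scale"
abbreviation "act \<equiv> (fun_act G \<rho> :: 'g \<Rightarrow> ('v \<Rightarrow> 'k) \<Rightarrow> 'v \<Rightarrow> 'k)"
abbreviation "fr \<equiv> frac_class PR"
abbreviation "emb \<equiv> frac_emb PR"
abbreviation "KV \<equiv> rat_fun_field scale"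
abbreviation "KVG \<equiv> invariant_field G scale \<rho>"

sublocale R: domain PR
  by (rule poly_fun_ring_domain[OF infinite_field vs])

sublocale K: field KV
  unfolding rat_fun_field_def by (rule R.frac_field_field)

lemmas PF_sub = subspace_poly_funs[of scale]

lemma PF_closed [intro]:
  "0 \<in> PF" "1 \<in> PF" "f \<in> PF \<Longrightarrow> g \<in> PF \<Longrightarrow> f + g \<in> PF" "f \<in> PF \<Longrightarrow> g \<in> PF \<Longrightarrow> f - g \<in> PF"
  "f \<in> PF \<Longrightarrow> - f \<in> PF" "f \<in> PF \<Longrightarrow> g \<in> PF \<Longrightarrow> f * g \<in> PF"
  using fun_space.subspace_0[OF PF_sub] fun_space.subspace_add[OF PF_sub]
    fun_space.subspace_diff[OF PF_sub] fun_space.subspace_neg[OF PF_sub]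
    poly_funs_mult[of _ scale] one_in_poly_funs[of scale] by metis+

lemma PF_sum: "(\<And>i. i \<in> I \<Longrightarrow> f i \<in> PF) \<Longrightarrow> sum f I \<in> PF"
  by (rule fun_space.subspace_sum[OF PF_sub])

lemma PF_nz_mult: "f \<in> PF \<Longrightarrow> f \<noteq> 0 \<Longrightarrow> g \<in> PF \<Longrightarrow> g \<noteq> 0 \<Longrightarrow> f * g \<noteq> 0"
  by (rule poly_funs_integral[OF infinite_field vs])

lemma PF_nz_prod: "finite I \<Longrightarrow> (\<And>i. i \<in> I \<Longrightarrow> f i \<in> PF \<and> f i \<noteq> 0) \<Longrightarrow> prod f I \<in> PF \<and> prod f I \<noteq> 0"
proof (induction I rule: finite_induct)
  case empty
  show ?case unfolding prod.empty using PF_closed(2) one_neq_zero by blast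
next
  case (insert x F)
  have "f x \<in> PF \<and> f x \<noteq> 0" "prod f F \<in> PF \<and> prod f F \<noteq> 0" using insert by blast+
  thus ?case unfolding prod.insert[OF insert.hyps] using PF_nz_mult PF_closed(6) by blast
qed

lemma PF_cancel: "f \<in> PF \<Longrightarrow> g \<in> PF \<Longrightarrow> h \<in> PF \<Longrightarrow> f \<noteq> 0 \<Longrightarrow> f * g = f * h \<Longrightarrow> g = h"
  using PF_nz_mult[of f "g - h"] PF_closed(4)[of g h] by (metis eq_iff_diff_eq_0 right_diff_distrib)

lemma rho_inv: "g \<in> carrier G \<Longrightarrow> \<rho> (inv g) (\<rho> g v) = v" "g \<in> carrier G \<Longrightarrow> \<rho> g (\<rho> (inv g) v) = v"
  using rho_mult[of "inv g" g v] rho_mult[of g "inv g" v] rho_one by simp_all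

lemma act_apply: "act g f v = f (\<rho> (inv g) v)"
  by (simp add: fun_act_def)

lemma act_simps:
  "act g (f + f') = act g f + act g f'" "act g (f - f') = act g f - act g f'"
  "act g (f * f') = act g f * act g f'" "act g 0 = 0" "act g 1 = 1" "act g (- f) = - act g f"
  "act g (fscale c f) = fscale c (act g f)"
  by (auto simp: fun_act_def fun_eq_iff fscale_def)

lemma act_sum: "act g (sum f I) = (\<Sum>i\<in>I. act g (f i))"
  by (auto simp: fun_act_def fun_eq_iff sum_fun_apply)

lemma act_prod: "act g (prod f I) = (\<Prod>i\<in>I. act g (f i))"
  by (auto simp: fun_act_def fun_eq_iff prod_fun_apply)

lemma act_PF: "g \<in> carrier G \<Longrightarrow> f \<in> PF \<Longrightarrow> act g f \<in> PF"
  unfolding fun_act_def by (rule poly_funs_comp[OF _ rho_linear]) auto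

lemma act_hom: "g \<in> carrier G \<Longrightarrow> f \<in> hom_poly_funs scale d \<Longrightarrow> act g f \<in> hom_poly_funs scale d"
  unfolding fun_act_def by (rule hom_poly_funs_comp[OF _ rho_linear]) auto

lemma act_le: "g \<in> carrier G \<Longrightarrow> f \<in> poly_funs_le scale d \<Longrightarrow> act g f \<in> poly_funs_le scale d"
  unfolding fun_act_def by (rule poly_funs_le_comp[OF _ rho_linear]) auto

lemma act_act: "g \<in> carrier G \<Longrightarrow> h \<in> carrier G \<Longrightarrow> act g (act h f) = act (g \<otimes> h) f"
  by (simp add: fun_eq_iff act_apply inv_mult_group rho_mult)

lemma act_one: "act \<one> f = f"
  by (simp add: fun_eq_iff act_apply rho_one)

lemma act_inv: "g \<in> carrier G \<Longrightarrow> act (inv g) (act g f) = f" "g \<in> carrier G \<Longrightarrow> act g (act (inv g) f) = f"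
  by (simp_all add: act_act act_one)

lemma act_nz: "g \<in> carrier G \<Longrightarrow> f \<noteq> 0 \<Longrightarrow> act g f \<noteq> 0"
  using act_inv(1)[of g f] act_simps(4)[of "inv g"] by metis

section \<open>Invariant polynomials and the field of invariants\<close>

definition PFG :: "('v \<Rightarrow> 'k) set" where
  "PFG = {f \<in> PF. \<forall>g\<in>carrier G. act g f = f}"

lemma PFG_PF: "f \<in> PFG \<Longrightarrow> f \<in> PF" and PFG_act: "f \<in> PFG \<Longrightarrow> g \<in> carrier G \<Longrightarrow> act g f = f"
  by (auto simp: PFG_def)

lemma PFG_closed [intro]:
  "0 \<in> PFG" "1 \<in> PFG" "f \<in> PFG \<Longrightarrow> g \<in> PFG \<Longrightarrow> f + g \<in> PFG" "f \<in> PFG \<Longrightarrow> - f \<in> PFG"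
  "f \<in> PFG \<Longrightarrow> g \<in> PFG \<Longrightarrow> f * g \<in> PFG"
  unfolding PFG_def using PF_closed act_simps by auto

lemma PFG_rho: "f \<in> PFG \<Longrightarrow> g \<in> carrier G \<Longrightarrow> f (\<rho> g v) = f v"
  using PFG_act[of f "inv g"] by (metis act_apply inv_closed inv_inv)

text \<open>The norm of \<open>b\<close>, the product of its translates \<open>act g b\<close>, is
  invariant because translation permutes the factors; \<open>c\<close> collects the factors with
  \<open>g\<close> different from the unit.\<close>

lemma norm_invariant:
  assumes "b \<in> PF" "b \<noteq> 0"
  obtains c where "c \<in> PF" "b * c \<in> PFG" "b * c \<noteq> 0"
proof -
  let ?N = "\<Prod>g\<in>carrier G. act g b"
  let ?c = "\<Prod>g\<in>carrier G - {\<one>}. act g b"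
  have N: "?N = b * ?c" using finite_G by (simp add: prod.remove[of _ \<one>] act_one)
  have nz: "?N \<in> PF \<and> ?N \<noteq> 0" using finite_G act_PF act_nz assms by (intro PF_nz_prod) auto
  have "?c \<in> PF" by (rule poly_funs_prod) (use act_PF assms in auto)
  moreover have "act h ?N = ?N" if h: "h \<in> carrier G" for h
  proof -
    have "act h ?N = (\<Prod>g\<in>carrier G. act (h \<otimes> g) b)"
      unfolding act_prod using h by (intro prod.cong refl) (simp add: act_act)
    also have "\<dots> = ?N"
      by (rule prod.reindex_bij_witness[of _ "\<lambda>g. inv h \<otimes> g" "\<lambda>g. h \<otimes> g"])
         (use h in \<open>auto simp: m_assoc[symmetric]\<close>)
    finally show ?thesis .
  qed
  ultimately show ?thesis using that[of ?c] nz unfolding N[symmetric] PFG_def by blast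
qed

lemma frac_eq_iff:
  "a \<in> PF \<Longrightarrow> b \<in> PF \<Longrightarrow> b \<noteq> 0 \<Longrightarrow> c \<in> PF \<Longrightarrow> d \<in> PF \<Longrightarrow> d \<noteq> 0 \<Longrightarrow> fr a b = fr c d \<longleftrightarrow> a * d = c * b"
  using R.frac_class_eq_iff[of a b c d] by simp

lemma KV_add:
  "a \<in> PF \<Longrightarrow> b \<in> PF \<Longrightarrow> b \<noteq> 0 \<Longrightarrow> c \<in> PF \<Longrightarrow> d \<in> PF \<Longrightarrow> d \<noteq> 0 \<Longrightarrow>
    fr a b \<oplus>\<^bsub>KV\<^esub> fr c d = fr (a * d + c * b) (b * d)"
  unfolding rat_fun_field_def using R.frac_add[of a b c d] by simp

lemma KV_mult:
  "a \<in> PF \<Longrightarrow> b \<in> PF \<Longrightarrow> b \<noteq> 0 \<Longrightarrow> c \<in> PF \<Longrightarrow> d \<in> PF \<Longrightarrow> d \<noteq> 0 \<Longrightarrow>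
    fr a b \<otimes>\<^bsub>KV\<^esub> fr c d = fr (a * c) (b * d)"
  unfolding rat_fun_field_def using R.frac_mult[of a b c d] by simp

lemma KV_zero: "\<zero>\<^bsub>KV\<^esub> = fr 0 1" and KV_one: "\<one>\<^bsub>KV\<^esub> = fr 1 1"
  unfolding rat_fun_field_def using R.frac_zero R.frac_one by simp_all

lemma one_nz: "(1 :: 'v \<Rightarrow> 'k) \<noteq> 0"
  by (rule one_neq_zero)

lemma KV_carrier: "x \<in> carrier KV \<longleftrightarrow> (\<exists>a b. a \<in> PF \<and> b \<in> PF \<and> b \<noteq> 0 \<and> x = fr a b)"
  unfolding rat_fun_field_def R.frac_carrier by auto

lemma emb_eq: "emb a = fr a 1"
  by (simp add: frac_emb_def)

lemma frac_cancel:
  assumes "a \<in> PF" "b \<in> PF" "b \<noteq> 0" "c \<in> PF" "c \<noteq> 0"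
  shows "fr (a * c) (b * c) = fr a b"
proof (rule iffD2[OF frac_eq_iff])
  show "b * c \<noteq> 0" using PF_nz_mult assms by blast
  show "a * c * b = a * (b * c)" by (simp only: mult_ac)
qed (use assms PF_closed(6) in blast)+

text \<open>Expanding a fraction by the factor that completes its denominator to a norm makes the
  denominator invariant.\<close>

lemma KV_invariant_denominator:
  assumes "x \<in> carrier KV"
  obtains a q where "a \<in> PF" "q \<in> PFG" "q \<noteq> 0" "x = fr a q"
proof -
  obtain a b where ab: "a \<in> PF" "b \<in> PF" "b \<noteq> 0" "x = fr a b" using assms KV_carrier by blast
  obtain c where c: "c \<in> PF" "b * c \<in> PFG" "b * c \<noteq> 0" using norm_invariant[OF ab(2,3)] .
  have "c \<noteq> 0" using c(3) by auto
  hence "x = fr (a * c) (b * c)" using frac_cancel[OF ab(1-3) c(1)] ab(4) by simp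
  thus ?thesis using that c ab PF_closed(6) by metis
qed

lemma KV_map_frac:
  assumes "g \<in> carrier G" "a \<in> PF" "b \<in> PF" "b \<noteq> 0"
  shows "frac_map PR (act g) (fr a b) = fr (act g a) (act g b)"
  by (rule R.frac_map_class) (use assms act_PF act_nz act_simps in auto)

text \<open>Once the denominator is invariant, invariance of the fraction passes to the numerator by
  cancellation. Thus k(V)^G is the fraction field of k[V]^G.\<close>

lemma KVG_iff: "x \<in> KVG \<longleftrightarrow> (\<exists>a b. a \<in> PFG \<and> b \<in> PFG \<and> b \<noteq> 0 \<and> x = fr a b)"
proof
  assume x: "x \<in> KVG"
  then obtain a q where aq: "a \<in> PF" "q \<in> PFG" "q \<noteq> 0" "x = fr a q"
    using KV_invariant_denominator unfolding invariant_field_def by blast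
  have "act g a = a" if g: "g \<in> carrier G" for g
  proof -
    have "fr (act g a) q = fr a q"
      using x g KV_map_frac[OF g aq(1) PFG_PF[OF aq(2)] aq(3)] aq PFG_act unfolding invariant_field_def by simp
    hence "q * act g a = q * a"
      using aq PFG_PF act_PF g by (subst (asm) frac_eq_iff) (auto simp: mult.commute)
    thus ?thesis using PF_cancel aq PFG_PF act_PF g by metis
  qed
  hence "a \<in> PFG" using aq(1) by (simp add: PFG_def)
  thus "\<exists>a b. a \<in> PFG \<and> b \<in> PFG \<and> b \<noteq> 0 \<and> x = fr a b" using aq by blast
next
  assume "\<exists>a b. a \<in> PFG \<and> b \<in> PFG \<and> b \<noteq> 0 \<and> x = fr a b"
  then obtain a b where ab: "a \<in> PFG" "b \<in> PFG" "b \<noteq> 0" "x = fr a b" by blast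
  have PF: "a \<in> PF" "b \<in> PF" using ab PFG_PF by blast+
  have "x \<in> carrier KV" using PF ab KV_carrier by blast
  moreover have "frac_map PR (act g) x = x" if g: "g \<in> carrier G" for g
    unfolding ab(4) KV_map_frac[OF g PF ab(3)] PFG_act[OF ab(1) g] PFG_act[OF ab(2) g] ..
  ultimately show "x \<in> KVG" unfolding invariant_field_def by blast
qed

lemma KVG_subset: "KVG \<subseteq> carrier KV"
  by (auto simp: invariant_field_def)

lemma KVG_subfield: "subfield KVG KV"
proof (rule K.subfieldI')
  show "subring KVG KV"
  proof (rule K.subringI)
    show "KVG \<subseteq> carrier KV" by (rule KVG_subset)
    show "\<one>\<^bsub>KV\<^esub> \<in> KVG" unfolding KVG_iff KV_one using PFG_closed(2) one_nz by blast
  next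
    fix x assume "x \<in> KVG"
    then obtain a b where ab: "a \<in> PFG" "b \<in> PFG" "b \<noteq> 0" "x = fr a b" unfolding KVG_iff by blast
    have PF: "a \<in> PF" "b \<in> PF" "- a \<in> PF" using ab PFG_PF PF_closed(5) by blast+
    have bb: "b * b \<in> PF" "b * b \<noteq> 0" using PF ab PF_closed(6) PF_nz_mult by blast+
    have "fr (- a) b \<oplus>\<^bsub>KV\<^esub> x = fr ((- a) * b + a * b) (b * b)"
      unfolding ab(4) by (rule KV_add[OF PF(3,2) ab(3) PF(1,2) ab(3)])
    also have "(- a) * b + a * b = 0" by (simp only: mult_minus_left add.left_inverse)
    also have "fr 0 (b * b) = \<zero>\<^bsub>KV\<^esub>"
      unfolding KV_zero by (rule iffD2[OF frac_eq_iff]) (use PF_closed(1,2) bb one_nz in simp_all)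
    finally have "fr (- a) b \<oplus>\<^bsub>KV\<^esub> x = \<zero>\<^bsub>KV\<^esub>" .
    hence "\<ominus>\<^bsub>KV\<^esub> x = fr (- a) b"
      by (rule K.minus_equality) (use PF ab KV_carrier in blast)+
    thus "\<ominus>\<^bsub>KV\<^esub> x \<in> KVG" unfolding KVG_iff using ab(2,3) PFG_closed(4)[OF ab(1)] by blast
  next
    fix x y assume "x \<in> KVG" "y \<in> KVG"
    then obtain a b c d where *: "a \<in> PFG" "b \<in> PFG" "b \<noteq> 0" "x = fr a b" "c \<in> PFG" "d \<in> PFG" "d \<noteq> 0" "y = fr c d"
      unfolding KVG_iff by blast
    note PF = *(1,2,5,6)[THEN PFG_PF]
    have bd: "b * d \<in> PFG" "b * d \<noteq> 0" using *(2,6) PFG_closed(5) PF_nz_mult[OF PF(2) *(3) PF(4) *(7)] by blast+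
    have "x \<otimes>\<^bsub>KV\<^esub> y = fr (a * c) (b * d)"
      unfolding *(4,8) by (rule KV_mult[OF PF(1,2) *(3) PF(3,4) *(7)])
    thus "x \<otimes>\<^bsub>KV\<^esub> y \<in> KVG" unfolding KVG_iff using bd PFG_closed(5)[OF *(1,5)] by blast
    have "x \<oplus>\<^bsub>KV\<^esub> y = fr (a * d + c * b) (b * d)"
      unfolding *(4,8) by (rule KV_add[OF PF(1,2) *(3) PF(3,4) *(7)])
    moreover have "a * d + c * b \<in> PFG" using * PFG_closed(3,5) by blast
    ultimately show "x \<oplus>\<^bsub>KV\<^esub> y \<in> KVG" unfolding KVG_iff using bd by blast
  qed
  fix x assume x: "x \<in> KVG - {\<zero>\<^bsub>KV\<^esub>}"
  have "x \<in> KVG" using x by (rule DiffD1)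
  then obtain a b where *: "a \<in> PFG" "b \<in> PFG" "b \<noteq> 0" "x = fr a b"
    unfolding KVG_iff by (elim exE conjE)
  note PF = *(1,2)[THEN PFG_PF]
  have a: "a \<noteq> 0"
  proof
    assume a0: "a = 0"
    have "x = \<zero>\<^bsub>KV\<^esub>" unfolding KV_zero *(4) a0
      by (rule iffD2[OF frac_eq_iff]) (use PF_closed(1,2) PF * one_nz in simp_all)
    thus False using x by simp
  qed
  have "x \<otimes>\<^bsub>KV\<^esub> fr b a = fr (a * b) (b * a)"
    unfolding *(4) by (rule KV_mult[OF PF *(3) PF(2,1) a])
  also have "\<dots> = fr (1 * (a * b)) (1 * (a * b))" by (simp only: mult_1_left mult.commute)
  also have "\<dots> = \<one>\<^bsub>KV\<^esub>"
    unfolding KV_one by (rule frac_cancel) (use PF_closed(2,6) PF one_nz PF_nz_mult[OF PF(1) a PF(2) *(3)] in blast)+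
  finally have 1: "x \<otimes>\<^bsub>KV\<^esub> fr b a = \<one>\<^bsub>KV\<^esub>" .
  have c: "x \<in> carrier KV" "fr b a \<in> carrier KV" using PF * a KV_carrier by blast+
  have "inv\<^bsub>KV\<^esub> x = fr b a"
    using 1 c by (intro K.inv_char) (simp_all add: K.m_comm)
  thus "inv\<^bsub>KV\<^esub> x \<in> KVG" unfolding KVG_iff using *(1,2) a by blast
qed


text \<open>Nonsingularity of the square matrix of values \<open>b (g v)\<close>, expressed through its kernel.\<close>

definition nonsing :: "('v \<Rightarrow> 'k) set \<Rightarrow> 'v \<Rightarrow> bool" where
  "nonsing B v \<longleftrightarrow> finite B \<and> card B = card (carrier G) \<and> B \<subseteq> PF \<and>
     (\<forall>c. (\<forall>g\<in>carrier G. (\<Sum>b\<in>B. c b * b (\<rho> g v)) = 0) \<longrightarrow> (\<forall>b\<in>B. c b = 0))"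

text \<open>One determinant, of the matrix with entries \<open>act g b\<close>, provides everything:
  it is nonzero at \<open>v0\<close>, the homogeneous system over k[V] has only the zero solution,
  the right sides \<open>act g p\<close> are reached after multiplication by
  \<open>\<Delta>\<close>, and at every point where \<open>\<Delta>\<close> does not vanish
  arbitrary orbit values are interpolated. Sums over \<open>B\<close> and \<open>carrier G\<close>
  in the statement confine the enumerations to this proof.\<close>

lemma nonsing_Cramer:
  assumes ns: "nonsing B v0"
  obtains \<Delta> where "\<Delta> \<in> PF" "\<Delta> v0 \<noteq> 0"
    and "\<forall>n. (\<forall>b\<in>B. n b \<in> PF) \<longrightarrow> (\<forall>g\<in>carrier G. (\<Sum>b\<in>B. act g b * n b) = 0) \<longrightarrow> (\<forall>b\<in>B. n b = 0)"
    and "\<forall>p\<in>PF. \<exists>n. (\<forall>b\<in>B. n b \<in> PF) \<and> (\<forall>g\<in>carrier G. (\<Sum>b\<in>B. act g b * n b) = \<Delta> * act g p)"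
    and "\<forall>v y. \<Delta> v \<noteq> 0 \<longrightarrow> (\<exists>c. \<forall>g\<in>carrier G. (\<Sum>b\<in>B. c b * b (\<rho> g v)) = y g)"
proof -
  define N where "N = card (carrier G)"
  have B: "finite B" "card B = N" "B \<subseteq> PF"
    and nsB: "\<And>c b. (\<And>g. g \<in> carrier G \<Longrightarrow> (\<Sum>b\<in>B. c b * b (\<rho> g v0)) = 0) \<Longrightarrow> b \<in> B \<Longrightarrow> c b = 0"
    using ns unfolding nonsing_def N_def by blast+
  obtain gs where gs: "set gs = carrier G" "distinct gs" using finite_distinct_list[OF finite_G] by blast
  obtain bs where bs: "set bs = B" "distinct bs" using finite_distinct_list[OF B(1)] by blast
  have lgs: "length gs = N" using distinct_card[OF gs(2)] gs(1) N_def by simp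
  have lbs: "length bs = N" using distinct_card[OF bs(2)] bs(1) B(2) by simp
  have gsG: "gs ! i \<in> carrier G" if "i < N" for i using gs(1) lgs that nth_mem by blast
  have Ggs: "\<exists>i<N. g = gs ! i" if "g \<in> carrier G" for g using gs(1) lgs that by (metis in_set_conv_nth)
  have bsB: "bs ! j \<in> B" if "j < N" for j using bs(1) lbs that nth_mem by blast
  have bij: "bij_betw ((!) bs) {..<N} B" using bij_betw_nth[OF bs(2)] lbs bs(1) by simp
  \<comment> \<open>The position of \<open>b\<close> in the list, so that coefficients indexed by
    \<open>B\<close> can be read off vectors.\<close>
  define idx where "idx = inv_into {..<N} ((!) bs)"
  have idx: "idx (bs ! j) = j" if "j < N" for j
    unfolding idx_def using bij_betw_inv_into_left[OF bij] that by simp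
  have sumB: "(\<Sum>b\<in>B. F b) = (\<Sum>j<N. F (bs ! j))" for F :: "('v \<Rightarrow> 'k) \<Rightarrow> 'c::comm_monoid_add"
    by (rule sum.reindex_bij_betw[OF bij, symmetric])
  have Bbs: "\<exists>j<N. b = bs ! j" if "b \<in> B" for b using bs(1) lbs that by (metis in_set_conv_nth)
  define A where "A = mat N N (\<lambda>(i, j). act (gs ! i) (bs ! j))"
  have A: "A \<in> carrier_mat N N" by (simp add: A_def)
  have Aij: "A $$ (i, j) = act (gs ! i) (bs ! j)" if "i < N" "j < N" for i j
    using that by (simp add: A_def)
  have AS: "A $$ (i, j) \<in> PF" if "i < N" "j < N" for i j
    unfolding Aij[OF that] using act_PF gsG bsB B(3) that by blast
  define \<Delta> where "\<Delta> = det A"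
  have \<Delta>: "\<Delta> \<in> PF" unfolding \<Delta>_def
    by (rule det_in_closed_set[OF A AS PF_closed(1,2)]) (assumption | rule PF_closed)+
  have adjS: "adj_mat A $$ (i, j) \<in> PF" if "i < N" "j < N" for i j
    by (rule adj_mat_in_closed_set[OF A AS PF_closed(1,2)]) (assumption | rule PF_closed that)+
  have ev: "map_mat (\<lambda>f. f v) A \<in> carrier_mat N N"
    "\<And>i j. i < N \<Longrightarrow> j < N \<Longrightarrow> map_mat (\<lambda>f. f v) A $$ (i, j) = (bs ! j) (\<rho> (inv (gs ! i)) v)"
    "\<Delta> v = det (map_mat (\<lambda>f. f v) A)" for v
    using A by (auto simp: Aij act_apply \<Delta>_def det_eval_at)
  have \<Delta>0: "\<Delta> v0 \<noteq> 0"
  proof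
    assume "\<Delta> v0 = 0"
    then obtain x where x: "x \<in> carrier_vec N" "x \<noteq> 0\<^sub>v N" "map_mat (\<lambda>f. f v0) A *\<^sub>v x = 0\<^sub>v N"
      using det_0_iff_vec_prod_zero_field[OF ev(1)] ev(3) by metis
    have "(\<Sum>b\<in>B. x $ idx b * b (\<rho> g v0)) = 0" if g: "g \<in> carrier G" for g
    proof -
      \<comment> \<open>The value of \<open>act g b\<close> at \<open>v\<close> is that of
        \<open>b\<close> at \<open>\<rho> (inv g) v\<close>, so the condition at \<open>g\<close> is
        the row of \<open>inv g\<close>.\<close>
      obtain i where i: "i < N" "inv g = gs ! i" using Ggs g inv_closed by blast
      have "(map_mat (\<lambda>f. f v0) A *\<^sub>v x) $ i = (\<Sum>j<N. map_mat (\<lambda>f. f v0) A $$ (i, j) * x $ j)"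
        using i x(1) ev(1)[of v0] by (simp add: scalar_prod_def atLeast0LessThan)
      also have "\<dots> = (\<Sum>j<N. (bs ! j) (\<rho> g v0) * x $ j)"
        using i(1) by (intro sum.cong refl) (simp add: ev(2) i(2)[symmetric] g del: index_map_mat)
      also have "\<dots> = (\<Sum>b\<in>B. x $ idx b * b (\<rho> g v0))"
        unfolding sumB by (intro sum.cong refl) (simp add: idx)
      finally show ?thesis using i(1) unfolding x(3) by simp
    qed
    hence "x $ idx b = 0" if "b \<in> B" for b using nsB[of "\<lambda>b. x $ idx b"] that by blast
    hence "x $ j = 0" if "j < N" for j using that idx bsB by metis
    thus False using x(1,2) by (metis carrier_vecD eq_vecI index_zero_vec)
  qed
  show ?thesis
  proof (rule that[OF \<Delta> \<Delta>0]; intro allI impI ballI)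
    fix n b assume n: "\<forall>b\<in>B. n b \<in> PF" and b: "b \<in> B"
      and eq: "\<forall>g\<in>carrier G. (\<Sum>b\<in>B. act g b * n b) = 0"
    obtain j where j: "j < N" "b = bs ! j" using Bbs b by blast
    have "\<Delta> * n (bs ! j) = 0" unfolding \<Delta>_def
    proof (rule det_mult_kernel[OF A _ j(1), where x = "\<lambda>j. n (bs ! j)"])
      fix i assume i: "i < N"
      have "(\<Sum>j<N. A $$ (i, j) * n (bs ! j)) = (\<Sum>b\<in>B. act (gs ! i) b * n b)"
        unfolding sumB using i by (intro sum.cong refl) (simp add: Aij)
      thus "(\<Sum>j<N. A $$ (i, j) * n (bs ! j)) = 0" using bspec[OF eq gsG[OF i]] by (simp only:)
    qed
    moreover have "\<Delta> \<noteq> 0" using \<Delta>0 by auto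
    ultimately show "n b = 0" using PF_nz_mult[OF \<Delta> _ bspec[OF n b]] j(2) by blast
  next
    fix p assume p: "p \<in> PF"
    define x where "x j = (\<Sum>l<N. adj_mat A $$ (j, l) * act (gs ! l) p)" for j
    have "x (idx b) \<in> PF" if "b \<in> B" for b
    proof -
      obtain j where j: "j < N" "b = bs ! j" using Bbs \<open>b \<in> B\<close> by blast
      have "x j \<in> PF" unfolding x_def by (intro PF_sum PF_closed(6) adjS act_PF p gsG j(1)) simp_all
      thus ?thesis using j idx by metis
    qed
    moreover have "(\<Sum>b\<in>B. act g b * x (idx b)) = \<Delta> * act g p" if g: "g \<in> carrier G" for g
    proof -
      obtain i where i: "i < N" "g = gs ! i" using Ggs[OF g] by blast
      have "(\<Sum>b\<in>B. act g b * x (idx b)) = (\<Sum>j<N. A $$ (i, j) * x j)"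
        unfolding sumB using i by (intro sum.cong refl) (simp add: Aij idx)
      also have "\<dots> = \<Delta> * act (gs ! i) p" unfolding x_def \<Delta>_def by (rule adj_mat_solves[OF A i(1)])
      finally show ?thesis using i(2) by (simp only:)
    qed
    ultimately show "\<exists>n. (\<forall>b\<in>B. n b \<in> PF) \<and> (\<forall>g\<in>carrier G. (\<Sum>b\<in>B. act g b * n b) = \<Delta> * act g p)"
      by (intro exI[of _ "\<lambda>b. x (idx b)"]) blast
  next
    fix v y assume nz: "\<Delta> v \<noteq> 0"
    let ?A = "map_mat (\<lambda>f. f v) A"
    \<comment> \<open>The prescribed values are listed at inverses for the same reason as the rows.
      At a single point the solution can be divided by \<open>\<Delta> v\<close>.\<close>
    define x where "x j = (\<Sum>l<N. adj_mat ?A $$ (j, l) * y (inv (gs ! l)))" for j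
    have "(\<Sum>b\<in>B. (x (idx b) / \<Delta> v) * b (\<rho> g v)) = y g" if g: "g \<in> carrier G" for g
    proof -
      obtain i where i: "i < N" "inv g = gs ! i" using Ggs g inv_closed by blast
      have "(\<Sum>b\<in>B. (x (idx b) / \<Delta> v) * b (\<rho> g v)) = (\<Sum>j<N. ?A $$ (i, j) * x j) / \<Delta> v"
        unfolding sumB sum_divide_distrib using i(1)
        by (intro sum.cong refl) (simp add: ev(2) i(2)[symmetric] g idx del: index_map_mat)
      also have "\<dots> = (\<Delta> v * y (inv (gs ! i))) / \<Delta> v"
        unfolding x_def adj_mat_solves[OF ev(1) i(1)] ev(3) ..
      also have "\<dots> = y g" using nz i(2)[symmetric] g by simp
      finally show ?thesis .
    qed
    thus "\<exists>c. \<forall>g\<in>carrier G. (\<Sum>b\<in>B. c b * b (\<rho> g v)) = y g"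
      by (intro exI[of _ "\<lambda>b. x (idx b) / \<Delta> v"]) blast
  qed
qed


section \<open>Nonsingular families are bases of k(V) over k(V)^G\<close>

lemma emb_carrier: "b \<in> PF \<Longrightarrow> emb b \<in> carrier KV"
  unfolding emb_eq KV_carrier using PF_closed(2) one_nz by blast

lemma combine_frac:
  assumes d: "d \<in> PF" "d \<noteq> 0"
    and "distinct bs" "set bs \<subseteq> PF" "\<And>b. b \<in> set bs \<Longrightarrow> n b \<in> PF"
  shows "K.combine (map (\<lambda>b. fr (n b) d) bs) (map emb bs) = fr (\<Sum>b\<in>set bs. n b * b) d"
  using assms(3-)
proof (induction bs)
  case Nil
  have "fr 0 1 = fr 0 d"
    by (rule iffD2[OF frac_eq_iff]) (use d one_nz PF_closed(1,2) in simp_all)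
  thus ?case by (simp only: list.map list.set sum.empty K.combine.simps KV_zero)
next
  case (Cons b bs)
  define s where "s = (\<Sum>b\<in>set bs. n b * b)"
  have b: "b \<in> PF" "n b \<in> PF" using Cons.prems by simp_all
  have s: "s \<in> PF" unfolding s_def using Cons.prems by (intro PF_sum PF_closed(6)) auto
  have nb: "n b * b \<in> PF" using b PF_closed(6) by blast
  have "fr (n b) d \<otimes>\<^bsub>KV\<^esub> emb b = fr (n b * b) (d * 1)"
    unfolding emb_eq by (rule KV_mult[OF b(2) d b(1) PF_closed(2) one_nz])
  hence 1: "fr (n b) d \<otimes>\<^bsub>KV\<^esub> emb b = fr (n b * b) d" by (simp only: mult_1_right)
  have IH: "K.combine (map (\<lambda>b. fr (n b) d) bs) (map emb bs) = fr s d"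
    unfolding s_def by (rule Cons.IH) (use Cons.prems in auto)
  have "fr (n b * b) d \<oplus>\<^bsub>KV\<^esub> fr s d = fr (n b * b * d + s * d) (d * d)"
    by (rule KV_add[OF nb d s d])
  also have "\<dots> = fr ((n b * b + s) * d) (d * d)" by (simp only: distrib_right)
  also have "\<dots> = fr (n b * b + s) d"
    by (rule frac_cancel[OF PF_closed(3)[OF nb s] d d])
  also have "n b * b + s = (\<Sum>b\<in>set (b # bs). n b * b)"
    unfolding s_def using Cons.prems(1) by (simp del: plus_fun_apply)
  finally show ?case by (simp only: list.map K.combine.simps 1 IH)
qed

lemma KVG_common_denominator:
  assumes "finite B" "\<And>b. b \<in> B \<Longrightarrow> k b \<in> KVG"
  obtains d n where "d \<in> PFG" "d \<noteq> 0" "\<forall>b\<in>B. n b \<in> PFG \<and> k b = fr (n b) d"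
proof -
  have "\<exists>n d. d \<in> PFG \<and> d \<noteq> 0 \<and> (\<forall>b\<in>B. n b \<in> PFG \<and> k b = fr (n b) d)"
    using assms
  proof (induction B rule: finite_induct)
    case empty
    show ?case using PFG_closed(2) one_nz by blast
  next
    case (insert b B)
    obtain n d where nd: "d \<in> PFG" "d \<noteq> 0" "\<And>b. b \<in> B \<Longrightarrow> n b \<in> PFG \<and> k b = fr (n b) d"
      using insert.IH insert.prems by blast
    have "k b \<in> KVG" using insert.prems by blast
    then obtain a c where ac: "a \<in> PFG" "c \<in> PFG" "c \<noteq> 0" "k b = fr a c"
      unfolding KVG_iff by (elim exE conjE)
    define n' where "n' b' = (if b' = b then a * d else n b' * c)" for b'
    have dc: "d * c \<in> PFG" "d * c \<noteq> 0"
      using nd(1) ac(2) PFG_closed(5) PF_nz_mult[OF PFG_PF[OF nd(1)] nd(2) PFG_PF[OF ac(2)] ac(3)] by blast+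
    have "n' b' \<in> PFG \<and> k b' = fr (n' b') (d * c)" if b': "b' \<in> insert b B" for b'
    proof (cases "b' = b")
      case True
      have "fr (a * d) (c * d) = fr a c"
        by (rule frac_cancel) (use ac nd PFG_PF in blast)+
      thus ?thesis using True ac(1,4) nd(1) PFG_closed(5) by (simp only: n'_def if_True simp_thms mult.commute[of d c])
    next
      case False
      have n: "n b' \<in> PFG" "k b' = fr (n b') d" using nd(3) b' False by blast+
      have "fr (n b' * c) (d * c) = fr (n b') d"
        by (rule frac_cancel) (use ac nd n PFG_PF in blast)+
      thus ?thesis using False n ac(2) PFG_closed(5) by (simp only: n'_def if_False simp_thms)
    qed
    thus ?case using dc by blast
  qed
  thus ?thesis using that by blast
qed

text \<open>For \<open>x = a / q\<close> the system with right sides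
  \<open>\<Delta> * act g a\<close> has a polynomial solution \<open>n\<close>, and its equation at
  the unit writes \<open>x\<close> as the combination with coefficients
  \<open>n b / (\<Delta> q)\<close>. These are invariant, because applying \<open>h\<close> permutes
  the equations and solutions are unique.\<close>

lemma nonsing_spans:
  assumes ns: "nonsing B v0"
  shows "spans_over KV KVG (emb ` B)"
  unfolding spans_over_def
proof (intro conjI ballI)
  have B: "finite B" "B \<subseteq> PF" using ns unfolding nonsing_def by blast+
  show "emb ` B \<subseteq> carrier KV" using B(2) emb_carrier by blast
  fix x assume "x \<in> carrier KV"
  then obtain a q where aq: "a \<in> PF" "q \<in> PFG" "q \<noteq> 0" "x = fr a q"
    by (rule KV_invariant_denominator)
  obtain \<Delta> where \<Delta>: "\<Delta> \<in> PF" "\<Delta> v0 \<noteq> 0"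
    and uniq: "\<forall>n. (\<forall>b\<in>B. n b \<in> PF) \<longrightarrow> (\<forall>g\<in>carrier G. (\<Sum>b\<in>B. act g b * n b) = 0) \<longrightarrow> (\<forall>b\<in>B. n b = 0)"
    and solve: "\<forall>p\<in>PF. \<exists>n. (\<forall>b\<in>B. n b \<in> PF) \<and> (\<forall>g\<in>carrier G. (\<Sum>b\<in>B. act g b * n b) = \<Delta> * act g p)"
    and "\<forall>v y. \<Delta> v \<noteq> 0 \<longrightarrow> (\<exists>c. \<forall>g\<in>carrier G. (\<Sum>b\<in>B. c b * b (\<rho> g v)) = y g)"
    by (rule nonsing_Cramer[OF ns])
  have \<Delta>nz: "\<Delta> \<noteq> 0" using \<Delta>(2) by auto
  obtain n where "(\<forall>b\<in>B. n b \<in> PF) \<and> (\<forall>g\<in>carrier G. (\<Sum>b\<in>B. act g b * n b) = \<Delta> * act g a)"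
    using bspec[OF solve aq(1)] by (rule exE)
  hence nPF: "\<And>b. b \<in> B \<Longrightarrow> n b \<in> PF"
    and eq: "\<And>g. g \<in> carrier G \<Longrightarrow> (\<Sum>b\<in>B. act g b * n b) = \<Delta> * act g a" by blast+
  have inv: "act h (n b) * \<Delta> = act h \<Delta> * n b" if h: "h \<in> carrier G" and b: "b \<in> B" for h b
  proof -
    \<comment> \<open>\<open>act h (n b)\<close> and \<open>n b\<close> solve the same system up to
      the factors \<open>act h \<Delta>\<close> and \<open>\<Delta>\<close>, so this
      cross-difference solves the homogeneous one.\<close>
    let ?m = "\<lambda>b. act h (n b) * \<Delta> - act h \<Delta> * n b"
    have "\<forall>b\<in>B. ?m b = 0"
    proof (rule mp[OF mp[OF spec[OF uniq, of ?m]]]; intro ballI)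
      show "?m b \<in> PF" if "b \<in> B" for b
        using that nPF act_PF[OF h] \<Delta>(1) by (intro PF_closed(4,6)) auto
    next
      fix g assume g: "g \<in> carrier G"
      \<comment> \<open>Starting from the equation at \<open>inv h \<otimes> g\<close>, the
        application of \<open>h\<close> lands in row \<open>g\<close>.\<close>
      have "act h (\<Sum>b\<in>B. act (inv h \<otimes> g) b * n b) = act h (\<Delta> * act (inv h \<otimes> g) a)"
        using eq[of "inv h \<otimes> g"] g h by (simp only: m_closed inv_closed)
      moreover have hg: "act h (act (inv h \<otimes> g) f) = act g f" for f
        using g h by (simp add: act_act m_assoc[symmetric])
      ultimately have eqh: "(\<Sum>b\<in>B. act g b * act h (n b)) = act h \<Delta> * act g a"
        by (simp only: act_sum act_simps(3) hg)
      have "(\<Sum>b\<in>B. act g b * (act h (n b) * \<Delta> - act h \<Delta> * n b)) =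
          (\<Sum>b\<in>B. act g b * act h (n b)) * \<Delta> - act h \<Delta> * (\<Sum>b\<in>B. act g b * n b)"
        unfolding sum_distrib_left sum_distrib_right sum_subtractf[symmetric]
        by (intro sum.cong refl) (simp only: right_diff_distrib mult_ac)
      also have "\<dots> = 0" unfolding eqh eq[OF g] by (simp only: mult_ac diff_self)
      finally show "(\<Sum>b\<in>B. act g b * (act h (n b) * \<Delta> - act h \<Delta> * n b)) = 0" .
    qed
    thus ?thesis using b by (simp only: right_minus_eq)
  qed
  have \<Delta>q: "\<Delta> * q \<in> PF" "\<Delta> * q \<noteq> 0"
    using PF_closed(6)[OF \<Delta>(1) PFG_PF[OF aq(2)]] PF_nz_mult[OF \<Delta>(1) \<Delta>nz PFG_PF[OF aq(2)] aq(3)] by blast+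
  have kG: "fr (n b) (\<Delta> * q) \<in> KVG" if b: "b \<in> B" for b
    unfolding invariant_field_def
  proof (intro CollectI conjI ballI)
    show "fr (n b) (\<Delta> * q) \<in> carrier KV" using nPF[OF b] \<Delta>q KV_carrier by blast
    fix h assume h: "h \<in> carrier G"
    have "frac_map PR (act h) (fr (n b) (\<Delta> * q)) = fr (act h (n b)) (act h (\<Delta> * q))"
      by (rule KV_map_frac[OF h nPF[OF b] \<Delta>q])
    also have "\<dots> = fr (n b) (\<Delta> * q)"
    proof (rule iffD2[OF frac_eq_iff])
      have "act h (n b) * (\<Delta> * q) = (act h (n b) * \<Delta>) * q" by (simp only: mult.assoc)
      also have "\<dots> = n b * act h (\<Delta> * q)"
        unfolding inv[OF h b] act_simps(3) PFG_act[OF aq(2) h] by (simp only: mult_ac)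
      finally show "act h (n b) * (\<Delta> * q) = n b * act h (\<Delta> * q)" .
    qed (use act_PF[OF h] act_nz[OF h] nPF[OF b] \<Delta>q in blast)+
    finally show "frac_map PR (act h) (fr (n b) (\<Delta> * q)) = fr (n b) (\<Delta> * q)" .
  qed
  obtain bs where bs: "set bs = B" "distinct bs" using finite_distinct_list[OF B(1)] by blast
  have "K.combine (map (\<lambda>b. fr (n b) (\<Delta> * q)) bs) (map emb bs) = fr (\<Sum>b\<in>set bs. n b * b) (\<Delta> * q)"
    by (rule combine_frac[OF \<Delta>q bs(2)]) (use bs(1) B(2) nPF in auto)
  also have "(\<Sum>b\<in>set bs. n b * b) = a * \<Delta>"
    using eq[OF one_closed] unfolding act_one bs(1) by (simp only: mult.commute)
  also have "fr (a * \<Delta>) (\<Delta> * q) = x"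
    using frac_cancel[OF aq(1) PFG_PF[OF aq(2)] aq(3) \<Delta>(1) \<Delta>nz] unfolding aq(4) by (simp only: mult.commute)
  finally have "x = K.combine (map (\<lambda>b. fr (n b) (\<Delta> * q)) bs) (map emb bs)" by (rule sym)
  moreover have "set (map (\<lambda>b. fr (n b) (\<Delta> * q)) bs) \<subseteq> KVG" using kG bs(1) by auto
  moreover have c: "set (map emb bs) \<subseteq> carrier KV" using B(2) bs(1) emb_carrier by auto
  ultimately have "x \<in> K.Span KVG (map emb bs)"
    unfolding K.Span_eq_combine_set[OF KVG_subfield c] by blast
  thus "\<exists>us. set us \<subseteq> emb ` B \<and> x \<in> K.Span KVG us"
    using bs(1) by (intro exI[of _ "map emb bs"]) simp
qed

text \<open>Clearing denominators leaves a relation with invariant polynomial coefficients.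
  Translating it by every \<open>g\<close> moves only the elements of \<open>B\<close> and yields
  the full homogeneous system, whose only solution is 0.\<close>

lemma nonsing_independent:
  assumes ns: "nonsing B v0"
  shows "independent_over KV KVG (emb ` B)"
  unfolding independent_over_def
proof (intro allI impI)
  fix us assume us: "distinct us \<and> set us \<subseteq> emb ` B"
  have B: "finite B" "B \<subseteq> PF" using ns unfolding nonsing_def by blast+
  have "\<exists>bs. us = map emb bs \<and> set bs \<subseteq> B" 
    using us
  proof (induction us)
    case (Cons u us)
    then obtain bs b where "us = map emb bs" "set bs \<subseteq> B" "u = emb b" "b \<in> B" by auto
    thus ?case by (intro exI[of _ "b # bs"]) simp
  qed simp
  then obtain bs where bs: "us = map emb bs" "set bs \<subseteq> B" by blast
  have dbs: "distinct bs" using us bs(1) by (simp add: distinct_map)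
  have c: "set us \<subseteq> carrier KV" using bs B(2) emb_carrier by auto
  obtain \<Delta> where "\<Delta> \<in> PF" "\<Delta> v0 \<noteq> 0"
    and uniq: "\<forall>n. (\<forall>b\<in>B. n b \<in> PF) \<longrightarrow> (\<forall>g\<in>carrier G. (\<Sum>b\<in>B. act g b * n b) = 0) \<longrightarrow> (\<forall>b\<in>B. n b = 0)"
    and "\<forall>p\<in>PF. \<exists>n. (\<forall>b\<in>B. n b \<in> PF) \<and> (\<forall>g\<in>carrier G. (\<Sum>b\<in>B. act g b * n b) = \<Delta> * act g p)"
    and "\<forall>v y. \<Delta> v \<noteq> 0 \<longrightarrow> (\<exists>c. \<forall>g\<in>carrier G. (\<Sum>b\<in>B. c b * b (\<rho> g v)) = y g)"
    by (rule nonsing_Cramer[OF ns])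
  show "K.independent KVG us"
  proof (rule ccontr)
    assume dep: "\<not> K.independent KVG us"
    hence ne: "us \<noteq> []" using K.li_Nil by blast
    obtain Ks where Ks: "length Ks = length us" "K.combine Ks us = \<zero>\<^bsub>KV\<^esub>" "set Ks \<subseteq> KVG" "set Ks \<noteq> {\<zero>\<^bsub>KV\<^esub>}"
      using K.dependent_imp_non_trivial_combine[OF KVG_subfield c dep] by blast
    \<comment> \<open>The coefficient list as a function on the elements of \<open>bs\<close>, which
      are distinct.\<close>
    define k where "k b = the (map_of (zip bs Ks) b)" for b
    have Ksk: "Ks = map k bs"
      by (rule nth_equalityI) (use Ks(1) bs(1) dbs in \<open>auto simp: k_def map_of_zip_nth\<close>)
    have kG: "k b \<in> KVG" if "b \<in> set bs" for b using that Ks(3) Ksk by auto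
    obtain d n where nd0: "d \<in> PFG" "d \<noteq> 0" "\<forall>b\<in>set bs. n b \<in> PFG \<and> k b = fr (n b) d"
      by (rule KVG_common_denominator[OF finite_set kG])
    note nd = nd0(1,2) bspec[OF nd0(3)]
    note dPF = PFG_PF[OF nd(1)]
    have "Ks = map (\<lambda>b. fr (n b) d) bs" unfolding Ksk using nd(3) by simp
    hence "fr (\<Sum>b\<in>set bs. n b * b) d = fr 0 1"
      using combine_frac[OF dPF nd(2) dbs, of n] Ks(2) bs B(2) nd(3) PFG_PF unfolding KV_zero by auto
    moreover have sPF: "(\<Sum>b\<in>set bs. n b * b) \<in> PF"
      using nd(3) PFG_PF bs(2) B(2) by (intro PF_sum PF_closed(6)) blast+
    ultimately have s0: "(\<Sum>b\<in>set bs. n b * b) = 0"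
      using frac_eq_iff[OF sPF dPF nd(2) PF_closed(1,2) one_nz] by (simp only: mult_1_right mult_zero_left)
    \<comment> \<open>Extension by 0, as the square system has one unknown for each element of
      \<open>B\<close>.\<close>
    define n' where "n' b = (if b \<in> set bs then n b else 0)" for b
    have n'PF: "n' b \<in> PF" for b
      using nd(3)[THEN conjunct1, THEN PFG_PF] PF_closed(1) by (cases "b \<in> set bs") (simp_all only: n'_def if_True if_False)
    have "(\<Sum>b\<in>B. act g b * n' b) = 0" if g: "g \<in> carrier G" for g
    proof -
      have "(\<Sum>b\<in>B. act g b * n' b) = (\<Sum>b\<in>set bs. act g b * n' b)"
        by (rule sum.mono_neutral_right[OF B(1) bs(2)]) (simp add: n'_def del: zero_fun_apply times_fun_apply)
      also have "\<dots> = (\<Sum>b\<in>set bs. act g (n b * b))"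
        using nd(3)[THEN conjunct1, THEN PFG_act[OF _ g]]
        by (intro sum.cong refl) (simp only: act_simps(3) n'_def if_True mult.commute)
      also have "\<dots> = act g (\<Sum>b\<in>set bs. n b * b)" by (rule act_sum[symmetric])
      also have "\<dots> = 0" unfolding s0 act_simps(4) ..
      finally show ?thesis .
    qed
    hence n'0: "\<forall>b\<in>B. n' b = 0" using spec[OF uniq, of n'] n'PF by blast
    have n0: "n b = 0" if "b \<in> set bs" for b using that bs(2) n'_def[of b] n'0 by (metis subsetD)
    have "k b = \<zero>\<^bsub>KV\<^esub>" if b: "b \<in> set bs" for b
    proof -
      have "fr 0 d = fr 0 1" using frac_eq_iff[OF PF_closed(1) dPF nd(2) PF_closed(1,2) one_nz]
        by (simp only: mult_zero_left)
      thus ?thesis using nd(3)[OF b] n0[OF b] KV_zero by metis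
    qed
    hence "set Ks \<subseteq> {\<zero>\<^bsub>KV\<^esub>}" unfolding Ksk by auto
    moreover have "set Ks \<noteq> {}" using ne Ks(1) by auto
    ultimately show False using Ks(4) subset_singletonD by metis
  qed
qed

lemma nonsing_basis: "nonsing B v0 \<Longrightarrow> basis_over KV KVG (emb ` B)"
  unfolding basis_over_def using nonsing_spans nonsing_independent by blast

end

section \<open>Free orbits and the spanning degree\<close>

context poly_rep
begin

text \<open>Invariant polynomials are constant on orbits. At a fixed \<open>v\<close> they act as
  scalars, so the numerator of a combination over k(V)^G agrees along the orbit with a k-combination
  of elements of \<open>M\<close>; this \<open>m\<close> depends on \<open>v\<close>. No division
  occurs, so zeros of the denominator are harmless.\<close>

lemma spanned_fraction:
  assumes M: "fun_space.subspace M" "M \<subseteq> PF"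
    and us: "set us \<subseteq> emb ` M" and x: "x \<in> K.Span KVG us"
  shows "\<exists>a q. a \<in> PF \<and> q \<in> PFG \<and> q \<noteq> 0 \<and> x = fr a q \<and>
    (\<forall>v. \<exists>m\<in>M. \<forall>g\<in>carrier G. a (\<rho> g v) = m (\<rho> g v))"
  using us x
proof (induction us arbitrary: x)
  case Nil
  hence x: "x = fr 0 1" by (simp add: KV_zero)
  have "\<forall>v. \<exists>m\<in>M. \<forall>g\<in>carrier G. 0 (\<rho> g v) = m (\<rho> g v)"
    using fun_space.subspace_0[OF M(1)] by blast
  thus ?case using x PF_closed(1) PFG_closed(2) one_nz by blast
next
  case (Cons u us)
  obtain m where m: "m \<in> M" "u = emb m" using Cons.prems(1) by auto
  have "x \<in> K.line_extension KVG u (K.Span KVG us)" using Cons.prems(2) by simp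
  then obtain k e where ke: "k \<in> KVG" "e \<in> K.Span KVG us" "x = k \<otimes>\<^bsub>KV\<^esub> u \<oplus>\<^bsub>KV\<^esub> e"
    unfolding K.line_extension_mem_iff by (elim bexE)
  have usM: "set us \<subseteq> emb ` M" using Cons.prems(1) by simp
  obtain a q where aq: "a \<in> PF" "q \<in> PFG" "q \<noteq> 0" "e = fr a q"
    and aM: "\<forall>v. \<exists>m\<in>M. \<forall>g\<in>carrier G. a (\<rho> g v) = m (\<rho> g v)"
    using Cons.IH[OF usM ke(2)] by (elim exE conjE)
  obtain n d where nd: "n \<in> PFG" "d \<in> PFG" "d \<noteq> 0" "k = fr n d"
    using ke(1) unfolding KVG_iff by (elim exE conjE)
  have mPF: "m \<in> PF" using m(1) M(2) by blast
  note PF = PFG_PF[OF nd(1)] PFG_PF[OF nd(2)] PFG_PF[OF aq(2)]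
  have nm: "n * m \<in> PF" by (rule PF_closed(6)[OF PF(1) mPF])
  have "k \<otimes>\<^bsub>KV\<^esub> u = fr (n * m) (d * 1)"
    unfolding m(2) nd(4) emb_eq by (rule KV_mult[OF PF(1,2) nd(3) mPF PF_closed(2) one_nz])
  hence "x = fr (n * m) d \<oplus>\<^bsub>KV\<^esub> fr a q" unfolding ke(3) aq(4) by (simp only: mult_1_right)
  also have "\<dots> = fr (n * m * q + a * d) (d * q)"
    by (rule KV_add[OF nm PF(2) nd(3) aq(1) PF(3) aq(3)])
  finally have x: "x = fr (n * m * q + a * d) (d * q)" .
  have "n * m * q + a * d \<in> PF" using nm aq(1) PF PF_closed(3,6) by blast
  moreover have "d * q \<in> PFG" "d * q \<noteq> 0"
    using PFG_closed(5)[OF nd(2) aq(2)] PF_nz_mult[OF PF(2) nd(3) PF(3) aq(3)] by blast+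
  moreover have "\<exists>m'\<in>M. \<forall>g\<in>carrier G. (n * m * q + a * d) (\<rho> g v) = m' (\<rho> g v)" for v
  proof -
    obtain m' where m': "m' \<in> M" "\<forall>g\<in>carrier G. a (\<rho> g v) = m' (\<rho> g v)" using aM by blast
    have "fscale (n v * q v) m + fscale (d v) m' \<in> M"
      using m(1) m'(1) fun_space.subspace_add[OF M(1)] fun_space.subspace_scale[OF M(1)] by blast
    moreover have "(n * m * q + a * d) (\<rho> g v) = (fscale (n v * q v) m + fscale (d v) m') (\<rho> g v)"
      if g: "g \<in> carrier G" for g
      using m'(2) g by (simp add: fscale_def PFG_rho[OF nd(1) g] PFG_rho[OF nd(2) g] PFG_rho[OF aq(2) g])
    ultimately show ?thesis by blast
  qed
  ultimately show ?case using x by blast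
qed

text \<open>After multiplication by an invariant \<open>q b\<close>, each \<open>b\<close> in
  \<open>Y\<close> agrees with an element of \<open>M\<close> on every orbit. At a point where
  neither \<open>\<Delta>\<close> nor any \<open>q b\<close> vanishes, dividing by the scalar
  \<open>q b v\<close> lets \<open>M\<close> attain all values that \<open>Y\<close>
  interpolates.\<close>

lemma spans_over_imp_surjective:
  assumes M: "fun_space.subspace M" "M \<subseteq> PF" and sp: "spans_over KV KVG (emb ` M)"
    and ns: "nonsing Y v0"
  shows "\<exists>v. \<forall>y. \<exists>m\<in>M. \<forall>g\<in>carrier G. m (\<rho> g v) = y g"
proof -
  have Y: "finite Y" "Y \<subseteq> PF" using ns unfolding nonsing_def by blast+
  have "\<forall>b\<in>Y. \<exists>q. q \<in> PFG \<and> q \<noteq> 0 \<and>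
    (\<forall>v. \<exists>m\<in>M. \<forall>g\<in>carrier G. b (\<rho> g v) * q v = m (\<rho> g v))"
  proof
    fix b assume b: "b \<in> Y"
    hence bPF: "b \<in> PF" using Y by blast
    obtain us where us: "set us \<subseteq> emb ` M" "emb b \<in> K.Span KVG us"
      using sp emb_carrier[OF bPF] unfolding spans_over_def by blast
    obtain a q where aq: "a \<in> PF" "q \<in> PFG" "q \<noteq> 0" "emb b = fr a q"
      and aM: "\<forall>v. \<exists>m\<in>M. \<forall>g\<in>carrier G. a (\<rho> g v) = m (\<rho> g v)"
      using spanned_fraction[OF M us] by (elim exE conjE)
    have "b * q = a * 1"
      using aq(4) unfolding emb_eq
        frac_eq_iff[OF bPF PF_closed(2) one_nz aq(1) PFG_PF[OF aq(2)] aq(3)] .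
    hence ba: "b * q = a" by (simp only: mult_1_right)
    have "b (\<rho> g v) * q v = a (\<rho> g v)" if "g \<in> carrier G" for g v
      unfolding ba[symmetric] using PFG_rho[OF aq(2) that] by simp
    hence "\<forall>v. \<exists>m\<in>M. \<forall>g\<in>carrier G. b (\<rho> g v) * q v = m (\<rho> g v)" using aM by simp
    thus "\<exists>q. q \<in> PFG \<and> q \<noteq> 0 \<and> (\<forall>v. \<exists>m\<in>M. \<forall>g\<in>carrier G. b (\<rho> g v) * q v = m (\<rho> g v))"
      using aq(2,3) by (intro exI[of _ q] conjI)
  qed
  then obtain q where q: "\<forall>b\<in>Y. q b \<in> PFG \<and> q b \<noteq> 0 \<and>
    (\<forall>v. \<exists>m\<in>M. \<forall>g\<in>carrier G. b (\<rho> g v) * q b v = m (\<rho> g v))"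
    by (rule bchoice[THEN exE])
  obtain \<Delta> where \<Delta>: "\<Delta> \<in> PF" "\<Delta> v0 \<noteq> 0"
    and "\<forall>n. (\<forall>b\<in>Y. n b \<in> PF) \<longrightarrow> (\<forall>g\<in>carrier G. (\<Sum>b\<in>Y. act g b * n b) = 0) \<longrightarrow> (\<forall>b\<in>Y. n b = 0)"
    and "\<forall>p\<in>PF. \<exists>n. (\<forall>b\<in>Y. n b \<in> PF) \<and> (\<forall>g\<in>carrier G. (\<Sum>b\<in>Y. act g b * n b) = \<Delta> * act g p)"
    and solve: "\<forall>v y. \<Delta> v \<noteq> 0 \<longrightarrow> (\<exists>c. \<forall>g\<in>carrier G. (\<Sum>b\<in>Y. c b * b (\<rho> g v)) = y g)"
    by (rule nonsing_Cramer[OF ns])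
  have Q: "prod q Y \<in> PF \<and> prod q Y \<noteq> 0"
    by (rule PF_nz_prod[OF Y(1)]) (use q PFG_PF in blast)
  have "\<Delta> \<noteq> 0" using \<Delta>(2) by auto
  hence "\<Delta> * prod q Y \<noteq> 0" using PF_nz_mult[OF \<Delta>(1)] Q by blast
  \<comment> \<open>One product collects all conditions on a generic point; it is nonzero because
    polynomial functions form a domain.\<close>
  then obtain v where v: "(\<Delta> * prod q Y) v \<noteq> 0" by (metis ext zero_fun_apply)
  hence \<Delta>v: "\<Delta> v \<noteq> 0" by simp
  have qv: "q b v \<noteq> 0" if "b \<in> Y" for b
    using v that Y(1) by (auto simp: prod_fun_apply)
  have "\<exists>m\<in>M. \<forall>g\<in>carrier G. m (\<rho> g v) = y g" for y
  proof -
    obtain c where c: "\<forall>g\<in>carrier G. (\<Sum>b\<in>Y. c b * b (\<rho> g v)) = y g" using solve \<Delta>v by blast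
    have "\<forall>b\<in>Y. \<exists>m. m \<in> M \<and> (\<forall>g\<in>carrier G. b (\<rho> g v) * q b v = m (\<rho> g v))" using q by blast
    then obtain m where m: "\<forall>b\<in>Y. m b \<in> M \<and> (\<forall>g\<in>carrier G. b (\<rho> g v) * q b v = m b (\<rho> g v))"
      by (rule bchoice[THEN exE])
    define w where "w = (\<Sum>b\<in>Y. fscale (c b / q b v) (m b))"
    have "w \<in> M" unfolding w_def
      using m fun_space.subspace_scale[OF M(1)] by (intro fun_space.subspace_sum[OF M(1)]) blast
    moreover have "w (\<rho> g v) = y g" if g: "g \<in> carrier G" for g
    proof -
      have "w (\<rho> g v) = (\<Sum>b\<in>Y. c b / q b v * m b (\<rho> g v))"
        by (simp add: w_def sum_fun_apply fscale_def)
      also have "\<dots> = (\<Sum>b\<in>Y. c b * b (\<rho> g v))"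
      proof (rule sum.cong[OF refl])
        fix b assume b: "b \<in> Y"
        have "m b (\<rho> g v) = b (\<rho> g v) * q b v" using m b g by simp
        thus "c b / q b v * m b (\<rho> g v) = c b * b (\<rho> g v)" using qv[OF b] by simp
      qed
      finally show ?thesis using c g by simp
    qed
    ultimately show ?thesis by blast
  qed
  thus ?thesis by blast
qed

end

text \<open>\<open>separating\<close> supplies the functionals from which polynomials telling orbit
  points apart are built.\<close>

locale faithful_poly_rep = poly_rep G scale \<rho>
  for G :: "('g, 'm) monoid_scheme" (structure)
    and scale :: "'k::field \<Rightarrow> 'v::ab_group_add \<Rightarrow> 'v" and \<rho> :: "'g \<Rightarrow> 'v \<Rightarrow> 'v" +
  assumes faithful: "g \<in> carrier G \<Longrightarrow> (\<And>v. \<rho> g v = v) \<Longrightarrow> g = \<one>"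
    and separating: "v \<noteq> 0 \<Longrightarrow> \<exists>l. Vector_Spaces.linear scale (*) l \<and> l v \<noteq> (0 :: 'k)"
begin

text \<open>For \<open>g\<close> other than the unit, some functional \<open>l\<close> makes
  \<open>l (\<rho> g v) - l v\<close> a nonzero polynomial in \<open>v\<close>, and it vanishes at
  all fixed points of \<open>g\<close>. Where the product of these over all such \<open>g\<close> is
  nonzero, the stabiliser is trivial.\<close>

lemma free_orbit: "\<exists>v. \<forall>g\<in>carrier G. \<forall>h\<in>carrier G. \<rho> g v = \<rho> h v \<longrightarrow> g = h"
proof -
  have "\<forall>g\<in>carrier G - {\<one>}. \<exists>f. f \<in> PF \<and> f \<noteq> 0 \<and> (\<forall>v. \<rho> g v = v \<longrightarrow> f v = 0)"
  proof
    fix g assume g: "g \<in> carrier G - {\<one>}"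
    then obtain u where u: "\<rho> g u \<noteq> u" using faithful by blast
    then obtain l where l: "Vector_Spaces.linear scale (*) l" "l (\<rho> g u - u) \<noteq> 0"
      using separating[of "\<rho> g u - u"] by auto
    interpret l: Vector_Spaces.linear scale "(*)" l by (rule l(1))
    have lPF: "l \<in> PF" by (rule lin_fun_in_poly_funs[OF l(1)])
    have "(\<lambda>v. l (\<rho> g v)) \<in> PF" by (rule poly_funs_comp[OF lPF rho_linear]) (use g in blast)
    hence "(\<lambda>v. l (\<rho> g v)) - l \<in> PF" using lPF PF_closed(4) by blast
    moreover have "((\<lambda>v. l (\<rho> g v)) - l) u \<noteq> 0" using l(2) by (simp add: l.diff)
    hence "(\<lambda>v. l (\<rho> g v)) - l \<noteq> 0" by (metis zero_fun_apply)
    moreover have "\<forall>v. \<rho> g v = v \<longrightarrow> ((\<lambda>v. l (\<rho> g v)) - l) v = 0" by simp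
    ultimately show "\<exists>f. f \<in> PF \<and> f \<noteq> 0 \<and> (\<forall>v. \<rho> g v = v \<longrightarrow> f v = 0)" by blast
  qed
  then obtain f where f: "\<forall>g\<in>carrier G - {\<one>}. f g \<in> PF \<and> f g \<noteq> 0 \<and> (\<forall>v. \<rho> g v = v \<longrightarrow> f g v = 0)"
    by (rule bchoice[THEN exE])
  have "prod f (carrier G - {\<one>}) \<noteq> 0"
    using PF_nz_prod[of "carrier G - {\<one>}" f] f finite_G by blast
  then obtain v where v: "prod f (carrier G - {\<one>}) v \<noteq> 0" by (metis ext zero_fun_apply)
  have nofix: "g = \<one>" if "g \<in> carrier G" "\<rho> g v = v" for g
  proof (rule ccontr)
    assume "g \<noteq> \<one>"
    hence g: "g \<in> carrier G - {\<one>}" using that(1) by blast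
    hence "f g v = 0" using f that(2) by blast
    thus False using v g finite_G by (auto simp: prod_fun_apply)
  qed
  have "g = h" if "g \<in> carrier G" "h \<in> carrier G" "\<rho> g v = \<rho> h v" for g h
  proof -
    have "\<rho> (inv h \<otimes> g) v = v" using that rho_mult[of "inv h" g v] rho_inv(1)[of h v] by simp
    hence "inv h \<otimes> g = \<one>" using nofix that by simp
    thus ?thesis using that by (metis inv_closed inv_equality inv_inv)
  qed
  thus ?thesis by blast
qed

text \<open>Interpolation on a free orbit: for each \<open>h\<close> a product of affine functions
  vanishes at all orbit points except \<open>\<rho> h v\<close>, so the matrix of values is diagonal
  with nonzero diagonal.\<close>

lemma exists_nonsing: "\<exists>Y v. nonsing Y v"
proof -
  obtain v where v: "\<forall>g\<in>carrier G. \<forall>h\<in>carrier G. \<rho> g v = \<rho> h v \<longrightarrow> g = h"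
    using free_orbit by blast
  have sep: "\<exists>f. f \<in> PF \<and> f (\<rho> g v) = 0 \<and> f (\<rho> h v) \<noteq> 0"
    if "g \<in> carrier G" "h \<in> carrier G" "g \<noteq> h" for g h
  proof -
    have "\<rho> h v - \<rho> g v \<noteq> 0" using v that by auto
    then obtain l where l: "Vector_Spaces.linear scale (*) l" "l (\<rho> h v - \<rho> g v) \<noteq> 0"
      using separating by blast
    interpret l: Vector_Spaces.linear scale "(*)" l by (rule l(1))
    have "l - (\<lambda>_. l (\<rho> g v)) \<in> PF"
      using lin_fun_in_poly_funs[OF l(1)] const_in_poly_funs PF_closed(4) by blast
    moreover have "(l - (\<lambda>_. l (\<rho> g v))) (\<rho> h v) \<noteq> 0" using l(2) by (simp add: l.diff)
    ultimately show ?thesis by (intro exI[of _ "l - (\<lambda>_. l (\<rho> g v))"]) simp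
  qed
  have "\<forall>h\<in>carrier G. \<exists>y. y \<in> PF \<and> (\<forall>g\<in>carrier G. y (\<rho> g v) \<noteq> 0 \<longleftrightarrow> g = h)"
  proof
    fix h assume h: "h \<in> carrier G"
    have "\<forall>g\<in>carrier G - {h}. \<exists>f. f \<in> PF \<and> f (\<rho> g v) = 0 \<and> f (\<rho> h v) \<noteq> 0"
      using sep h by blast
    then obtain f where f: "\<forall>g\<in>carrier G - {h}. f g \<in> PF \<and> f g (\<rho> g v) = 0 \<and> f g (\<rho> h v) \<noteq> 0"
      by (rule bchoice[THEN exE])
    have "prod f (carrier G - {h}) \<in> PF" by (rule poly_funs_prod) (use f in blast)
    moreover have "prod f (carrier G - {h}) (\<rho> g v) \<noteq> 0 \<longleftrightarrow> g = h" if "g \<in> carrier G" for g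
      using f that finite_G by (auto simp: prod_fun_apply)
    ultimately show "\<exists>y. y \<in> PF \<and> (\<forall>g\<in>carrier G. y (\<rho> g v) \<noteq> 0 \<longleftrightarrow> g = h)" by blast
  qed
  then obtain y where y: "\<forall>h\<in>carrier G. y h \<in> PF \<and> (\<forall>g\<in>carrier G. y h (\<rho> g v) \<noteq> 0 \<longleftrightarrow> g = h)"
    by (rule bchoice[THEN exE])
  have inj: "inj_on y (carrier G)" by (rule inj_onI) (metis y)
  have "c (y h) = 0" if eq: "\<forall>g\<in>carrier G. (\<Sum>b\<in>y ` carrier G. c b * b (\<rho> g v)) = 0"
    and h: "h \<in> carrier G" for c h
  proof -
    have "0 = (\<Sum>g\<in>carrier G. c (y g) * y g (\<rho> h v))"
      using bspec[OF eq h] by (simp add: sum.reindex[OF inj])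
    also have "\<dots> = c (y h) * y h (\<rho> h v) + (\<Sum>g\<in>carrier G - {h}. c (y g) * y g (\<rho> h v))"
      by (rule sum.remove[OF finite_G h])
    also have "(\<Sum>g\<in>carrier G - {h}. c (y g) * y g (\<rho> h v)) = 0"
      by (rule sum.neutral) (use y h in auto)
    finally show ?thesis using y h by auto
  qed
  hence "nonsing (y ` carrier G) v"
    unfolding nonsing_def using finite_G y card_image[OF inj] by blast
  thus ?thesis by blast
qed

text \<open>\<open>LEAST\<close> has its intended meaning only if some degree works. A nonsingular
  family is finite, hence of bounded degree, and it already spans.\<close>

lemma spanning_degree_spans:
  "spans_over KV KVG (emb ` poly_funs_le scale (spanning_degree G scale \<rho>))"
proof -
  obtain Y v where ns: "nonsing Y v" using exists_nonsing by blast
  have Y: "finite Y" "Y \<subseteq> PF" using ns unfolding nonsing_def by blast+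
  have "\<exists>d. Y \<subseteq> poly_funs_le scale d" using Y
  proof (induction Y rule: finite_induct)
    case (insert y Y)
    obtain d e where d: "Y \<subseteq> poly_funs_le scale d" and e: "y \<in> poly_funs_le scale e"
      using insert unfolding poly_funs_eq_Union_le by blast
    have "insert y Y \<subseteq> poly_funs_le scale (max d e)"
      using d e poly_funs_le_mono[of d "max d e" scale] poly_funs_le_mono[of e "max d e" scale] by auto
    thus ?case by blast
  qed simp
  then obtain d where d: "Y \<subseteq> poly_funs_le scale d" by blast
  have "spans_over KV KVG (emb ` poly_funs_le scale d)"
    using nonsing_spans[OF ns] d poly_funs_le_subset[of scale d] emb_carrier unfolding spans_over_def
    by (meson image_mono image_subsetI subset_trans subsetD)
  thus ?thesis unfolding spanning_degree_def by (rule LeastI)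
qed

lemma evaluation_surjective:
  "\<exists>v. \<forall>y. \<exists>m\<in>poly_funs_le scale (spanning_degree G scale \<rho>). \<forall>g\<in>carrier G. m (\<rho> g v) = y g"
  using spans_over_imp_surjective[OF subspace_poly_funs_le poly_funs_le_subset spanning_degree_spans]
    exists_nonsing by blast

end

section \<open>The regular representation inside polynomial functions\<close>

context group
begin

lemma regular_act_linear_on: "linear_on UNIV (regular_act G g)"
  by (auto simp: linear_on_def regular_act_def fscale_def fun_eq_iff)

lemma subspace_regular_space: "fun_space.subspace (regular_space G)"
  by (rule fun_space.subspaceI) (auto simp: regular_space_def fscale_def)

lemma regular_submodule: "kG_submodule G (regular_act G) (regular_space G)"
  unfolding kG_submodule_def using subspace_regular_space by (auto simp: regular_space_def regular_act_def)

text \<open>The group element \<open>g\<close> as a member of kG, given by its coefficient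
  function.\<close>

definition delta :: "'a \<Rightarrow> 'a \<Rightarrow> 'k::field" where
  "delta g = (\<lambda>x. if x = g then 1 else 0)"

lemma delta_in_regular_space: "g \<in> carrier G \<Longrightarrow> delta g \<in> regular_space G"
  by (auto simp: delta_def regular_space_def)

lemma regular_act_delta:
  "g \<in> carrier G \<Longrightarrow> h \<in> carrier G \<Longrightarrow> regular_act G g (delta h) = delta (g \<otimes> h)"
  by (auto simp: regular_act_def delta_def fun_eq_iff m_assoc[symmetric])

lemma regular_space_expand:
  assumes fin: "finite (carrier G)" and a: "a \<in> regular_space G"
  shows "(\<Sum>g\<in>carrier G. fscale (a g) (delta g)) = a"
proof
  fix x
  have "(\<Sum>g\<in>carrier G. fscale (a g) (delta g)) x = (\<Sum>g\<in>carrier G. if x = g then a g else 0)"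
    unfolding sum_fun_apply by (intro sum.cong) (auto simp: fscale_def delta_def)
  also have "\<dots> = a x" using a fin by (auto simp: regular_space_def)
  finally show "(\<Sum>g\<in>carrier G. fscale (a g) (delta g)) x = a x" .
qed

lemma span_delta:
  assumes "finite (carrier G)"
  shows "fun_space.span (delta ` carrier G) = (regular_space G :: ('a \<Rightarrow> 'k::field) set)"
proof
  show "fun_space.span (delta ` carrier G) \<subseteq> (regular_space G :: ('a \<Rightarrow> 'k) set)"
    by (rule fun_space.span_minimal[OF _ subspace_regular_space]) (use delta_in_regular_space in blast)
  show "(regular_space G :: ('a \<Rightarrow> 'k) set) \<subseteq> fun_space.span (delta ` carrier G)"
  proof
    fix a :: "'a \<Rightarrow> 'k" assume "a \<in> regular_space G"
    hence a: "a = (\<Sum>g\<in>carrier G. fscale (a g) (delta g))" using regular_space_expand assms by metis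
    have "(\<Sum>g\<in>carrier G. fscale (a g) (delta g)) \<in> fun_space.span (delta ` carrier G)"
      by (intro fun_space.span_sum fun_space.span_scale fun_space.span_base) simp
    thus "a \<in> fun_space.span (delta ` carrier G)" using a by (simp only:)
  qed
qed

lemma inj_delta: "inj_on (delta :: 'a \<Rightarrow> 'a \<Rightarrow> 'k::field) X"
proof (rule inj_onI)
  fix x y :: 'a assume "(delta x :: 'a \<Rightarrow> 'k) = delta y"
  hence "(delta x :: 'a \<Rightarrow> 'k) x = delta y x" by simp
  thus "x = y" by (simp add: delta_def split: if_splits)
qed

lemma independent_delta:
  assumes "finite (carrier G)"
  shows "fun_space.independent (delta ` carrier G :: ('a \<Rightarrow> 'k::field) set)"
proof (rule fun_space.independent_if_scalars_zero)
  fix f :: "('a \<Rightarrow> 'k) \<Rightarrow> 'k" and x :: "'a \<Rightarrow> 'k"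
  assume eq: "(\<Sum>x\<in>delta ` carrier G. fscale (f x) x) = 0" and "x \<in> delta ` carrier G"
  then obtain g where g: "g \<in> carrier G" "x = delta g" by blast
  have "0 = (\<Sum>h\<in>carrier G. fscale (f (delta h)) (delta h)) g"
    using eq by (simp add: sum.reindex[OF inj_delta])
  also have "\<dots> = (\<Sum>h\<in>carrier G. if g = h then f (delta h) else 0)"
    unfolding sum_fun_apply by (intro sum.cong) (auto simp: fscale_def delta_def)
  also have "\<dots> = f x" using g assms by simp
  finally show "f x = 0" by simp
qed (use assms in simp)

end

section \<open>Evaluation along an orbit and the graded regular summand\<close>

context faithful_poly_rep
begin

definition ev :: "'v \<Rightarrow> ('v \<Rightarrow> 'k) \<Rightarrow> 'g \<Rightarrow> 'k" where
  "ev v m = (\<lambda>x. if x \<in> carrier G then m (\<rho> x v) else 0)"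

lemma ev_linear_on: "linear_on UNIV (ev v)"
  by (auto simp: linear_on_def ev_def fscale_def fun_eq_iff)

text \<open>The two conventions match: \<open>act g u\<close> at \<open>\<rho> x v\<close> is
  \<open>u\<close> at the orbit point of \<open>inv g \<otimes> x\<close>.\<close>

lemma ev_hom: "kG_hom G act U (regular_act G) (regular_space G) (ev v)"
  unfolding kG_hom_def
proof (intro conjI ballI)
  show "ev v ` U \<subseteq> regular_space G" by (auto simp: ev_def regular_space_def)
  show "linear_on U (ev v)" by (rule linear_on_subset[OF ev_linear_on]) simp
  fix g u assume "g \<in> carrier G"
  thus "ev v (act g u) = regular_act G g (ev v u)"
    by (auto simp: ev_def regular_act_def act_apply fun_eq_iff rho_mult)
qed

lemma ev_sum: "ev v (sum f I) = (\<Sum>i\<in>I. ev v (f i))"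
  by (rule linear_on_sum[OF fun_space.subspace_UNIV ev_linear_on]) simp

text \<open>kG is free on its unit, so a preimage \<open>m0\<close> of \<open>delta \<one>\<close>
  extends to a section, sending \<open>a\<close> to the sum of the \<open>act g m0\<close> weighted
  by \<open>a g\<close>. The action preserves degree, so using the component \<open>h d\<close> in
  place of \<open>m0\<close> gives equivariant maps \<open>s d\<close>, to which
  \<open>graded_lift\<close> applies.\<close>

lemma graded_regular_submodule:
  assumes surj: "\<And>y. \<exists>m\<in>poly_funs_le scale D. \<forall>g\<in>carrier G. m (\<rho> g v) = y g"
  obtains V where "\<And>d. d \<le> D \<Longrightarrow> kG_submodule G act (V d) \<and> V d \<subseteq> hom_poly_funs scale d"
    "\<And>p. p \<in> regular_space G \<Longrightarrow> \<exists>!h. h \<in> (\<Pi>\<^sub>E d\<in>{..D}. V d) \<and> (\<Sum>d\<le>D. ev v (h d)) = p"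
proof -
  obtain m0 where m0: "m0 \<in> poly_funs_le scale D" "\<forall>g\<in>carrier G. m0 (\<rho> g v) = delta \<one> g"
    using surj by blast
  obtain h where h: "\<And>d. d \<le> D \<Longrightarrow> h d \<in> hom_poly_funs scale d" "m0 = (\<Sum>d\<le>D. h d)"
    using poly_funs_le_decompose[OF m0(1)] by blast
  define s where "s d a = (\<Sum>g\<in>carrier G. fscale (a g) (act g (h d)))" for d and a :: "'g \<Rightarrow> 'k"
  have evm0: "ev v m0 = delta \<one>"
    using m0(2) by (auto simp: ev_def delta_def fun_eq_iff)
  have sM: "s d a \<in> hom_poly_funs scale d" if "d \<le> D" for d a
    unfolding s_def using h(1)[OF that] act_hom fun_space.subspace_scale[OF subspace_hom_poly_funs]
    by (intro fun_space.subspace_sum[OF subspace_hom_poly_funs]) blast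
  have sub: "kG_submodule G act (hom_poly_funs scale d)" for d
    unfolding kG_submodule_def using subspace_hom_poly_funs act_hom by blast
  have shom: "kG_hom G (regular_act G) (regular_space G) act (hom_poly_funs scale d) (s d)" if d: "d \<le> D" for d
    unfolding kG_hom_def
  proof (intro conjI ballI)
    show "s d ` regular_space G \<subseteq> hom_poly_funs scale d" using sM[OF d] by blast
    show "linear_on (regular_space G) (s d)"
      unfolding linear_on_def s_def
      by (simp add: fun_space.scale_left_distrib sum.distrib fun_space.scale_sum_right)
         (simp add: fscale_def)
    fix x and a :: "'g \<Rightarrow> 'k" assume x: "x \<in> carrier G"
    have "s d (regular_act G x a) = (\<Sum>g\<in>carrier G. fscale (a (inv x \<otimes> g)) (act g (h d)))"
      unfolding s_def regular_act_def by simp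
    also have "\<dots> = (\<Sum>g\<in>carrier G. fscale (a g) (act (x \<otimes> g) (h d)))"
      by (rule sum.reindex_bij_witness[of _ "\<lambda>g. x \<otimes> g" "\<lambda>g. inv x \<otimes> g"])
         (use x in \<open>auto simp: m_assoc[symmetric]\<close>)
    also have "\<dots> = act x (s d a)"
      unfolding s_def act_sum act_simps(7) using x by (intro sum.cong refl) (simp add: act_act)
    finally show "s d (regular_act G x a) = act x (s d a)" .
  qed
  have id: "(\<Sum>d\<le>D. ev v (s d p)) = p" if p: "p \<in> regular_space G" for p
  proof -
    have "(\<Sum>d\<le>D. s d p) = (\<Sum>g\<in>carrier G. \<Sum>d\<le>D. fscale (p g) (act g (h d)))"
      unfolding s_def by (rule sum.swap)
    also have "\<dots> = (\<Sum>g\<in>carrier G. fscale (p g) (act g m0))"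
      unfolding h(2) act_sum fun_space.scale_sum_right ..
    finally have sm: "(\<Sum>d\<le>D. s d p) = (\<Sum>g\<in>carrier G. fscale (p g) (act g m0))" .
    have "(\<Sum>d\<le>D. ev v (s d p)) = (\<Sum>g\<in>carrier G. ev v (fscale (p g) (act g m0)))"
      unfolding ev_sum[symmetric] sm ..
    also have "\<dots> = (\<Sum>g\<in>carrier G. fscale (p g) (delta g))"
    proof (intro sum.cong refl)
      fix g assume g: "g \<in> carrier G"
      have "ev v (fscale (p g) (act g m0)) = fscale (p g) (ev v (act g m0))"
        using ev_linear_on unfolding linear_on_def by blast
      also have "ev v (act g m0) = regular_act G g (ev v m0)"
        using ev_hom[of UNIV v] g unfolding kG_hom_def by blast
      also have "\<dots> = delta g" unfolding evm0 using g by (simp add: regular_act_delta)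
      finally show "ev v (fscale (p g) (act g m0)) = fscale (p g) (delta g)" .
    qed
    also have "\<dots> = p" by (rule regular_space_expand[OF finite_G p])
    finally show ?thesis .
  qed
  have "\<exists>V. (\<forall>d\<in>{..D}. kG_submodule G act (V d) \<and> V d \<subseteq> hom_poly_funs scale d) \<and>
    (\<forall>p\<in>regular_space G. \<exists>!h. h \<in> (\<Pi>\<^sub>E d\<in>{..D}. V d) \<and> (\<Sum>d\<in>{..D}. ev v (h d)) = p)"
    by (rule graded_lift[where S = "delta ` carrier G" and act = "regular_act G" and s = s])
       (use finite_G regular_submodule span_delta regular_act_linear_on sub shom ev_hom id in auto)
  then obtain V where V: "(\<forall>d\<in>{..D}. kG_submodule G act (V d) \<and> V d \<subseteq> hom_poly_funs scale d) \<and>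
    (\<forall>p\<in>regular_space G. \<exists>!h. h \<in> (\<Pi>\<^sub>E d\<in>{..D}. V d) \<and> (\<Sum>d\<in>{..D}. ev v (h d)) = p)"
    by (rule exE)
  show ?thesis
    by (rule that[of V]) (use V in auto)
qed

text \<open>Unique existence of tuples with prescribed image makes \<open>ev v\<close> bijective
  from the sum \<open>U\<close> of the pieces onto kG, which gives the summand, the isomorphism and
  the basis. The grading rests instead on homogeneous components being determined by their
  sum.\<close>

lemma graded_regular_summand:
  "\<exists>Vreg :: ('v \<Rightarrow> 'k) set.
    kG_direct_summand G (fun_act G \<rho>) Vreg (poly_funs_le scale (spanning_degree G scale \<rho>)) \<and>
    kG_isomorphic G (fun_act G \<rho>) Vreg
      (regular_act G) (regular_space G :: ('g \<Rightarrow> 'k) set) \<and>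
    internal_direct_sum Vreg {0..spanning_degree G scale \<rho>}
      (\<lambda>d. Vreg \<inter> hom_poly_funs scale d) \<and>
    (\<forall>B. fun_basis Vreg B \<longrightarrow>
      basis_over (rat_fun_field scale) (invariant_field G scale \<rho>)
        (frac_emb (poly_fun_ring scale) ` B))"
proof -
  define D where "D = spanning_degree G scale \<rho>"
  define M where "M = poly_funs_le scale D"
  have sM: "fun_space.subspace M" unfolding M_def by (rule subspace_poly_funs_le)
  obtain v where v: "\<And>y. \<exists>m\<in>M. \<forall>g\<in>carrier G. m (\<rho> g v) = y g"
    using evaluation_surjective unfolding M_def D_def by blast
  obtain V where V: "\<And>d. d \<le> D \<Longrightarrow> kG_submodule G act (V d) \<and> V d \<subseteq> hom_poly_funs scale d"
    and uV: "\<And>p. p \<in> regular_space G \<Longrightarrow> \<exists>!h. h \<in> (\<Pi>\<^sub>E d\<in>{..D}. V d) \<and> (\<Sum>d\<le>D. ev v (h d)) = p"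
    using graded_regular_submodule[OF v[unfolded M_def]] by metis
  have Vsub: "fun_space.subspace (V d)" if "d \<le> D" for d
    using V[OF that] by (simp add: kG_submodule_def)
  define U where "U = {\<Sum>d\<le>D. h d | h. \<forall>d\<le>D. h d \<in> V d}"
  have UI: "(\<Sum>d\<le>D. h d) \<in> U" if "\<And>d. d \<le> D \<Longrightarrow> h d \<in> V d" for h
    unfolding U_def using that by blast
  have UE: "\<exists>h. (\<forall>d\<le>D. h d \<in> V d) \<and> u = (\<Sum>d\<le>D. h d)" if "u \<in> U" for u
    using that unfolding U_def by blast
  have sU: "fun_space.subspace U"
  proof (rule fun_space.subspaceI)
    show "0 \<in> U" using UI[of "\<lambda>_. 0"] fun_space.subspace_0[OF Vsub] by (simp only: sum.neutral_const)
  next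
    fix x y assume xU: "x \<in> U" and yU: "y \<in> U"
    obtain h where h: "\<forall>d\<le>D. h d \<in> V d" "x = (\<Sum>d\<le>D. h d)"
      using UE[OF xU] by (elim exE conjE)
    obtain h' where h': "\<forall>d\<le>D. h' d \<in> V d" "y = (\<Sum>d\<le>D. h' d)"
      using UE[OF yU] by (elim exE conjE)
    note * = h h'
    have "x + y = (\<Sum>d\<le>D. h d + h' d)" unfolding *(2,4) by (rule sum.distrib[symmetric])
    also have "\<dots> \<in> U" using * fun_space.subspace_add[OF Vsub] by (intro UI[of "\<lambda>d. h d + h' d"]) blast
    finally show "x + y \<in> U" .
  next
    fix c x assume xU: "x \<in> U"
    obtain h where *: "\<forall>d\<le>D. h d \<in> V d" "x = (\<Sum>d\<le>D. h d)" using UE[OF xU] by (elim exE conjE)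
    have "fscale c x = (\<Sum>d\<le>D. fscale c (h d))" unfolding *(2) by (rule fun_space.scale_sum_right)
    also have "\<dots> \<in> U" using * fun_space.subspace_scale[OF Vsub] by (intro UI[of "\<lambda>d. fscale c (h d)"]) blast
    finally show "fscale c x \<in> U" .
  qed
  have mU: "kG_submodule G act U"
    unfolding kG_submodule_def
  proof (intro conjI ballI sU)
    fix g u assume g: "g \<in> carrier G" and uU: "u \<in> U"
    obtain h where *: "\<forall>d\<le>D. h d \<in> V d" "u = (\<Sum>d\<le>D. h d)" using UE[OF uU] by (elim exE conjE)
    have "act g u = (\<Sum>d\<le>D. act g (h d))" unfolding *(2) by (rule act_sum)
    also have "\<dots> \<in> U" using * V g unfolding kG_submodule_def by (intro UI[of "\<lambda>d. act g (h d)"]) blast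
    finally show "act g u \<in> U" .
  qed
  have UM: "U \<subseteq> M"
  proof
    fix u assume uU: "u \<in> U"
    obtain h where *: "\<forall>d\<le>D. h d \<in> V d" "u = (\<Sum>d\<le>D. h d)" using UE[OF uU] by (elim exE conjE)
    show "u \<in> M" unfolding *(2)
    proof (rule fun_space.subspace_sum[OF sM])
      fix d assume "d \<in> {..D}"
      thus "h d \<in> M" using *(1) V[of d] hom_poly_funs_subset_le[of d D scale] unfolding M_def by blast
    qed
  qed
  have ev_surj: "\<exists>u\<in>U. ev v u = p" if p: "p \<in> regular_space G" for p
  proof -
    obtain h where h: "h \<in> (\<Pi>\<^sub>E d\<in>{..D}. V d)" "(\<Sum>d\<le>D. ev v (h d)) = p" using uV[OF p] by (elim ex1E conjE)
    have "(\<Sum>d\<le>D. h d) \<in> U" using h(1) by (intro UI[of h]) (auto simp: PiE_iff)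
    moreover have "ev v (\<Sum>d\<le>D. h d) = p" unfolding ev_sum by (rule h(2))
    ultimately show ?thesis by blast
  qed
  have evP: "ev v u \<in> regular_space G" for u by (auto simp: ev_def regular_space_def)
  have ev_inj: "inj_on (ev v) U"
  proof (rule inj_onI)
    fix x y assume xU: "x \<in> U" and yU: "y \<in> U" and xy: "ev v x = ev v y"
    obtain h where h: "\<forall>d\<le>D. h d \<in> V d" "x = (\<Sum>d\<le>D. h d)"
      using UE[OF xU] by (elim exE conjE)
    obtain h' where h': "\<forall>d\<le>D. h' d \<in> V d" "y = (\<Sum>d\<le>D. h' d)"
      using UE[OF yU] by (elim exE conjE)
    note * = h h'
    \<comment> \<open>Uniqueness concerns extensional tuples, so both families are cut down to
      \<open>{..D}\<close> before they are compared.\<close>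
    have "restrict h {..D} \<in> (\<Pi>\<^sub>E d\<in>{..D}. V d) \<and> (\<Sum>d\<le>D. ev v (restrict h {..D} d)) = ev v x"
      using *(1) by (auto simp: *(2) ev_sum)
    moreover have "restrict h' {..D} \<in> (\<Pi>\<^sub>E d\<in>{..D}. V d) \<and> (\<Sum>d\<le>D. ev v (restrict h' {..D} d)) = ev v x"
      unfolding xy using *(3) by (auto simp: *(4) ev_sum)
    ultimately have r: "restrict h {..D} = restrict h' {..D}" using uV[OF evP[of x]] by (elim ex1E) metis
    have "h d = h' d" if "d \<le> D" for d using fun_cong[OF r, of d] that by simp
    thus "x = y" unfolding *(2,4) by simp
  qed
  have ev_bij: "bij_betw (ev v) U (regular_space G)"
    unfolding bij_betw_def using ev_inj ev_surj evP by blast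
  have ev0: "ev v u = 0 \<Longrightarrow> u = 0" if "u \<in> U" for u
    using inj_onD[OF ev_inj _ that fun_space.subspace_0[OF sU]]
      linear_on_zero[OF fun_space.subspace_UNIV ev_linear_on] by metis
  have "kG_direct_summand G act U M"
    unfolding kG_direct_summand_def
  proof (intro conjI mU exI[of _ "{m \<in> M. ev v m = 0}"])
    let ?W = "{m \<in> M. ev v m = 0}"
    have lin: "ev v (x + y) = ev v x + ev v y" "ev v (fscale c x) = fscale c (ev v x)" for x y c
      using ev_linear_on unfolding linear_on_def by blast+
    have z: "ev v 0 = 0" by (rule linear_on_zero[OF fun_space.subspace_UNIV ev_linear_on])
    have sW: "fun_space.subspace ?W"
    proof (rule fun_space.subspaceI)
      show "0 \<in> ?W" using z fun_space.subspace_0[OF sM] by blast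
      show "x + y \<in> ?W" if "x \<in> ?W" "y \<in> ?W" for x y
        using that fun_space.subspace_add[OF sM] lin(1)[of x y] by (simp only: mem_Collect_eq add_0_left simp_thms)
      show "fscale c x \<in> ?W" if "x \<in> ?W" for c x
        using that fun_space.subspace_scale[OF sM] lin(2)[of c x]
        by (simp only: mem_Collect_eq fun_space.scale_zero_right simp_thms)
    qed
    show "kG_submodule G act ?W"
      unfolding kG_submodule_def
    proof (intro conjI ballI sW)
      fix g w assume g: "g \<in> carrier G" and w: "w \<in> ?W"
      have "ev v (act g w) = regular_act G g (ev v w)"
        using ev_hom[of UNIV v] g unfolding kG_hom_def by blast
      also have "\<dots> = 0" using w by (auto simp: regular_act_def fun_eq_iff)
      finally show "act g w \<in> ?W" using w act_le[OF g] unfolding M_def by blast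
    qed
    show "U \<inter> ?W = {0}"
      using ev0 fun_space.subspace_0[OF sU] fun_space.subspace_0[OF sW] by blast
    show "M = {u + w | u w. u \<in> U \<and> w \<in> ?W}"
    proof (intro equalityI subsetI)
      fix m assume m: "m \<in> M"
      obtain u where u: "u \<in> U" "ev v u = ev v m" using ev_surj evP by blast
      have "ev v (m - u) = 0"
        using linear_on_diff[OF fun_space.subspace_UNIV ev_linear_on, of m u] u(2) by (simp only: UNIV_I diff_self)
      moreover have "m - u \<in> M" using fun_space.subspace_diff[OF sM m] u(1) UM by blast
      moreover have "m = u + (m - u)" by simp
      ultimately show "m \<in> {u + w | u w. u \<in> U \<and> w \<in> ?W}" using u(1) by blast
    next
      fix m assume "m \<in> {u + w | u w. u \<in> U \<and> w \<in> ?W}"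
      thus "m \<in> M" using UM fun_space.subspace_add[OF sM] by blast
    qed
  qed
  moreover have "kG_isomorphic G act U (regular_act G) (regular_space G :: ('g \<Rightarrow> 'k) set)"
    unfolding kG_isomorphic_def
    using ev_bij ev_hom[of U v] unfolding kG_hom_def linear_on_def by (intro exI[of _ "ev v"]) blast
  moreover have "internal_direct_sum U {0..D} (\<lambda>d. U \<inter> hom_poly_funs scale d)"
    unfolding internal_direct_sum_def
  proof (intro conjI ballI)
    fix d :: nat
    show "fun_space.subspace (U \<inter> hom_poly_funs scale d)"
      by (rule fun_space.subspace_inter[OF sU subspace_hom_poly_funs])
    show "U \<inter> hom_poly_funs scale d \<subseteq> U" by blast
  next
    fix u assume uU: "u \<in> U"
    obtain h where h: "\<forall>d\<le>D. h d \<in> V d" "u = (\<Sum>d\<le>D. h d)" using UE[OF uU] by (elim exE conjE)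
    \<comment> \<open>Putting 0 in all other degrees shows that each component of \<open>u\<close>
      lies in \<open>U\<close> by itself.\<close>
    have hU: "h d \<in> U" if d: "d \<le> D" for d
    proof -
      have "h d = (\<Sum>e\<le>D. if e = d then h d else 0)" using d by (subst sum.delta) auto
      also have "\<dots> \<in> U"
        using h(1) fun_space.subspace_0[OF Vsub]
        by (intro UI[of "\<lambda>e. if e = d then h d else 0"]) (simp del: zero_fun_apply)
      finally show ?thesis .
    qed
    show "\<exists>!h. h \<in> (\<Pi>\<^sub>E d\<in>{0..D}. U \<inter> hom_poly_funs scale d) \<and> u = (\<Sum>d\<in>{0..D}. h d)"
    proof (rule ex1I[of _ "restrict h {0..D}"])
      show "restrict h {0..D} \<in> (\<Pi>\<^sub>E d\<in>{0..D}. U \<inter> hom_poly_funs scale d) \<and>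
          u = (\<Sum>d\<in>{0..D}. restrict h {0..D} d)"
      proof
        show "restrict h {0..D} \<in> (\<Pi>\<^sub>E d\<in>{0..D}. U \<inter> hom_poly_funs scale d)"
        proof (rule restrict_PiE_iff[THEN iffD2], rule ballI)
          fix d assume "d \<in> {0..D}"
          hence d: "d \<le> D" by simp
          show "h d \<in> U \<inter> hom_poly_funs scale d" using hU[OF d] h(1) V[OF d] d by blast
        qed
        show "u = (\<Sum>d\<in>{0..D}. restrict h {0..D} d)" unfolding h(2) atLeast0AtMost by simp
      qed
    next
      fix h' assume h': "h' \<in> (\<Pi>\<^sub>E d\<in>{0..D}. U \<inter> hom_poly_funs scale d) \<and> u = (\<Sum>d\<in>{0..D}. h' d)"
      \<comment> \<open>The values of \<open>h'\<close> are only known to be homogeneous elements of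
        \<open>U\<close>, not members of \<open>V d\<close>, so uniqueness of the tuples in
        \<open>V\<close> cannot be quoted.\<close>
      have "h' d = h d" if d: "d \<le> D" for d
      proof (rule hom_poly_funs_sum_inject[OF infinite_field _ _ _ d])
        show "h' e \<in> hom_poly_funs scale e" if "e \<le> D" for e using h' that by (auto simp: PiE_iff)
        show "h e \<in> hom_poly_funs scale e" if "e \<le> D" for e using h(1) V that by blast
        show "(\<Sum>d\<le>D. h' d) = (\<Sum>d\<le>D. h d)" using h' h(2) unfolding atLeast0AtMost by simp
      qed
      thus "h' = restrict h {0..D}"
        using h' by (intro extensionalityI[of _ "{0..D}"]) (auto simp: PiE_iff)
    qed
  qed
  moreover have "basis_over KV KVG (emb ` B)" if B: "fun_basis U B" for B
  proof -
    have iB: "fun_space.independent B" and spB: "fun_space.span B = U"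
      using B unfolding fun_basis_def by blast+
    have BU: "B \<subseteq> U" using spB fun_space.span_superset by blast
    have lin: "Vector_Spaces.linear fscale fscale (ev v)"
      using ev_linear_on[of v] unfolding linear_on_def Vector_Spaces.linear_iff
      by (auto intro: fun_space.vector_space_axioms)
    have inj: "inj_on (ev v) (fun_space.span B)" using ev_inj spB by simp
    have ind: "fun_space.independent (ev v ` B)"
      by (rule fun_pair.linear_independent_injective_image[OF lin iB inj])
    have "fun_space.span (ev v ` B) = (regular_space G :: ('g \<Rightarrow> 'k) set)"
      using fun_pair.linear_span_image[OF lin, of B] spB ev_bij unfolding bij_betw_def by simp
    \<comment> \<open>The image of \<open>B\<close> and the point masses are two bases of
      kG.\<close>
    hence "card (ev v ` B) = card (delta ` carrier G :: ('g \<Rightarrow> 'k) set)"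
      using fun_space.dim_span_eq_card_independent[OF ind]
        fun_space.dim_span_eq_card_independent[OF independent_delta[OF finite_G]]
        span_delta[OF finite_G, where 'k = 'k] by metis
    moreover have "card (ev v ` B) = card B" by (rule card_image[OF inj_on_subset[OF ev_inj BU]])
    moreover have "card (delta ` carrier G :: ('g \<Rightarrow> 'k) set) = card (carrier G)"
      by (rule card_image[OF inj_delta])
    ultimately have card: "card B = card (carrier G)" by simp
    moreover have "card (carrier G) > 0" using finite_G one_closed by (auto simp: card_gt_0_iff)
    \<comment> \<open>Infinite sets have \<open>card\<close> 0, whereas a group has at least one
      element.\<close>
    ultimately have finB: "finite B" using card.infinite by fastforce
    have "nonsing B v"
      unfolding nonsing_def
    proof (intro conjI allI impI ballI finB card)
      show "B \<subseteq> PF" using BU UM poly_funs_le_subset unfolding M_def by blast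
      \<comment> \<open>A relation among the orbit values means that the combination evaluates to 0,
        and evaluation is injective on \<open>U\<close>.\<close>
      fix c b assume eq: "\<forall>g\<in>carrier G. (\<Sum>b\<in>B. c b * b (\<rho> g v)) = 0" and b: "b \<in> B"
      have "ev v (\<Sum>b\<in>B. fscale (c b) b) = 0"
        using eq by (auto simp: ev_def fun_eq_iff sum_fun_apply fscale_def)
      moreover have "(\<Sum>b\<in>B. fscale (c b) b) \<in> U"
        using BU fun_space.subspace_scale[OF sU] by (intro fun_space.subspace_sum[OF sU]) blast
      ultimately have "(\<Sum>b\<in>B. fscale (c b) b) = 0" using ev0 by blast
      thus "c b = 0" using fun_space.independentD[OF iB finB order_refl _ b] by blast
    qed
    thus ?thesis by (rule nonsing_basis)
  qed
  ultimately show ?thesis unfolding M_def D_def by blast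
qed

end

theorem proposition2p10:
  fixes G :: "('g, 'm) monoid_scheme"
    and scale :: "'k::alg_closed_field \<Rightarrow> 'v::ab_group_add \<Rightarrow> 'v"
    and \<rho> :: "'g \<Rightarrow> 'v \<Rightarrow> 'v"
    and Basis :: "'v set"
  assumes "group G" and "finite (carrier G)"
    and "finite_dimensional_vector_space scale Basis"
    and "faithful_action G UNIV \<rho>"
    and "\<forall>g\<in>carrier G. Vector_Spaces.linear scale scale (\<rho> g)"
  shows "\<exists>Vreg :: ('v \<Rightarrow> 'k) set.
    kG_direct_summand G (fun_act G \<rho>) Vreg (poly_funs_le scale (spanning_degree G scale \<rho>)) \<and>
    kG_isomorphic G (fun_act G \<rho>) Vreg
      (regular_act G) (regular_space G :: ('g \<Rightarrow> 'k) set) \<and>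
    internal_direct_sum Vreg {0..spanning_degree G scale \<rho>}
      (\<lambda>d. Vreg \<inter> hom_poly_funs scale d) \<and>
    (\<forall>B. fun_basis Vreg B \<longrightarrow>
      basis_over (rat_fun_field scale) (invariant_field G scale \<rho>)
        (frac_emb (poly_fun_ring scale) ` B))"
proof -
  interpret group G by fact
  interpret fd: finite_dimensional_vector_space scale Basis by fact
  interpret faithful_action G UNIV \<rho> by fact
  interpret kk: vector_space "(*) :: 'k \<Rightarrow> 'k \<Rightarrow> 'k"
    by unfold_locales (auto simp: algebra_simps)
  interpret pr: vector_space_pair scale "(*) :: 'k \<Rightarrow> 'k \<Rightarrow> 'k" ..
  have one: "\<rho> \<one>\<^bsub>G\<^esub> v = v" for v using fun_cong[OF id_eq_one, of v] by simp
  interpret faithful_poly_rep G scale \<rho>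
  proof
    show "finite (carrier G)" by fact
    show "infinite (UNIV :: 'k set)" by (rule alg_closed_infinite)
    show "\<rho> \<one>\<^bsub>G\<^esub> v = v" for v by (rule one)
    show "\<rho> (g \<otimes>\<^bsub>G\<^esub> h) v = \<rho> g (\<rho> h v)" if "g \<in> carrier G" "h \<in> carrier G" for g h v
      using composition_rule[OF _ that] by simp
    show "g = \<one>\<^bsub>G\<^esub>" if "g \<in> carrier G" "\<And>v. \<rho> g v = v" for g
    proof -
      \<comment> \<open>Here \<open>faithful\<close> is injectivity of the map from \<open>g\<close>
        to \<open>\<rho> g\<close>, so it is enough to act like the unit.\<close>
      have "\<rho> g = \<rho> \<one>\<^bsub>G\<^esub>" using that(2) one by auto
      thus ?thesis using faithful that(1) by (auto dest: inj_onD)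
    qed
    show "\<exists>l. Vector_Spaces.linear scale (*) l \<and> l v \<noteq> (0 :: 'k)" if "v \<noteq> 0" for v
    proof -
      \<comment> \<open>A nonzero vector is independent, so some functional takes the value 1 on
        it.\<close>
      have "fd.independent {v}" using that by simp
      from pr.linear_independent_extend[OF this, of "\<lambda>_. 1"]
      show ?thesis by auto
    qed
  qed (use assms(5) in \<open>auto simp: Vector_Spaces.linear_iff\<close>)
  show ?thesis by (rule graded_regular_summand)
qed

end
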